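(* Let $\mathbf{k}$ be a field (of arbitrary characteristic) and let $Q$ be a connected, finite, acyclic quiver with vertex set $Q_0=\{1,\dots,r\}$. Assume that $Q$ is non-Dynkin. Let $\Pi=\Pi(Q)$ be the preprojective algebra of $Q$ over $\mathbf{k}$, graded by path length, and let $C$ be the adjacency matrix of the double quiver $\overline{Q}$. Then the (matrix-valued) Hilbert series of $\Pi$ is $$h_{\Pi}(t)=\frac{1}{1-Ct+t^{2}}$$ as an identity in the ring $M_r(\mathbb{Z})[[t]]$.
   Context: A quiver is Dynkin if its underlying graph is a Dynkin diagram of type $A_n$, $D_n$, $E_6$, $E_7$ or $E_8$; non-Dynkin means not Dynkin. The double quiver $\overline{Q}$ is obtained from $Q$ by adding an opposite arrow $\alpha^*:j\to i$ for each arrow $\alpha:i\to j$ of $Q$. For an arrow $\alpha: i\to j$ write $t(\alpha)=i$ and $h(\alpha)=j$; paths are composed from left to right, so $\alpha\alpha^*$ is a cycle at $t(\alpha)$. For $i\in Q_0$ the mesh relation at $i$ is $$\rho_i=\sum_{\alpha\in Q_1:\,t(\alpha)=i}\alpha\alpha^*-\sum_{\alpha\in Q_1:\,h(\alpha)=i}\alpha^*\alpha\in\mathbf{k}\overline{Q}.$$ The preprojective algebra is $\Pi(Q)=\mathbf{k}\overline{Q}/(\rho_i\mid i\in Q_0)$. It is graded by path length (all $\alpha,\alpha^*$ have degree $1$, so $\rho_i$ is homogeneous of degree $2$), and each graded piece $\Pi_n$ is finite dimensional. Let $e_i$ be the idempotent at vertex $i$ and $A=\mathbf{k}Q_0=\prod_i\mathbf{k}e_i$.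 For a finite dimensional $A$-$A$-bimodule $M$, its dimension matrix is $[M]=(\dim_{\mathbf{k}}e_iMe_j)_{i,j}\in M_r(\mathbb{Z})$. The Hilbert series is $h_\Pi(t)=\sum_{n\ge0}[\Pi_n]t^n\in M_r(\mathbb{Z})[[t]]$. The adjacency matrix of $\overline{Q}$ is $C=[\mathbf{k}\overline{Q}_1]=[V]+[V]^{t}$, where $V=\mathbf{k}Q_1$ is the arrow bimodule of $Q$. In $1-Ct+t^2$, the symbol $1$ denotes the identity matrix and $t^2$ is $t^2$ times the identity matrix; the fraction denotes the inverse in $M_r(\mathbb{Z})[[t]]$. *)

theory Defs
  imports
    "HOL-Analysis.Cartesian_Space"
    "HOL-Computational_Algebra.Formal_Power_Series"
    "HOL-Algebra.QuotRing"
    "HOL-Algebra.Embedded_Algebras"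
    "Graph_Theory.Graph_Theory"
begin

section \<open>The ring of square matrices\<close>

text \<open>The library multiplies elements of \<^typ>\<open>'a ^ 'n ^ 'n\<close> entrywise when they are combined with
  \<open>*\<close>. The following copy of that type carries matrix multiplication instead, so that
  \<open>(int, 'n) sqmat fps\<close> is the ring of formal power series over the ring of integer matrices.\<close>

typedef (overloaded) ('a, 'n) sqmat = "UNIV :: ('a ^ 'n ^ 'n) set"
  morphisms mat_of_sqmat Sqmat ..

setup_lifting type_definition_sqmat

instantiation sqmat :: (ring_1, finite) ring_1
begin

lift_definition zero_sqmat :: "('a, 'b) sqmat" is 0 .
lift_definition one_sqmat :: "('a, 'b) sqmat" is "mat 1" .
lift_definition plus_sqmat :: "('a, 'b) sqmat \<Rightarrow> ('a, 'b) sqmat \<Rightarrow> ('a, 'b) sqmat" is "(+)" .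
lift_definition minus_sqmat :: "('a, 'b) sqmat \<Rightarrow> ('a, 'b) sqmat \<Rightarrow> ('a, 'b) sqmat" is "(-)" .
lift_definition uminus_sqmat :: "('a, 'b) sqmat \<Rightarrow> ('a, 'b) sqmat" is uminus .
lift_definition times_sqmat :: "('a, 'b) sqmat \<Rightarrow> ('a, 'b) sqmat \<Rightarrow> ('a, 'b) sqmat" is "(**)" .

instance
proof
  fix a b c :: "('a, 'b) sqmat"
  show "a * b * c = a * (b * c)"
    by transfer
      (simp add: matrix_matrix_mult_def vec_eq_iff sum_distrib_left sum_distrib_right mult.assoc,
       intro allI, rule sum.swap)
  show "1 * a = a"
    by transfer (simp add: matrix_matrix_mult_def mat_def vec_eq_iff if_distrib if_distribR
        cong: if_cong)
  show "a * 1 = a"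
    by transfer (simp add: matrix_matrix_mult_def mat_def vec_eq_iff if_distrib if_distribR
        cong: if_cong)
  show "(a + b) * c = a * c + b * c"
    by transfer (simp add: matrix_matrix_mult_def vec_eq_iff distrib_right sum.distrib)
  show "a * (b + c) = a * b + a * c"
    by transfer (simp add: matrix_matrix_mult_def vec_eq_iff distrib_left sum.distrib)
  show "(0 :: ('a, 'b) sqmat) \<noteq> 1"
    by transfer (auto simp: mat_def vec_eq_iff)
qed (transfer; simp)+

end


section \<open>Quivers\<close>

text \<open>A quiver is a directed multigraph, with \<^const>\<open>tail\<close> and \<^const>\<open>head\<close> the source
  and the target of an arrow.\<close>

definition acyclic_quiver :: "('v, 'a) pre_digraph \<Rightarrow> bool" where
  "acyclic_quiver Q \<longleftrightarrow> \<not> (\<exists>p. pre_digraph.cycle Q p)"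

text \<open>The edge sets of the Dynkin diagrams on the vertices \<open>1, \<dots>, n\<close>: in type D the vertex \<open>n\<close>
  is joined to the chain \<open>1, \<dots>, n - 1\<close> at \<open>n - 2\<close>, in type E at \<open>3\<close>.\<close>

definition chain_edges :: "nat \<Rightarrow> nat set set" where
  "chain_edges n = {{i, i + 1} | i. 1 \<le> i \<and> i < n}"

definition dynkin_A :: "nat \<Rightarrow> nat set set" where
  "dynkin_A n = chain_edges n"

definition dynkin_D :: "nat \<Rightarrow> nat set set" where
  "dynkin_D n = insert {n - 2, n} (chain_edges (n - 1))"

definition dynkin_E :: "nat \<Rightarrow> nat set set" where
  "dynkin_E n = insert {3, n} (chain_edges (n - 1))"

text \<open>Sending each arrow to its pair of end points has to be injective on arrows, so parallel
  arrows are excluded; loops are excluded because the edges on the right are two-element sets.\<close>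

definition underlying_graph_iso :: "('v, 'a) pre_digraph \<Rightarrow> nat \<Rightarrow> nat set set \<Rightarrow> bool" where
  "underlying_graph_iso Q n E \<longleftrightarrow>
     (\<exists>f. bij_betw f (verts Q) {1..n} \<and>
          bij_betw (\<lambda>a. {f (tail Q a), f (head Q a)}) (arcs Q) E)"

definition dynkin_quiver :: "('v, 'a) pre_digraph \<Rightarrow> bool" where
  "dynkin_quiver Q \<longleftrightarrow>
     (\<exists>n\<ge>1. underlying_graph_iso Q n (dynkin_A n)) \<or>
     (\<exists>n\<ge>4. underlying_graph_iso Q n (dynkin_D n)) \<or>
     (\<exists>n\<in>{6, 7, 8}. underlying_graph_iso Q n (dynkin_E n))"

text \<open>\<^term>\<open>Inl a\<close> is the arrow \<open>a\<close> itself and \<^term>\<open>Inr a\<close> its opposite \<open>a*\<close>.\<close>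

definition double_quiver :: "('v, 'a) pre_digraph \<Rightarrow> ('v, 'a + 'a) pre_digraph" where
  "double_quiver Q =
     \<lparr> verts = verts Q, arcs = arcs Q <+> arcs Q,
       tail = case_sum (tail Q) (head Q), head = case_sum (head Q) (tail Q) \<rparr>"

definition adjacency_matrix :: "('v::finite, 'b) pre_digraph \<Rightarrow> (int, 'v) sqmat" where
  "adjacency_matrix G =
     Sqmat (\<chi> i j. int (card {b \<in> arcs G. tail G b = i \<and> head G b = j}))"


section \<open>Path algebras\<close>

text \<open>A path is recorded together with both of its end points; \<^term>\<open>(i, [], i)\<close> is the trivial
  path at \<open>i\<close>.\<close>

type_synonym ('v, 'b) path = "'v \<times> 'b list \<times> 'v"

definition paths :: "('v, 'b) pre_digraph \<Rightarrow> ('v, 'b) path set" where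
  "paths G = {(u, p, v). pre_digraph.awalk G u p v}"

definition path_factorizations ::
    "('v, 'b) pre_digraph \<Rightarrow> ('v, 'b) path \<Rightarrow> (('v, 'b) path \<times> ('v, 'b) path) set" where
  "path_factorizations G x =
     {((u, p, w), (w, q, v)) | u p w q v.
        (u, p, w) \<in> paths G \<and> (w, q, v) \<in> paths G \<and> x = (u, p @ q, v)}"

text \<open>An element of the path algebra is the finitely supported function of its coefficients in the
  basis of paths. Paths are composed from left to right.\<close>

definition path_algebra :: "('v, 'b) pre_digraph \<Rightarrow> (('v, 'b) path \<Rightarrow> 'k::field) ring" where
  "path_algebra G =
     \<lparr> carrier = {f. finite {x. f x \<noteq> 0} \<and> {x. f x \<noteq> 0} \<subseteq> paths G},
       mult = (\<lambda>f g x. \<Sum>(y, z) \<in> path_factorizations G x. f y * g z),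
       one = (\<lambda>x. if x \<in> (\<lambda>i. (i, [], i)) ` verts G then 1 else 0),
       zero = (\<lambda>x. 0),
       add = (\<lambda>f g x. f x + g x) \<rparr>"

text \<open>The copy of the ground field inside the algebra, consisting of the scalar multiples of the
  unit. Since it is central, dimension over this subfield is dimension over the ground field.\<close>

definition path_scalars :: "('v, 'b) pre_digraph \<Rightarrow> (('v, 'b) path \<Rightarrow> 'k::field) set" where
  "path_scalars G = range (\<lambda>c x. c * \<one>\<^bsub>path_algebra G\<^esub> x)"

definition path_basis :: "('v, 'b) path \<Rightarrow> ('v, 'b) path \<Rightarrow> 'k::field" where
  "path_basis y = (\<lambda>x. if x = y then 1 else 0)"

definition path_graded ::
    "('v, 'b) pre_digraph \<Rightarrow> nat \<Rightarrow> (('v, 'b) path \<Rightarrow> 'k::field) set" where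
  "path_graded G n =
     {f \<in> carrier (path_algebra G). \<forall>u p v. f (u, p, v) \<noteq> 0 \<longrightarrow> length p = n}"


section \<open>Preprojective algebras\<close>

definition mesh_relation ::
    "('v, 'a) pre_digraph \<Rightarrow> 'v \<Rightarrow> ('v, 'a + 'a) path \<Rightarrow> 'k::field" where
  "mesh_relation Q i = (\<lambda>x.
     (\<Sum>a | a \<in> arcs Q \<and> tail Q a = i. path_basis (i, [Inl a, Inr a], i) x) -
     (\<Sum>a | a \<in> arcs Q \<and> head Q a = i. path_basis (i, [Inr a, Inl a], i) x))"

definition mesh_ideal :: "('v, 'a) pre_digraph \<Rightarrow> (('v, 'a + 'a) path \<Rightarrow> 'k::field) set" where
  "mesh_ideal Q = genideal (path_algebra (double_quiver Q)) (mesh_relation Q ` verts Q)"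

definition preproj_algebra ::
    "('v, 'a) pre_digraph \<Rightarrow> (('v, 'a + 'a) path \<Rightarrow> 'k::field) set ring" where
  "preproj_algebra Q = path_algebra (double_quiver Q) Quot mesh_ideal Q"

definition preproj_class ::
    "('v, 'a) pre_digraph \<Rightarrow> (('v, 'a + 'a) path \<Rightarrow> 'k::field) \<Rightarrow>
      (('v, 'a + 'a) path \<Rightarrow> 'k) set" where
  "preproj_class Q f = mesh_ideal Q +>\<^bsub>path_algebra (double_quiver Q)\<^esub> f"

definition preproj_graded ::
    "('v, 'a) pre_digraph \<Rightarrow> nat \<Rightarrow> (('v, 'a + 'a) path \<Rightarrow> 'k::field) set set" where
  "preproj_graded Q n = preproj_class Q ` path_graded (double_quiver Q) n"

definition preproj_idem ::
    "('v, 'a) pre_digraph \<Rightarrow> 'v \<Rightarrow> (('v, 'a + 'a) path \<Rightarrow> 'k::field) set" where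
  "preproj_idem Q i = preproj_class Q (path_basis (i, [], i))"

definition preproj_scalars ::
    "('v, 'a) pre_digraph \<Rightarrow> (('v, 'a + 'a) path \<Rightarrow> 'k::field) set set" where
  "preproj_scalars Q = preproj_class Q ` path_scalars (double_quiver Q)"


section \<open>Dimension matrices and Hilbert series\<close>

text \<open>The dimension of a subspace \<open>E\<close> of \<open>R\<close> over a subfield \<open>K\<close> of \<open>R\<close>; only meaningful if this
  dimension is finite.\<close>

definition vdim :: "('r, 'm) ring_scheme \<Rightarrow> 'r set \<Rightarrow> 'r set \<Rightarrow> nat" where
  "vdim R K E = (THE n. ring.dimension R n K E)"

definition dim_matrix ::
    "('r, 'm) ring_scheme \<Rightarrow> 'r set \<Rightarrow> ('v::finite \<Rightarrow> 'r) \<Rightarrow> 'r set \<Rightarrow> (int, 'v) sqmat" where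
  "dim_matrix R K e M =
     Sqmat (\<chi> i j. int (vdim R K ((\<lambda>x. e i \<otimes>\<^bsub>R\<^esub> x \<otimes>\<^bsub>R\<^esub> e j) ` M)))"

definition hilbert_series ::
    "'k::field itself \<Rightarrow> ('v::finite, 'a) pre_digraph \<Rightarrow> (int, 'v) sqmat fps" where
  "hilbert_series k Q =
     Abs_fps (\<lambda>n. dim_matrix (preproj_algebra Q :: (('v, 'a + 'a) path \<Rightarrow> 'k) set ring)
       (preproj_scalars Q) (preproj_idem Q) (preproj_graded Q n))"


section \<open>Well-definedness\<close>

context wf_digraph
begin

lemma paths_append:
  "(u, p, w) \<in> paths G \<Longrightarrow> (w, q, v) \<in> paths G \<Longrightarrow> (u, p @ q, v) \<in> paths G"
  by (auto simp: paths_def)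

lemma trivial_path_iff: "(u, [], v) \<in> paths G \<longleftrightarrow> u = v \<and> u \<in> verts G"
  by (auto simp: paths_def awalk_Nil_iff)

lemma paths_verts: "(u, p, v) \<in> paths G \<Longrightarrow> u \<in> verts G \<and> v \<in> verts G"
  by (auto simp: paths_def)

lemma path_factorizations_empty: "x \<notin> paths G \<Longrightarrow> path_factorizations G x = {}"
  by (auto simp: path_factorizations_def dest: paths_append)

end

context fin_digraph
begin

lemma finite_path_factorizations: "finite (path_factorizations G x)"
proof -
  obtain u p v where x: "x = (u, p, v)" by (cases x)
  have "path_factorizations G x \<subseteq>
      (\<lambda>(k, w). ((u, take k p, w), (w, drop k p, v))) ` ({..length p} \<times> verts G)"
  proof
    fix yz assume "yz \<in> path_factorizations G x"
    then obtain p1 w q where yz: "yz = ((u, p1, w), (w, q, v))" "p = p1 @ q"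
      "(u, p1, w) \<in> paths G"
      by (auto simp: path_factorizations_def x)
    then show "yz \<in> (\<lambda>(k, w). ((u, take k p, w), (w, drop k p, v))) ` ({..length p} \<times> verts G)"
      by (intro image_eqI[of _ _ "(length p1, w)"]) (auto dest: paths_verts)
  qed
  then show ?thesis
    by (rule finite_subset) simp
qed

lemma path_algebra_mult_closed:
  assumes "f \<in> carrier (path_algebra G)" "g \<in> carrier (path_algebra G)"
  shows "f \<otimes>\<^bsub>path_algebra G\<^esub> g \<in> carrier (path_algebra G)"
proof -
  let ?h = "f \<otimes>\<^bsub>path_algebra G\<^esub> g"
  let ?c = "\<lambda>((u, p, _ :: 'a), (_ :: 'a, q, v)). (u, p @ q, v)"
  have "{x. ?h x \<noteq> 0} \<subseteq> ?c ` ({x. f x \<noteq> 0} \<times> {x. g x \<noteq> 0})"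
  proof
    fix x assume "x \<in> {x. ?h x \<noteq> 0}"
    then have "(\<Sum>yz \<in> path_factorizations G x. f (fst yz) * g (snd yz)) \<noteq> 0"
      by (simp add: path_algebra_def case_prod_beta)
    then obtain yz where "yz \<in> path_factorizations G x" "f (fst yz) * g (snd yz) \<noteq> 0"
      by (rule sum.not_neutral_contains_not_neutral)
    then show "x \<in> ?c ` ({x. f x \<noteq> 0} \<times> {x. g x \<noteq> 0})"
      by (intro image_eqI[of _ _ yz]) (auto simp: path_factorizations_def)
  qed
  moreover have "{x. ?h x \<noteq> 0} \<subseteq> paths G"
    by (auto simp: path_algebra_def) (metis path_factorizations_empty sum.empty)
  ultimately show ?thesis
    using assms finite_subset by (fastforce simp: path_algebra_def)
qed

lemma path_algebra_assoc:
  "f \<otimes>\<^bsub>path_algebra G\<^esub> g \<otimes>\<^bsub>path_algebra G\<^esub> h =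
   f \<otimes>\<^bsub>path_algebra G\<^esub> (g \<otimes>\<^bsub>path_algebra G\<^esub> h)"
proof
  fix x
  let ?F = "path_factorizations G"
  let ?cat = "\<lambda>y z. (fst y, fst (snd y) @ fst (snd z), snd (snd z))"
  have "(\<Sum>(y, z) \<in> ?F x. (\<Sum>(a, b) \<in> ?F y. f a * g b) * h z) =
      (\<Sum>(y, z) \<in> ?F x. \<Sum>(a, b) \<in> ?F y. f a * g b * h z)"
    by (intro sum.cong) (auto simp: sum_distrib_right case_prod_beta)
  also have "\<dots> = (\<Sum>((y, z), (a, b)) \<in> (SIGMA yz : ?F x. ?F (fst yz)). f a * g b * h z)"
    by (subst sum.Sigma[symmetric]) (auto simp: finite_path_factorizations case_prod_beta)
  also have "\<dots> = (\<Sum>((a, y), (b, z)) \<in> (SIGMA ay : ?F x. ?F (snd ay)). f a * (g b * h z))"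
    by (rule sum.reindex_bij_witness[where
          i = "\<lambda>((a, y), (b, z)). ((?cat a b, z), (a, b))" and
          j = "\<lambda>((y, z), (a, b)). ((a, ?cat b z), (b, z))"])
      (auto simp: path_factorizations_def mult.assoc paths_append)
  also have "\<dots> = (\<Sum>(a, y) \<in> ?F x. \<Sum>(b, z) \<in> ?F y. f a * (g b * h z))"
    by (subst sum.Sigma[symmetric]) (auto simp: finite_path_factorizations case_prod_beta)
  also have "\<dots> = (\<Sum>(a, y) \<in> ?F x. f a * (\<Sum>(b, z) \<in> ?F y. g b * h z))"
    by (intro sum.cong) (auto simp: sum_distrib_left case_prod_beta)
  finally show "(f \<otimes>\<^bsub>path_algebra G\<^esub> g \<otimes>\<^bsub>path_algebra G\<^esub> h) x =
      (f \<otimes>\<^bsub>path_algebra G\<^esub> (g \<otimes>\<^bsub>path_algebra G\<^esub> h)) x"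
    by (simp add: path_algebra_def)
qed

lemma path_algebra_one_left:
  assumes "f \<in> carrier (path_algebra G)"
  shows "\<one>\<^bsub>path_algebra G\<^esub> \<otimes>\<^bsub>path_algebra G\<^esub> f = f"
proof
  fix x :: "('a, 'b) path"
  obtain u p v where x: "x = (u, p, v)" by (cases x)
  show "(\<one>\<^bsub>path_algebra G\<^esub> \<otimes>\<^bsub>path_algebra G\<^esub> f) x = f x"
  proof (cases "x \<in> paths G")
    case True
    let ?t = "((u, [], u), (u, p, v))"
    have "(\<Sum>yz \<in> path_factorizations G x. \<one>\<^bsub>path_algebra G\<^esub> (fst yz) * f (snd yz)) =
        (\<Sum>yz \<in> {?t}. \<one>\<^bsub>path_algebra G\<^esub> (fst yz) * f (snd yz))"
    proof (rule sum.mono_neutral_right[OF finite_path_factorizations])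
      show "{?t} \<subseteq> path_factorizations G x"
        using True paths_verts by (auto simp: x path_factorizations_def trivial_path_iff)
    qed (auto simp: x path_factorizations_def path_algebra_def)
    then show ?thesis
      using True paths_verts by (auto simp: path_algebra_def case_prod_beta x)
  qed (use assms in \<open>auto simp: path_algebra_def path_factorizations_empty\<close>)
qed

lemma path_algebra_one_right:
  assumes "f \<in> carrier (path_algebra G)"
  shows "f \<otimes>\<^bsub>path_algebra G\<^esub> \<one>\<^bsub>path_algebra G\<^esub> = f"
proof
  fix x :: "('a, 'b) path"
  obtain u p v where x: "x = (u, p, v)" by (cases x)
  show "(f \<otimes>\<^bsub>path_algebra G\<^esub> \<one>\<^bsub>path_algebra G\<^esub>) x = f x"
  proof (cases "x \<in> paths G")
    case True
    let ?t = "((u, p, v), (v, [], v))"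
    have "(\<Sum>yz \<in> path_factorizations G x. f (fst yz) * \<one>\<^bsub>path_algebra G\<^esub> (snd yz)) =
        (\<Sum>yz \<in> {?t}. f (fst yz) * \<one>\<^bsub>path_algebra G\<^esub> (snd yz))"
    proof (rule sum.mono_neutral_right[OF finite_path_factorizations])
      show "{?t} \<subseteq> path_factorizations G x"
        using True paths_verts by (auto simp: x path_factorizations_def trivial_path_iff)
    qed (auto simp: x path_factorizations_def path_algebra_def)
    then show ?thesis
      using True paths_verts by (auto simp: path_algebra_def case_prod_beta x)
  qed (use assms in \<open>auto simp: path_algebra_def path_factorizations_empty\<close>)
qed

lemma path_algebra_add_closed:
  assumes "f \<in> carrier (path_algebra G)" "g \<in> carrier (path_algebra G)"
  shows "f \<oplus>\<^bsub>path_algebra G\<^esub> g \<in> carrier (path_algebra G)"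
proof -
  have "{x. f x + g x \<noteq> 0} \<subseteq> {x. f x \<noteq> 0} \<union> {x. g x \<noteq> 0}" by auto
  with assms show ?thesis
    by (auto simp: path_algebra_def dest: finite_subset)
qed

lemma path_algebra_ring: "ring (path_algebra G)"
proof (rule ringI)
  show "abelian_group (path_algebra G :: (('a, 'b) path \<Rightarrow> 'k::field) ring)"
  proof (rule abelian_groupI)
    fix f :: "('a, 'b) path \<Rightarrow> 'k" assume f: "f \<in> carrier (path_algebra G)"
    show "\<exists>g\<in>carrier (path_algebra G). g \<oplus>\<^bsub>path_algebra G\<^esub> f = \<zero>\<^bsub>path_algebra G\<^esub>"
      using f by (intro bexI[of _ "\<lambda>x. - f x"]) (auto simp: path_algebra_def)
  qed (auto intro: path_algebra_add_closed, auto simp: path_algebra_def add_ac)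
  show "monoid (path_algebra G :: (('a, 'b) path \<Rightarrow> 'k::field) ring)"
  proof (rule monoidI)
    show "\<one>\<^bsub>path_algebra G\<^esub> \<in> carrier (path_algebra G :: (('a, 'b) path \<Rightarrow> 'k) ring)"
      by (auto simp: path_algebra_def trivial_path_iff)
  qed (auto intro: path_algebra_mult_closed path_algebra_assoc path_algebra_one_left
        path_algebra_one_right)
qed (auto simp: path_algebra_def distrib_left distrib_right case_prod_beta sum.distrib)

lemma double_quiver_fin_digraph: "fin_digraph (double_quiver G)"
  by unfold_locales (auto simp: double_quiver_def)

lemma mesh_relation_closed:
  assumes "i \<in> verts G"
  shows "mesh_relation G i \<in> carrier (path_algebra (double_quiver G) ::
    (('a, 'b + 'b) path \<Rightarrow> 'k::field) ring)"
proof -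
  let ?m = "mesh_relation G i :: ('a, 'b + 'b) path \<Rightarrow> 'k"
  let ?A = "{(i, [Inl a, Inr a], i) |a. a \<in> arcs G \<and> tail G a = i} \<union>
      {(i, [Inr a, Inl a], i) |a. a \<in> arcs G \<and> head G a = i}"
  have "{x. ?m x \<noteq> 0} \<subseteq> ?A"
  proof
    fix x assume "x \<in> {x. ?m x \<noteq> 0}"
    then consider
      "(\<Sum>a | a \<in> arcs G \<and> tail G a = i. path_basis (i, [Inl a, Inr a], i) x :: 'k) \<noteq> 0" |
      "(\<Sum>a | a \<in> arcs G \<and> head G a = i. path_basis (i, [Inr a, Inl a], i) x :: 'k) \<noteq> 0"
      unfolding mesh_relation_def by force
    then show "x \<in> ?A"
      by cases (auto simp: path_basis_def elim!: sum.not_neutral_contains_not_neutral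
        split: if_splits)
  qed
  moreover have "finite ?A" by simp
  moreover have "?A \<subseteq> paths (double_quiver G)"
    using assms
    by (auto simp: paths_def pre_digraph.awalk_def pre_digraph.cas.simps double_quiver_def)
  ultimately show ?thesis
    by (auto simp: path_algebra_def dest: finite_subset)
qed

lemma mesh_ideal: "ideal (mesh_ideal G) (path_algebra (double_quiver G))"
  unfolding mesh_ideal_def
  by (intro ring.genideal_ideal fin_digraph.path_algebra_ring double_quiver_fin_digraph)
    (auto intro: mesh_relation_closed)

lemma preproj_algebra_ring: "ring (preproj_algebra G)"
  unfolding preproj_algebra_def by (intro ideal.quotient_is_ring mesh_ideal)

end


section \<open>The adjacency matrix as a dimension matrix\<close>

context fin_digraph
begin

lemma path_algebra_scalar_mult:
  "(\<lambda>x. c * f x) \<otimes>\<^bsub>path_algebra G\<^esub> g = (\<lambda>x. c * (f \<otimes>\<^bsub>path_algebra G\<^esub> g) x)"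
  "f \<otimes>\<^bsub>path_algebra G\<^esub> (\<lambda>x. c * g x) = (\<lambda>x. c * (f \<otimes>\<^bsub>path_algebra G\<^esub> g) x)"
  by (auto simp: path_algebra_def case_prod_beta sum_distrib_left mult_ac)

lemma path_scalars_subfield:
  assumes "verts G \<noteq> {}"
  shows "subfield (path_scalars G) (path_algebra G :: (('a, 'b) path \<Rightarrow> 'k::field) ring)"
proof -
  let ?R = "path_algebra G :: (('a, 'b) path \<Rightarrow> 'k) ring"
  let ?s = "\<lambda>c x. c * \<one>\<^bsub>?R\<^esub> x"
  interpret R: ring ?R by (rule path_algebra_ring)
  have one: "?s 1 = \<one>\<^bsub>?R\<^esub>" and zero: "?s 0 = \<zero>\<^bsub>?R\<^esub>" by (auto simp: path_algebra_def)
  have closed: "?s c \<in> carrier ?R" for c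
    using R.one_closed by (auto simp: path_algebra_def)
  have add: "?s c \<oplus>\<^bsub>?R\<^esub> ?s d = ?s (c + d)" for c d
    by (auto simp: path_algebra_def distrib_right)
  have mult: "?s c \<otimes>\<^bsub>?R\<^esub> ?s d = ?s (c * d)" for c d
    using R.l_one[OF R.one_closed] by (simp add: path_algebra_scalar_mult mult_ac)
  have minus: "\<ominus>\<^bsub>?R\<^esub> ?s c = ?s (- c)" for c
    by (rule R.minus_equality[OF _ closed closed]) (simp only: add zero left_minus)
  obtain i where "i \<in> verts G" using assms by auto
  then have "\<one>\<^bsub>?R\<^esub> (i, [], i) = 1" by (auto simp: path_algebra_def)
  then have inj: "?s c = ?s d \<longleftrightarrow> c = d" for c d
    by (auto dest: fun_cong[of _ _ "(i, [], i)"])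
  have scalar: "?s c \<in> path_scalars G" for c
    unfolding path_scalars_def by (rule range_eqI[of _ ?s c]) (rule refl)
  have "subring (path_scalars G) ?R"
  proof (rule R.subringI)
    show "\<one>\<^bsub>?R\<^esub> \<in> path_scalars G"
      using scalar[of 1] unfolding one .
  next
    fix f :: "('a, 'b) path \<Rightarrow> 'k" assume "f \<in> path_scalars G"
    then obtain c where "f = ?s c" by (auto simp: path_scalars_def)
    then show "\<ominus>\<^bsub>?R\<^esub> f \<in> path_scalars G"
      by (simp only: minus scalar)
  next
    fix f g :: "('a, 'b) path \<Rightarrow> 'k" assume "f \<in> path_scalars G" "g \<in> path_scalars G"
    then obtain c d where "f = ?s c" "g = ?s d" by (auto simp: path_scalars_def)
    then show "f \<otimes>\<^bsub>?R\<^esub> g \<in> path_scalars G" "f \<oplus>\<^bsub>?R\<^esub> g \<in> path_scalars G"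
      by (simp_all only: mult add scalar)
  qed (use closed in \<open>auto simp: path_scalars_def\<close>)
  then have "subcring (path_scalars G) ?R"
    by (rule R.subcringI) (auto simp: path_scalars_def mult mult.commute)
  moreover have "Units (?R \<lparr> carrier := path_scalars G \<rparr>) = path_scalars G - {\<zero>\<^bsub>?R\<^esub>}"
  proof (intro equalityI subsetI)
    fix f assume "f \<in> Units (?R \<lparr> carrier := path_scalars G \<rparr>)"
    then obtain c d where "f = ?s c" "?s c \<otimes>\<^bsub>?R\<^esub> ?s d = \<one>\<^bsub>?R\<^esub>"
      by (auto simp: Units_def path_scalars_def)
    then have "?s (c * d) = ?s 1" unfolding mult one by blast
    then have "c * d = 1" unfolding inj .
    then have "c \<noteq> 0" by auto
    then have "f \<noteq> ?s 0" unfolding \<open>f = ?s c\<close> inj .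
    then show "f \<in> path_scalars G - {\<zero>\<^bsub>?R\<^esub>}"
      using \<open>f = ?s c\<close> scalar[of c] unfolding zero by blast
  next
    fix f assume "f \<in> path_scalars G - {\<zero>\<^bsub>?R\<^esub>}"
    then obtain c where c: "f = ?s c" "f \<noteq> ?s 0"
      unfolding zero path_scalars_def by blast
    then have "c \<noteq> 0" by auto
    then have "?s c \<otimes>\<^bsub>?R\<^esub> ?s (inverse c) = ?s 1" "?s (inverse c) \<otimes>\<^bsub>?R\<^esub> ?s c = ?s 1"
      unfolding mult inj by simp_all
    then have "?s c \<otimes>\<^bsub>?R\<^esub> ?s (inverse c) = \<one>\<^bsub>?R\<^esub>" "?s (inverse c) \<otimes>\<^bsub>?R\<^esub> ?s c = \<one>\<^bsub>?R\<^esub>"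
      unfolding one .
    then show "f \<in> Units (?R \<lparr> carrier := path_scalars G \<rparr>)"
      unfolding Units_def c(1) using scalar[of c] scalar[of "inverse c"]
      by (intro CollectI conjI bexI[of _ "?s (inverse c)"]) simp_all
  qed
  ultimately show ?thesis by (rule R.subfieldI)
qed

lemma dimension_path_span:
  assumes "finite S" "S \<subseteq> paths G"
  shows "ring.dimension (path_algebra G) (card S) (path_scalars G)
    {f :: ('a, 'b) path \<Rightarrow> 'k::field. {x. f x \<noteq> 0} \<subseteq> S}"
  using assms
proof (induction S)
  let ?R = "path_algebra G :: (('a, 'b) path \<Rightarrow> 'k) ring"
  interpret R: ring ?R by (rule path_algebra_ring)
  case empty
  have "{f :: ('a, 'b) path \<Rightarrow> 'k. {x. f x \<noteq> 0} \<subseteq> {}} = {\<zero>\<^bsub>?R\<^esub>}"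
    by (auto simp: path_algebra_def)
  then show ?case using R.zero_dim by simp
next
  let ?R = "path_algebra G :: (('a, 'b) path \<Rightarrow> 'k) ring"
  interpret R: ring ?R by (rule path_algebra_ring)
  case (insert y S)
  let ?E = "{f :: ('a, 'b) path \<Rightarrow> 'k. {x. f x \<noteq> 0} \<subseteq> S}"
  let ?b = "path_basis y :: ('a, 'b) path \<Rightarrow> 'k"
  have b: "?b \<in> carrier ?R" "?b \<notin> ?E"
    using insert by (auto simp: path_algebra_def path_basis_def)
  have smult: "(\<lambda>x. c * \<one>\<^bsub>?R\<^esub> x) \<otimes>\<^bsub>?R\<^esub> ?b = (\<lambda>x. c * ?b x)" for c
    using R.l_one[OF b(1)] by (simp add: path_algebra_scalar_mult)
  have "R.line_extension (path_scalars G) ?b ?E = {f. {x. f x \<noteq> 0} \<subseteq> insert y S}"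
  proof (intro equalityI subsetI)
    fix f assume "f \<in> R.line_extension (path_scalars G) ?b ?E"
    then obtain c g where "g \<in> ?E" "f = (\<lambda>x. c * ?b x) \<oplus>\<^bsub>?R\<^esub> g"
      by (auto simp: R.line_extension_mem_iff path_scalars_def smult)
    then show "f \<in> {f. {x. f x \<noteq> 0} \<subseteq> insert y S}"
      by (auto simp: path_algebra_def path_basis_def)
  next
    fix f :: "('a, 'b) path \<Rightarrow> 'k" assume f: "f \<in> {f. {x. f x \<noteq> 0} \<subseteq> insert y S}"
    have "f(y := 0) \<in> ?E" using f by auto
    moreover have "f = (\<lambda>x. f y * ?b x) \<oplus>\<^bsub>?R\<^esub> f(y := 0)"
      by (auto simp: path_algebra_def path_basis_def)
    ultimately show "f \<in> R.line_extension (path_scalars G) ?b ?E"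
      unfolding R.line_extension_mem_iff path_scalars_def smult[symmetric] by blast
  qed
  with R.Suc_dim[OF b insert.IH] insert show ?case by auto
qed

lemma vdim_eqI:
  fixes R :: "('r, 'm) ring_scheme"
  assumes "ring R" "subfield K R" "ring.dimension R n K E"
  shows "vdim R K E = n"
  unfolding vdim_def using assms ring.dimension_is_inj[OF assms(1,2)] by blast

lemma path_algebra_corner:
  fixes f :: "('a, 'b) path \<Rightarrow> 'k::field"
  assumes f: "f \<in> carrier (path_algebra G)"
  shows "path_basis (i, [], i) \<otimes>\<^bsub>path_algebra G\<^esub> f \<otimes>\<^bsub>path_algebra G\<^esub> path_basis (j, [], j) =
    (\<lambda>(u, p, v). if u = i \<and> v = j then f (u, p, v) else 0)"
proof -
  let ?R = "path_algebra G :: (('a, 'b) path \<Rightarrow> 'k) ring"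
  have supp: "f x = 0" if "x \<notin> paths G" for x
    using f that by (auto simp: path_algebra_def)
  have l: "(path_basis (i, [], i) \<otimes>\<^bsub>?R\<^esub> f) (u, p, v) = (if u = i then f (u, p, v) else 0)" for u p v
  proof (cases "(u, p, v) \<in> paths G")
    case True
    have "(\<Sum>yz \<in> path_factorizations G (u, p, v). (path_basis (i, [], i) (fst yz) :: 'k) * f (snd yz)) =
        (\<Sum>yz \<in> {((u, [] :: 'b list, u), (u, p, v))}. path_basis (i, [], i) (fst yz) * f (snd yz))"
    proof (rule sum.mono_neutral_right[OF finite_path_factorizations])
      show "{((u, [], u), (u, p, v))} \<subseteq> path_factorizations G (u, p, v)"
        using True paths_verts by (auto simp: path_factorizations_def trivial_path_iff)
    qed (auto simp: path_factorizations_def path_basis_def)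
    then show ?thesis by (simp add: path_algebra_def case_prod_beta path_basis_def)
  qed (auto simp: supp path_algebra_def path_factorizations_empty)
  have "(g \<otimes>\<^bsub>?R\<^esub> path_basis (j, [], j)) (u, p, v) = (if v = j then g (u, p, v) else 0)"
    if g: "\<And>x. x \<notin> paths G \<Longrightarrow> g x = 0" for g :: "('a, 'b) path \<Rightarrow> 'k" and u p v
  proof (cases "(u, p, v) \<in> paths G")
    case True
    have "(\<Sum>yz \<in> path_factorizations G (u, p, v). g (fst yz) * (path_basis (j, [], j) (snd yz) :: 'k)) =
        (\<Sum>yz \<in> {((u, p, v), (v, [] :: 'b list, v))}. g (fst yz) * path_basis (j, [], j) (snd yz))"
    proof (rule sum.mono_neutral_right[OF finite_path_factorizations])
      show "{((u, p, v), (v, [], v))} \<subseteq> path_factorizations G (u, p, v)"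
        using True paths_verts by (auto simp: path_factorizations_def trivial_path_iff)
    qed (auto simp: path_factorizations_def path_basis_def)
    then show ?thesis by (simp add: path_algebra_def case_prod_beta path_basis_def)
  qed (auto simp: g path_algebra_def path_factorizations_empty)
  from this[of "path_basis (i, [], i) \<otimes>\<^bsub>?R\<^esub> f"] show ?thesis
    by (fastforce simp: l supp)
qed

end

lemma adjacency_matrix_eq_dim_matrix:
  fixes G :: "('v::finite, 'b) pre_digraph"
  assumes "fin_digraph G" "verts G = UNIV"
  shows "adjacency_matrix G =
    dim_matrix (path_algebra G :: (('v, 'b) path \<Rightarrow> 'k::field) ring) (path_scalars G)
      (\<lambda>i. path_basis (i, [], i)) (path_graded G 1)"
proof -
  interpret fin_digraph G by fact
  let ?R = "path_algebra G :: (('v, 'b) path \<Rightarrow> 'k) ring"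
  have "vdim ?R (path_scalars G)
      ((\<lambda>x. path_basis (i, [], i) \<otimes>\<^bsub>?R\<^esub> x \<otimes>\<^bsub>?R\<^esub> path_basis (j, [], j)) ` path_graded G 1) =
      card {b \<in> arcs G. tail G b = i \<and> head G b = j}" for i j
  proof -
    let ?B = "{b \<in> arcs G. tail G b = i \<and> head G b = j}"
    let ?S = "(\<lambda>b. (i, [b], j)) ` ?B"
    let ?E = "{f :: ('v, 'b) path \<Rightarrow> 'k. {x. f x \<noteq> 0} \<subseteq> ?S}"
    have arr: "(u, p, v) \<in> paths G \<and> length p = 1 \<longleftrightarrow>
        (\<exists>b \<in> arcs G. p = [b] \<and> u = tail G b \<and> v = head G b)" for u p v
      by (auto simp: paths_def awalk_def length_Suc_conv assms(2))
    have S: "?S \<subseteq> paths G" using arr by fastforce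
    have "(\<lambda>x. path_basis (i, [], i) \<otimes>\<^bsub>?R\<^esub> x \<otimes>\<^bsub>?R\<^esub> path_basis (j, [], j)) ` path_graded G 1 =
        (\<lambda>f (u, p, v). if u = i \<and> v = j then f (u, p, v) else 0) ` path_graded G 1"
      by (intro image_cong refl path_algebra_corner) (simp add: path_graded_def)
    also have "\<dots> = ?E"
    proof (intro equalityI subsetI)
      fix g :: "('v, 'b) path \<Rightarrow> 'k"
      assume "g \<in> (\<lambda>f (u, p, v). if u = i \<and> v = j then f (u, p, v) else 0) ` path_graded G 1"
      then obtain f :: "('v, 'b) path \<Rightarrow> 'k" where f: "f \<in> path_graded G 1"
        and g: "g = (\<lambda>(u, p, v). if u = i \<and> v = j then f (u, p, v) else 0)" by blast
      have "x \<in> ?S" if "g x \<noteq> 0" for x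
      proof -
        obtain u p v where x: "x = (u, p, v)" by (cases x)
        with that g have "u = i" "v = j" "f (u, p, v) \<noteq> 0" by (auto split: if_splits)
        with f have "(i, p, j) \<in> paths G \<and> length p = 1"
          by (auto simp: path_graded_def path_algebra_def)
        with arr \<open>u = i\<close> \<open>v = j\<close> x show ?thesis by auto
      qed
      then show "g \<in> ?E" by auto
    next
      fix f :: "('v, 'b) path \<Rightarrow> 'k" assume f: "f \<in> ?E"
      have "finite {x. f x \<noteq> 0}"
        using f by (auto intro: finite_subset[of _ ?S])
      then have "f \<in> path_graded G 1"
        using f S by (auto simp: path_graded_def path_algebra_def)
      moreover have "f = (\<lambda>(u, p, v). if u = i \<and> v = j then f (u, p, v) else 0)"
        using f by (auto simp: fun_eq_iff)
      ultimately show "f \<in> (\<lambda>f (u, p, v). if u = i \<and> v = j then f (u, p, v) else 0) ` path_graded G 1"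
        by blast
    qed
    finally have E: "(\<lambda>x. path_basis (i, [], i) \<otimes>\<^bsub>?R\<^esub> x \<otimes>\<^bsub>?R\<^esub> path_basis (j, [], j)) `
        path_graded G 1 = ?E" .
    have "card ?S = card ?B" by (intro card_image) (auto simp: inj_on_def)
    then have "ring.dimension ?R (card ?B) (path_scalars G) ?E"
      using dimension_path_span[OF _ S] by simp
    then show ?thesis
      unfolding E by (intro vdim_eqI path_algebra_ring path_scalars_subfield) (simp_all add: assms)
  qed
  then show ?thesis
    by (simp add: adjacency_matrix_def dim_matrix_def)
qed

end

theory Submission
  imports Defs "HOL-Library.Function_Algebras"
begin

text \<open>Write \<open>h\<^sub>n\<close> for the dimension matrix of \<open>\<Pi>\<^sub>n\<close>. The presentation of \<open>\<Pi>\<close> makes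
  \<open>\<Pi>\<^sub>n \<rightarrow> V \<otimes> \<Pi>\<^sub>n\<^sub>+\<^sub>1 \<rightarrow> \<Pi>\<^sub>n\<^sub>+\<^sub>2 \<rightarrow> 0\<close> exact, where \<open>V\<close> is now the arrow space of the double quiver, so the
  claim amounts to the injectivity of the first map, that is, to \<open>\<Pi>\<close> having no socle.

  Fix a vertex \<open>j\<close> and regard \<open>(\<Pi>\<^sub>n e\<^sub>j, \<Pi>\<^sub>n\<^sub>+\<^sub>1 e\<^sub>j)\<close> as a representation of the bipartite double cover of
  the quiver. If all earlier maps are injective, then passing from \<open>n\<close> to \<open>n + 1\<close> is a reflection, so
  the only endomorphisms of this representation are the scalars. A socle element in degree \<open>n\<close> splits
  off a simple summand, which is then everything, and \<open>\<Pi>\<^sub>n\<^sub>+\<^sub>1 e\<^sub>j = 0\<close>. On the other hand a connected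
  non-Dynkin graph carries a positive integer vector \<open>\<delta>\<close> with \<open>C \<delta> \<ge> 2 \<delta>\<close>. By the recursion
  \<open>h\<^sub>n\<^sub>+\<^sub>2 = C h\<^sub>n\<^sub>+\<^sub>1 - h\<^sub>n\<close>, valid so far, the \<open>\<delta>\<close>-weighted dimension of \<open>\<Pi>\<^sub>n e\<^sub>j\<close> is convex in \<open>n\<close>, hence
  strictly increasing, and \<open>\<Pi>\<^sub>n\<^sub>+\<^sub>1 e\<^sub>j\<close> cannot vanish. All of this is carried out in the graded dual of
  \<open>\<Pi>\<close>, the functions on paths that annihilate the mesh ideal, where no quotients occur.\<close>


section \<open>Vector spaces of functions\<close>

text \<open>Passing to the dual turns multiplication by an arrow into deletion of the first letter
  of a word, and the absence of a socle into surjectivity of the mesh map. The obstacle is a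
  circularity: the dimension recursion needs surjectivity, surjectivity needs the next level to be
  nonzero, and only the recursion can show that. Hence both are proved in one induction, in which
  growth feeds the algebra and the algebra prolongs the growth. The truncation to two levels
  matters: in the whole module a socle element need not split off, but nothing maps into the lower
  of two levels, so there it does. The weight \<delta> is required to satisfy an inequality only.
  Inequalities survive extension by zero, so a weight on some subgraph suffices, and it can then be
  made positive everywhere.\<close>

global_interpretation fs: vector_space "\<lambda>(c::'k::field) (f::'b \<Rightarrow> 'k) x. c * f x"
  by unfold_locales (auto simp: fun_eq_iff algebra_simps)

text \<open>The ambient space of all functions is infinite dimensional in general, so finiteness is
  recorded for the subspace at hand; it supplies the finite bases that \<open>fs.dim\<close>
  counts.\<close>

definition fin_dim :: "('b \<Rightarrow> 'k::field) set \<Rightarrow> bool" where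
  "fin_dim U \<longleftrightarrow> (\<exists>T. finite T \<and> U \<subseteq> fs.span T)"

abbreviation fun_linear :: "(('b \<Rightarrow> 'k::field) \<Rightarrow> ('c \<Rightarrow> 'k)) \<Rightarrow> bool" where
  "fun_linear \<equiv> Vector_Spaces.linear (\<lambda>c f x. c * f x) (\<lambda>c f x. c * f x)"

abbreviation functional :: "(('b \<Rightarrow> 'k::field) \<Rightarrow> 'k) \<Rightarrow> bool" where
  "functional \<equiv> Vector_Spaces.linear (\<lambda>c f x. c * f x) (*)"

lemma fun_linearI:
  assumes "\<And>f g. T (\<lambda>x. f x + g x) = (\<lambda>x. T f x + T g x)" "\<And>c f. T (\<lambda>x. c * f x) = (\<lambda>x. c * T f x)"
  shows "fun_linear T"
  using assms by (auto simp: Vector_Spaces.linear_iff fs.vector_space_axioms plus_fun_def)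

lemma functional_iff:
  "functional l \<longleftrightarrow> (\<forall>f g. l (f + g) = l f + l g) \<and> (\<forall>c f. l (\<lambda>x. c * f x) = c * l f)"
proof -
  have "vector_space ((*) :: 'a \<Rightarrow> 'a \<Rightarrow> 'a)"
    by unfold_locales (auto simp: algebra_simps)
  then show ?thesis by (auto simp: Vector_Spaces.linear_iff fs.vector_space_axioms)
qed

lemma fin_dim_subset: "fin_dim U \<Longrightarrow> W \<subseteq> U \<Longrightarrow> fin_dim W"
  unfolding fin_dim_def by blast

lemma fin_dim_independent: "fin_dim U \<Longrightarrow> B \<subseteq> U \<Longrightarrow> \<not> fs.dependent B \<Longrightarrow> finite B"
  unfolding fin_dim_def using fs.independent_span_bound by blast

lemma supported_subspace: "fs.subspace {f :: 'b \<Rightarrow> 'k::field. \<forall>x. f x \<noteq> 0 \<longrightarrow> P x}"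
  by (auto simp: fs.subspace_def) (metis add_0)

lemma sum_fun_apply: "(\<Sum>x\<in>A. f x) y = (\<Sum>x\<in>A. f x y)" for f :: "'c \<Rightarrow> 'b \<Rightarrow> 'k::field"
  by (induction A rule: infinite_finite_induct) auto

lemma supported_expansion:
  fixes f :: "'b \<Rightarrow> 'k::field"
  assumes "finite L" "\<forall>x. f x \<noteq> 0 \<longrightarrow> x \<in> L"
  shows "f = (\<Sum>y\<in>L. (\<lambda>x. f y * (if x = y then 1 else 0)))"
proof
  fix x
  have "(\<Sum>y\<in>L. f y * (if x = y then 1 else 0)) = (\<Sum>y\<in>L. if x = y then f y else 0)"
    by (intro sum.cong) auto
  also have "\<dots> = f x" using assms by (auto simp: sum.delta')
  finally show "f x = (\<Sum>y\<in>L. (\<lambda>x. f y * (if x = y then 1 else 0))) x"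
    by (simp add: sum_fun_apply)
qed

lemma fin_dim_supported:
  assumes "finite L"
  shows "fin_dim {f :: 'b \<Rightarrow> 'k::field. \<forall>x. f x \<noteq> 0 \<longrightarrow> x \<in> L}"
  unfolding fin_dim_def
proof (intro exI conjI subsetI)
  let ?T = "(\<lambda>y x. if x = y then 1 else 0 :: 'k) ` L"
  show "finite ?T" using assms by simp
  fix f :: "'b \<Rightarrow> 'k" assume "f \<in> {f. \<forall>x. f x \<noteq> 0 \<longrightarrow> x \<in> L}"
  then have "f = (\<Sum>y\<in>L. (\<lambda>x. f y * (if x = y then 1 else 0)))"
    by (intro supported_expansion assms) auto
  moreover have "(\<Sum>y\<in>L. (\<lambda>x. f y * (if x = y then 1 else 0))) \<in> fs.span ?T"
    by (intro fs.span_sum fs.span_scale[where x = "\<lambda>x. if x = _ then 1 else 0"] fs.span_base imageI)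
  ultimately show "f \<in> fs.span ?T" by simp
qed

text \<open>\<open>D\<close> represents a basis of the quotient of \<open>U\<close> by
  \<open>I\<close>. Comparing a quotient with an annihilator will amount to both having
  \<open>card D\<close> as their dimension.\<close>

lemma complement_basis:
  fixes U :: "('b \<Rightarrow> 'k::field) set"
  assumes "fin_dim U" "fs.subspace U" "fs.subspace I" "I \<subseteq> U"
  obtains B D where "finite B" "finite D" "B \<inter> D = {}" "\<not> fs.dependent (B \<union> D)"
    "fs.span B = I" "fs.span (B \<union> D) = U"
proof -
  obtain B where B: "B \<subseteq> I" "\<not> fs.dependent B" "I \<subseteq> fs.span B"
    using fs.maximal_independent_subset by blast
  obtain C where C: "B \<subseteq> C" "C \<subseteq> U" "\<not> fs.dependent C" "U \<subseteq> fs.span C"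
    using fs.maximal_independent_subset_extend[of B U] B assms by blast
  have "finite C" using fin_dim_independent assms C by blast
  moreover have "fs.span B = I" using B assms(3) fs.span_subspace by blast
  moreover have "fs.span C = U" using C assms(2) fs.span_subspace by blast
  moreover have "B \<union> (C - B) = C" using C by blast
  ultimately show ?thesis
    using that[of B "C - B"] C finite_subset[OF C(1)] by auto
qed

lemma span_Int_eq_0:
  fixes B D :: "('b \<Rightarrow> 'k::field) set"
  assumes "\<not> fs.dependent (B \<union> D)" "B \<inter> D = {}" "x \<in> fs.span B" "x \<in> fs.span D"
  shows "x = 0"
proof -
  have "fs.representation (B \<union> D) x = fs.representation B x"
    "fs.representation (B \<union> D) x = fs.representation D x"
    by (rule fs.representation_extend; use assms in blast)+
  then have "fs.representation (B \<union> D) x = (\<lambda>_. 0)"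
    using assms(2) fs.representation_ne_zero[of B x] fs.representation_ne_zero[of D x]
    by (metis IntI emptyE)
  then show ?thesis
    using fs.sum_nonzero_representation_eq[OF assms(1), of x] assms(3) fs.span_mono[of B "B \<union> D"]
    by auto
qed

lemma rank_nullity:
  fixes U :: "('b \<Rightarrow> 'k::field) set" and T :: "('b \<Rightarrow> 'k) \<Rightarrow> ('c \<Rightarrow> 'k)"
  assumes "fin_dim U" "fs.subspace U" "fun_linear T"
  shows "fs.dim U = fs.dim {u \<in> U. T u = 0} + fs.dim (T ` U)"
proof -
  interpret T: Vector_Spaces.linear "\<lambda>c f x. c * f x" "\<lambda>c f x. c * f x" T by fact
  let ?N = "{u \<in> U. T u = 0}"
  have N: "fs.subspace ?N"
    using assms(2) by (auto simp: fs.subspace_def T.add T.scale T.zero)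
  obtain B D where BD: "finite B" "finite D" "B \<inter> D = {}" "\<not> fs.dependent (B \<union> D)"
    "fs.span B = ?N" "fs.span (B \<union> D) = U"
    using complement_basis[OF assms(1,2) N] by blast
  have indB: "\<not> fs.dependent B" and indD: "\<not> fs.dependent D"
    using BD fs.independent_mono by blast+
  have inj: "inj_on T (fs.span D)"
  proof (subst T.inj_on_iff_eq_0[OF fs.subspace_span], intro ballI impI)
    fix x assume x: "x \<in> fs.span D" "T x = 0"
    have "x \<in> U" using x fs.span_mono[of D "B \<union> D"] BD by auto
    then have "x \<in> fs.span B" using x BD by auto
    with x show "x = 0" using span_Int_eq_0[OF BD(4,3)] by blast
  qed
  have "fs.dim (T ` U) = fs.dim (T ` fs.span D)"
  proof -
    have "T ` U = T ` fs.span D"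
    proof (intro equalityI subsetI)
      fix y assume "y \<in> T ` U"
      then obtain u where u: "u \<in> fs.span (B \<union> D)" "y = T u" using BD by auto
      then obtain b d where "b \<in> fs.span B" "d \<in> fs.span D" "u = b + d"
        unfolding fs.span_Un by auto
      then have "y = T d" using u BD by (auto simp: T.add)
      then show "y \<in> T ` fs.span D" using \<open>d \<in> _\<close> by auto
    next
      fix y assume "y \<in> T ` fs.span D"
      then show "y \<in> T ` U" using fs.span_mono[of D "B \<union> D"] BD by auto
    qed
    then show ?thesis by simp
  qed
  also have "\<dots> = fs.dim (fs.span (T ` D))" by (simp only: T.span_image)
  also have "\<dots> = card (T ` D)"
    using T.independent_injective_image[OF indD inj] by (rule fs.dim_span_eq_card_independent)
  also have "\<dots> = card D"
    using inj fs.span_superset by (intro card_image) (blast intro: inj_on_subset)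
  finally have "fs.dim (T ` U) = card D" .
  moreover have "fs.dim ?N = card B"
    using fs.dim_span_eq_card_independent[OF indB] BD by simp
  moreover have "fs.dim U = card (B \<union> D)"
    using fs.dim_span_eq_card_independent[OF BD(4)] BD by simp
  ultimately show ?thesis using card_Un_disjoint[OF BD(1-3)] by simp
qed

lemma functional_extend:
  fixes f :: "('b \<Rightarrow> 'k::field) \<Rightarrow> 'k"
  assumes "\<not> fs.dependent B"
  obtains l where "functional l" "\<forall>x\<in>B. l x = f x"
proof -
  interpret k: vector_space "(*) :: 'k \<Rightarrow> 'k \<Rightarrow> 'k"
    by unfold_locales (auto simp: algebra_simps)
  interpret p: vector_space_pair "\<lambda>(c::'k::field) (f::'b \<Rightarrow> 'k) x. c * f x" "(*) :: 'k \<Rightarrow> 'k \<Rightarrow> 'k" ..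
  show ?thesis using p.linear_independent_extend[OF assms] that by blast
qed

text \<open>A basis of \<open>W\<close> stays independent when \<open>y\<close> is added, so a
  functional can be prescribed as 1 at \<open>y\<close> and 0 on that basis.\<close>

lemma functional_separate:
  fixes W :: "('b \<Rightarrow> 'k::field) set"
  assumes "fs.subspace W" "y \<notin> W"
  obtains l where "functional l" "l y = 1" "\<And>w. w \<in> W \<Longrightarrow> l w = 0"
proof -
  obtain B where B: "B \<subseteq> W" "\<not> fs.dependent B" "W \<subseteq> fs.span B"
    using fs.maximal_independent_subset by blast
  have sB: "fs.span B = W" using B assms(1) fs.span_subspace by blast
  have "\<not> fs.dependent (insert y B)"
    using B(2) assms(2) sB fs.independent_insertI by blast
  then obtain l where l: "functional l" "\<forall>x\<in>insert y B. l x = (if x = y then 1 else 0)"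
    by (rule functional_extend)
  interpret l: Vector_Spaces.linear "\<lambda>c f x. c * f x" "(*)" l by fact
  have "l w = 0" if "w \<in> W" for w
    using that l(2) B assms(2) l.eq_0_on_span[of B w] sB by fastforce
  then show ?thesis using that l by auto
qed

text \<open>The delta functions are a basis of the functions supported in \<open>L\<close>, so a
  functional there is the pairing with a function on \<open>L\<close>. This is how dual spaces
  become function spaces again.\<close>

lemma functional_expansion:
  fixes l :: "('b \<Rightarrow> 'k::field) \<Rightarrow> 'k"
  assumes "functional l" "finite L" "\<forall>x. f x \<noteq> 0 \<longrightarrow> x \<in> L"
  shows "l f = (\<Sum>y\<in>L. l (\<lambda>x. if x = y then 1 else 0) * f y)"
proof -
  interpret l: Vector_Spaces.linear "\<lambda>c f x. c * f x" "(*)" l by fact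
  have "l f = l (\<Sum>y\<in>L. (\<lambda>x. f y * (if x = y then 1 else 0)))"
    by (rule arg_cong[OF supported_expansion[OF assms(2,3)]])
  also have "\<dots> = (\<Sum>y\<in>L. l (\<lambda>x. if x = y then 1 else 0) * f y)"
    by (simp only: l.sum l.scale mult.commute)
  finally show ?thesis .
qed

text \<open>The pairing of functions supported in \<open>L\<close> is perfect, so the basis
  \<open>B \<union> D\<close> has a dual basis. The dual vectors belonging to \<open>D\<close> form
  a basis of the annihilator of the span of \<open>B\<close>.\<close>

lemma dim_annihilator:
  fixes I :: "('b \<Rightarrow> 'k::field) set"
  assumes L: "finite L"
    and U: "fs.span (B \<union> D) = {f. \<forall>x. f x \<noteq> 0 \<longrightarrow> x \<in> L}"
    and fin: "finite B" "finite D" and disj: "B \<inter> D = {}"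
    and ind: "\<not> fs.dependent (B \<union> D)" and I: "fs.span B = I"
  shows "fs.dim {g. (\<forall>x. g x \<noteq> 0 \<longrightarrow> x \<in> L) \<and> (\<forall>f\<in>I. (\<Sum>x\<in>L. g x * f x) = 0)} = card D"
proof -
  let ?U = "{f :: 'b \<Rightarrow> 'k. \<forall>x. f x \<noteq> 0 \<longrightarrow> x \<in> L}"
  let ?A = "{g :: 'b \<Rightarrow> 'k. (\<forall>x. g x \<noteq> 0 \<longrightarrow> x \<in> L) \<and> (\<forall>f\<in>I. (\<Sum>x\<in>L. g x * f x) = 0)}"
  have lin: "functional (\<lambda>f. \<Sum>x\<in>L. g x * f x)" for g :: "'b \<Rightarrow> 'k"
    by (auto simp: functional_iff algebra_simps sum.distrib sum_distrib_left)
  have BD: "B \<union> D \<subseteq> ?U" using fs.span_superset U by blast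
  have zero: "g = 0" if "\<forall>x. g x \<noteq> 0 \<longrightarrow> x \<in> L" "\<And>f. f \<in> B \<union> D \<Longrightarrow> (\<Sum>x\<in>L. g x * f x) = 0" for g :: "'b \<Rightarrow> 'k"
  proof -
    interpret l: Vector_Spaces.linear "\<lambda>c f x. c * f x" "(*)" "\<lambda>f. \<Sum>x\<in>L. g x * f x" by (rule lin)
    have z: "(\<Sum>x\<in>L. g x * f x) = 0" if "f \<in> ?U" for f
      using that l.eq_0_on_span[of "B \<union> D" f] \<open>\<And>f. f \<in> B \<union> D \<Longrightarrow> _ f\<close> U by blast
    have "g y = 0" for y
    proof (cases "y \<in> L")
      case True
      have "(\<lambda>x. if x = y then 1 else 0) \<in> ?U" using True by auto
      from z[OF this] have "(\<Sum>x\<in>L. if x = y then g x else 0) = 0"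
        by (simp add: if_distrib cong: if_cong)
      then show ?thesis using True L by simp
    qed (use that in auto)
    then show ?thesis by auto
  qed
  \<comment> \<open>The dual vector of \<open>d\<close>: the functional that is 1 at
    \<open>d\<close> and 0 at the other basis vectors, rewritten as a function on
    \<open>L\<close>.\<close>
  have "\<exists>g. (\<forall>x. g x \<noteq> 0 \<longrightarrow> x \<in> L) \<and> (\<forall>f\<in>B\<union>D. (\<Sum>x\<in>L. g x * f x) = (if f = d then 1 else 0))" for d
  proof -
    obtain l where l: "functional l" "\<forall>x\<in>B\<union>D. l x = (if x = d then 1 else 0)"
      by (rule functional_extend[OF ind])
    define g where "g = (\<lambda>y. if y \<in> L then l (\<lambda>x. if x = y then 1 else 0) else 0)"
    have "(\<Sum>x\<in>L. g x * f x) = (if f = d then 1 else 0)" if "f \<in> B \<union> D" for f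
    proof -
      have "l f = (\<Sum>x\<in>L. g x * f x)"
        using functional_expansion[OF l(1) L, of f] that BD by (auto simp: g_def)
      then show ?thesis using l that by auto
    qed
    then show ?thesis by (intro exI[of _ g]) (auto simp: g_def)
  qed
  then obtain g where g: "\<And>d x. g d x \<noteq> 0 \<Longrightarrow> x \<in> L"
    "\<And>d f. f \<in> B \<union> D \<Longrightarrow> (\<Sum>x\<in>L. g d x * f x) = (if f = d then 1 else 0)"
    by metis
  have inj: "inj_on g D"
  proof (rule inj_onI)
    fix d d' assume "d \<in> D" "d' \<in> D" "g d = g d'"
    then show "d = d'" using g(2)[of d d] g(2)[of d d'] by (auto split: if_splits)
  qed
  have sub: "g ` D \<subseteq> ?A"
  proof clarify
    fix d assume d: "d \<in> D"
    have "\<forall>f\<in>I. (\<Sum>x\<in>L. g d x * f x) = 0"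
    proof
      fix f assume f: "f \<in> I"
      interpret l: Vector_Spaces.linear "\<lambda>c f x. c * f x" "(*)" "\<lambda>f. \<Sum>x\<in>L. g d x * f x" by (rule lin)
      have "(\<Sum>x\<in>L. g d x * b x) = 0" if "b \<in> B" for b
        using g(2)[of b d] that d disj by auto
      then show "(\<Sum>x\<in>L. g d x * f x) = 0" using l.eq_0_on_span[of B f] I f by blast
    qed
    then show "(\<forall>x. g d x \<noteq> 0 \<longrightarrow> x \<in> L) \<and> (\<forall>f\<in>I. (\<Sum>x\<in>L. g d x * f x) = 0)" using g(1) by blast
  qed
  have span: "?A \<subseteq> fs.span (g ` D)"
  proof
    fix h assume h: "h \<in> ?A"
    \<comment> \<open>The coefficient at the dual vector of \<open>d\<close> is the value of
      \<open>h\<close> on \<open>d\<close>. On \<open>B\<close> both sides vanish because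
      \<open>h\<close> annihilates \<open>I\<close>.\<close>
    let ?c = "\<lambda>d. \<Sum>x\<in>L. h x * d x"
    have "h - (\<Sum>d\<in>D. (\<lambda>x. ?c d * g d x)) = 0"
    proof (rule zero)
      show "\<forall>x. (h - (\<Sum>d\<in>D. (\<lambda>x. ?c d * g d x))) x \<noteq> 0 \<longrightarrow> x \<in> L"
        using h g(1) by (auto simp: sum_fun_apply) (metis (mono_tags, lifting) mult_zero_right sum.neutral)
      fix f assume f: "f \<in> B \<union> D"
      have "(\<Sum>x\<in>L. (\<Sum>d\<in>D. ?c d * g d x) * f x) = (\<Sum>d\<in>D. ?c d * (\<Sum>x\<in>L. g d x * f x))"
        by (simp only: sum_distrib_left sum_distrib_right, subst sum.swap) (simp add: mult.assoc)
      also have "\<dots> = (\<Sum>d\<in>D. if f = d then ?c d else 0)"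
        using f by (intro sum.cong refl) (simp add: g(2))
      also have "\<dots> = (if f \<in> D then ?c f else 0)"
        using fin by (simp add: sum.delta')
      also have "\<dots> = ?c f"
        using f h I fs.span_superset[of B] by auto
      finally show "(\<Sum>x\<in>L. (h - (\<Sum>d\<in>D. (\<lambda>x. ?c d * g d x))) x * f x) = 0"
        by (simp add: sum_fun_apply left_diff_distrib sum_subtractf)
    qed
    then have h_eq: "h = (\<Sum>d\<in>D. (\<lambda>x. ?c d * g d x))" by simp
    have "(\<lambda>x. ?c d * g d x) \<in> fs.span (g ` D)" if "d \<in> D" for d
      using that by (intro fs.span_scale fs.span_base imageI)
    then show "h \<in> fs.span (g ` D)"
      by (subst h_eq) (rule fs.span_sum)
  qed
  have "\<not> fs.dependent (g ` D)"
  proof (rule fs.independent_if_scalars_zero)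
    show "finite (g ` D)" using fin by simp
    fix c y assume s: "(\<Sum>v\<in>g ` D. (\<lambda>x. c v * v x)) = 0" and "y \<in> g ` D"
    then obtain d where d: "d \<in> D" "y = g d" by blast
    have "(\<Sum>v\<in>D. c (g v) * g v x) = 0" for x
      using fun_cong[OF s, of x] inj by (simp add: sum_fun_apply sum.reindex)
    then have "0 = (\<Sum>x\<in>L. (\<Sum>v\<in>D. c (g v) * g v x) * d x)" by simp
    also have "\<dots> = (\<Sum>v\<in>D. c (g v) * (\<Sum>x\<in>L. g v x * d x))"
      by (simp only: sum_distrib_left sum_distrib_right, subst sum.swap) (simp add: mult.assoc)
    also have "\<dots> = (\<Sum>v\<in>D. if d = v then c (g v) else 0)"
      using d by (intro sum.cong refl) (simp add: g(2))
    also have "\<dots> = c y" using fin d by simp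
    finally show "c y = 0" by simp
  qed
  then have "card (g ` D) = fs.dim ?A"
    using sub span by (rule fs.basis_card_eq_dim[rotated 2])
  then show ?thesis using card_image[OF inj] by simp
qed


section \<open>Mesh functions\<close>

definition cons_deriv :: "'b \<Rightarrow> ('b list \<Rightarrow> 'k::field) \<Rightarrow> 'b list \<Rightarrow> 'k" where
  "cons_deriv a g = (\<lambda>p. g (a # p))"

definition cons_lift :: "'b \<Rightarrow> ('b list \<Rightarrow> 'k::field) \<Rightarrow> 'b list \<Rightarrow> 'k" where
  "cons_lift a g = (\<lambda>p. case p of [] \<Rightarrow> 0 | b # q \<Rightarrow> if b = a then g q else 0)"

text \<open>A model of the direct sum of the spaces \<open>W a\<close>: a function vanishing at the
  empty word is determined by its derivatives. \<open>cons_deriv a\<close> is the transpose of left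
  multiplication by \<open>a\<close>, and \<open>cons_lift a\<close> is a section of it.\<close>

definition cons_space :: "'b set \<Rightarrow> ('b \<Rightarrow> ('b list \<Rightarrow> 'k::field) set) \<Rightarrow> ('b list \<Rightarrow> 'k) set" where
  "cons_space A W = {g. g [] = 0 \<and> (\<forall>a\<in>A. cons_deriv a g \<in> W a) \<and> (\<forall>a. a \<notin> A \<longrightarrow> cons_deriv a g = 0)}"

lemma cons_deriv_lift: "cons_deriv b (cons_lift a g) = (if b = a then g else 0)"
  by (auto simp: cons_deriv_def cons_lift_def)

lemma cons_lift_Nil: "cons_lift a g [] = 0"
  by (simp add: cons_lift_def)

lemma cons_deriv_linear: "fun_linear (cons_deriv a)"
  by (rule fun_linearI) (auto simp: cons_deriv_def)

lemma cons_ext: "f [] = g [] \<Longrightarrow> (\<And>a. cons_deriv a f = cons_deriv a g) \<Longrightarrow> f = g"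
  by (rule ext) (metis cons_deriv_def list.exhaust)

lemma fun_linear_simps:
  fixes T :: "('b \<Rightarrow> 'k::field) \<Rightarrow> ('c \<Rightarrow> 'k)"
  assumes "fun_linear T"
  shows "T (f + g) = T f + T g" "T (\<lambda>x. c * f x) = (\<lambda>x. c * T f x)" "T 0 = 0" "T (f - g) = T f - T g"
proof -
  interpret T: Vector_Spaces.linear "\<lambda>c f x. c * f x" "\<lambda>c f x. c * f x" T by fact
  show "T (f + g) = T f + T g" "T (\<lambda>x. c * f x) = (\<lambda>x. c * T f x)" "T 0 = 0" "T (f - g) = T f - T g"
    by (rule T.add T.scale T.zero T.diff)+
qed

lemma fun_linear_subspace_image:
  assumes "fun_linear T" "fs.subspace U"
  shows "fs.subspace (T ` U)"
proof -
  interpret T: Vector_Spaces.linear "\<lambda>c f x. c * f x" "\<lambda>c f x. c * f x" T by fact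
  show ?thesis using assms(2) by (rule T.subspace_image)
qed

lemma cons_space_subspace:
  assumes "\<And>a. a \<in> A \<Longrightarrow> fs.subspace (W a)"
  shows "fs.subspace (cons_space A W)"
  unfolding fs.subspace_def cons_space_def
  using assms[THEN fs.subspace_0] assms[THEN fs.subspace_add] assms[THEN fs.subspace_scale]
  by (auto simp: fun_linear_simps[OF cons_deriv_linear])

lemma fin_dim_cons_space:
  assumes "finite A" "\<And>a g p. a \<in> A \<Longrightarrow> g \<in> W a \<Longrightarrow> g p \<noteq> 0 \<Longrightarrow> p \<in> L" "finite L"
  shows "fin_dim (cons_space A W)"
proof (rule fin_dim_subset[OF fin_dim_supported])
  show "finite ((\<lambda>(a, p). a # p) ` (A \<times> L))" using assms by simp
  show "cons_space A W \<subseteq> {f. \<forall>x. f x \<noteq> 0 \<longrightarrow> x \<in> (\<lambda>(a, p). a # p) ` (A \<times> L)}"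
  proof clarify
    fix g x assume g: "g \<in> cons_space A W" and x: "g x \<noteq> 0"
    then obtain a p where xp: "x = a # p" by (cases x) (auto simp: cons_space_def)
    then have "cons_deriv a g p \<noteq> 0" using x by (simp add: cons_deriv_def)
    moreover from this have "a \<in> A" using g by (auto simp: cons_space_def)
    ultimately have "p \<in> L" using g assms(2) by (auto simp: cons_space_def)
    with \<open>a \<in> A\<close> xp show "x \<in> (\<lambda>(a, p). a # p) ` (A \<times> L)" by auto
  qed
qed

text \<open>Rank and nullity of \<open>cons_deriv a\<close> split off one letter: the kernel is the
  space for the remaining letters, and \<open>cons_lift a\<close> shows that the image is all of
  \<open>W a\<close>. The common bound \<open>L\<close> on the supports keeps everything finite
  dimensional.\<close>

lemma dim_cons_space:
  assumes "finite A" "\<And>a. a \<in> A \<Longrightarrow> fs.subspace (W a)"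
    and "\<And>a g p. a \<in> A \<Longrightarrow> g \<in> W a \<Longrightarrow> g p \<noteq> 0 \<Longrightarrow> p \<in> L" "finite L"
  shows "fs.dim (cons_space A W) = (\<Sum>a\<in>A. fs.dim (W a))"
  using assms(1-3)
proof (induction A)
  case empty
  have "g = 0" if "g \<in> cons_space {} W" for g :: "'a list \<Rightarrow> 'b"
    by (rule cons_ext)
      (use that in \<open>auto simp: cons_space_def fun_linear_simps[OF cons_deriv_linear]\<close>)
  then have "cons_space {} W = {0}"
    by (auto simp: cons_space_def fun_linear_simps[OF cons_deriv_linear])
  then have "fs.dim (cons_space {} W) = fs.dim ({} :: ('a list \<Rightarrow> 'b) set)"
    by (intro fs.span_eq_dim) (simp add: fs.span_insert_0[of "{}", simplified])
  also have "\<dots> = 0" using fs.dim_eq_card_independent[OF fs.independent_empty] by simp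
  finally show ?case by simp
next
  case (insert a A)
  have "fs.subspace (cons_space (insert a A) W)"
    by (rule cons_space_subspace) (use insert in auto)
  moreover have "fin_dim (cons_space (insert a A) W)"
    by (rule fin_dim_cons_space[where L = L]) (use insert assms(4) in auto)
  ultimately have "fs.dim (cons_space (insert a A) W) =
      fs.dim {g \<in> cons_space (insert a A) W. cons_deriv a g = 0} +
      fs.dim (cons_deriv a ` cons_space (insert a A) W)"
    by (intro rank_nullity cons_deriv_linear)
  also have "{g \<in> cons_space (insert a A) W. cons_deriv a g = 0} = cons_space A W"
  proof -
    have "0 \<in> W a" using insert.prems(1)[of a] by (simp add: fs.subspace_0)
    with insert.hyps(2) show ?thesis unfolding cons_space_def by (auto 0 3)
  qed
  also have "cons_deriv a ` cons_space (insert a A) W = W a"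
  proof (intro equalityI subsetI)
    fix w assume w: "w \<in> W a"
    have "0 \<in> W b" if "b \<in> A" for b using insert.prems(1)[of b] that by (simp add: fs.subspace_0)
    then have "cons_lift a w \<in> cons_space (insert a A) W"
      using w unfolding cons_space_def by (simp add: cons_deriv_lift cons_lift_Nil)
    moreover have "cons_deriv a (cons_lift a w) = w" by (simp add: cons_deriv_lift)
    ultimately show "w \<in> cons_deriv a ` cons_space (insert a A) W" by (intro image_eqI[of _ _ "cons_lift a w"]) simp_all
  qed (auto simp: cons_space_def)
  also have "fs.dim (cons_space A W) = (\<Sum>a\<in>A. fs.dim (W a))"
  proof (rule insert.IH)
    show "fs.subspace (W b)" if "b \<in> A" for b using insert.prems(1) that by simp
    show "p \<in> L" if "b \<in> A" "g \<in> W b" "g p \<noteq> 0" for b g p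
      using insert.prems(2)[of b g p] that by simp
  qed
  finally show ?case using insert.hyps by simp
qed

text \<open>\<open>B\<close> stands for the arrows of the double quiver, \<open>eps\<close> for the
  signs in the mesh relations and \<open>j\<close> for the vertex where all paths end. Signs enter
  only through \<open>eps_nz\<close>, so all characteristics are treated alike.\<close>

locale mesh =
  fixes B :: "'b set" and src tgt :: "'b \<Rightarrow> 'v::finite" and opp :: "'b \<Rightarrow> 'b"
    and eps :: "'b \<Rightarrow> 'k::field" and j :: 'v
  assumes finite_B: "finite B"
    and opp_B: "a \<in> B \<Longrightarrow> opp a \<in> B" and opp_opp: "a \<in> B \<Longrightarrow> opp (opp a) = a"
    and src_opp: "a \<in> B \<Longrightarrow> src (opp a) = tgt a"
    and eps_nz: "a \<in> B \<Longrightarrow> eps a \<noteq> 0"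
begin

lemma tgt_opp: "a \<in> B \<Longrightarrow> tgt (opp a) = src a"
  using src_opp[of "opp a"] opp_B opp_opp by simp

definition out :: "'v \<Rightarrow> 'b set" where "out i = {a \<in> B. src a = i}"

lemma finite_out: "finite (out i)" using finite_B by (simp add: out_def)

text \<open>The transpose of left multiplication by the mesh relation at \<open>i\<close>.\<close>

definition mesh_op :: "'v \<Rightarrow> ('b list \<Rightarrow> 'k) \<Rightarrow> 'b list \<Rightarrow> 'k" where
  "mesh_op i g = (\<lambda>p. \<Sum>a\<in>out i. eps a * g (a # opp a # p))"

text \<open>\<open>G n i\<close> is the dual of \<open>e\<^sub>i \<Pi>\<^sub>n\<^sub>-\<^sub>1 e\<^sub>j\<close>: the index is shifted by one so that \<open>G 0\<close> can stand for
  degree \<open>- 1\<close> and the recursion is uniform.\<close>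

primrec G :: "nat \<Rightarrow> 'v \<Rightarrow> ('b list \<Rightarrow> 'k) set" where
  "G 0 = (\<lambda>i. {0})"
| "G (Suc n) = (\<lambda>i. if n = 0 then {g. \<forall>p. g p \<noteq> 0 \<longrightarrow> p = [] \<and> i = j}
     else {g \<in> cons_space (out i) (\<lambda>a. G n (tgt a)). mesh_op i g = 0})"

lemma G_simps:
  "G 0 i = {0}"
  "G (Suc 0) i = {g. \<forall>p. g p \<noteq> 0 \<longrightarrow> p = [] \<and> i = j}"
  "G (Suc (Suc n)) i = {g \<in> cons_space (out i) (\<lambda>a. G (Suc n) (tgt a)). mesh_op i g = 0}"
  by simp_all

declare G.simps [simp del] G_simps(1,2) [simp]

text \<open>\<open>H (Suc n) i\<close> is the middle term of the dual sequence from
  \<open>G (Suc (Suc n)) i\<close> to \<open>G n i\<close>, with \<open>mesh_op i\<close> as its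
  second map.\<close>

definition H :: "nat \<Rightarrow> 'v \<Rightarrow> ('b list \<Rightarrow> 'k) set" where
  "H n i = cons_space (out i) (\<lambda>a. G n (tgt a))"

lemma G_Suc_Suc: "G (Suc (Suc n)) i = {g \<in> H (Suc n) i. mesh_op i g = 0}"
  by (simp add: H_def G_simps)

lemma mesh_op_linear: "fun_linear (mesh_op i)"
  by (rule fun_linearI) (auto simp: mesh_op_def algebra_simps sum.distrib sum_distrib_left)

lemma kernel_subspace: "fs.subspace U \<Longrightarrow> fun_linear T \<Longrightarrow> fs.subspace {u \<in> U. T u = 0}"
  by (auto simp: fs.subspace_def fun_linear_simps)

lemma G_subspace: "fs.subspace (G n i)"
proof (induction n arbitrary: i)
  case (Suc n)
  show ?case
  proof (cases n)
    case 0
    have "fs.subspace (G (Suc 0) i)" by (auto simp: fs.subspace_def) (metis add_0)+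
    then show ?thesis using 0 by simp
  next
    case (Suc m)
    then show ?thesis
      unfolding Suc G_simps(3)
      by (intro kernel_subspace cons_space_subspace mesh_op_linear) (use Suc.IH Suc in simp)
  qed
qed (simp add: fs.subspace_def zero_fun_def)

lemma H_subspace: "fs.subspace (H n i)"
  unfolding H_def by (rule cons_space_subspace) (rule G_subspace)

lemma cons_deriv_G: "g \<in> G (Suc n) i \<Longrightarrow> a \<in> out i \<Longrightarrow> cons_deriv a g \<in> G n (tgt a)"
  by (cases n) (auto simp: G_simps(3) cons_space_def cons_deriv_def fun_eq_iff)

lemma mesh_op_alt: "mesh_op i g = (\<Sum>a\<in>out i. (\<lambda>p. eps a * cons_deriv (opp a) (cons_deriv a g) p))"
  by (auto simp: mesh_op_def cons_deriv_def sum_fun_apply)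

text \<open>Deleting \<open>a\<close> lands in level \<open>Suc n\<close> at \<open>tgt a\<close>,
  and deleting \<open>opp a\<close> in level \<open>n\<close> back at \<open>i\<close>. So every
  term of the sum already lies in \<open>G n i\<close>; no cancellation is involved.\<close>

lemma mesh_op_H: "g \<in> H (Suc n) i \<Longrightarrow> mesh_op i g \<in> G n i"
  unfolding mesh_op_alt
proof (rule fs.subspace_sum[OF G_subspace], rule fs.subspace_scale[OF G_subspace])
  fix a assume g: "g \<in> H (Suc n) i" and a: "a \<in> out i"
  then have "cons_deriv a g \<in> G (Suc n) (tgt a)" by (auto simp: H_def cons_space_def)
  then have "cons_deriv (opp a) (cons_deriv a g) \<in> G n (tgt (opp a))"
    using a by (intro cons_deriv_G) (auto simp: out_def opp_B src_opp)
  then show "cons_deriv (opp a) (cons_deriv a g) \<in> G n i" using a by (simp add: out_def tgt_opp)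
qed

lemma G_support: "g \<in> G n i \<Longrightarrow> g p \<noteq> 0 \<Longrightarrow> set p \<subseteq> B \<and> length p < n"
proof (induction n arbitrary: g i p)
  case (Suc n)
  show ?case
  proof (cases p)
    case (Cons a q)
    show ?thesis
    proof (cases n)
      case (Suc m)
      have "a \<in> out i" using Suc Cons Suc.prems
        by (auto simp: G_simps(3) cons_space_def cons_deriv_def) (metis zero_fun_apply)
      moreover have "cons_deriv a g q \<noteq> 0" using Suc.prems Cons by (simp add: cons_deriv_def)
      ultimately show ?thesis
        using Suc.IH[of "cons_deriv a g" "tgt a" q] cons_deriv_G[OF Suc.prems(1)] Cons
        by (auto simp: out_def)
    qed (use Suc.prems Cons in auto)
  qed simp
qed simp

lemma finite_support: "finite {p. set p \<subseteq> B \<and> length p \<le> n}"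
  using finite_B by (rule finite_lists_length_le)

lemma fin_dim_H: "fin_dim (H n i)"
  unfolding H_def
  by (rule fin_dim_cons_space[OF finite_out _ finite_support[of n]]) (auto dest: G_support)

lemma dim_H: "fs.dim (H n i) = (\<Sum>a\<in>out i. fs.dim (G n (tgt a)))"
  unfolding H_def
  by (rule dim_cons_space[OF finite_out G_subspace _ finite_support[of n]]) (auto dest: G_support)

text \<open>On a function concentrated on words beginning with \<open>opp b\<close>, only the
  summand \<open>a = opp b\<close> of the mesh operator survives. Hence every derivative of an
  element of \<open>G (Suc n)\<close> is, up to a unit, a mesh image; the endomorphism arguments
  rest on this.\<close>

lemma cons_lift_opp:
  assumes "b \<in> B" "g \<in> G (Suc n) (src b)"
  shows "cons_lift (opp b) g \<in> H (Suc n) (tgt b)"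
    and "mesh_op (tgt b) (cons_lift (opp b) g) = (\<lambda>p. eps (opp b) * cons_deriv b g p)"
proof -
  have ob: "opp b \<in> out (tgt b)" using assms by (simp add: out_def opp_B src_opp)
  show "cons_lift (opp b) g \<in> H (Suc n) (tgt b)"
    using assms ob fs.subspace_0[OF G_subspace]
    by (auto simp: H_def cons_space_def cons_deriv_lift cons_lift_Nil tgt_opp)
  show "mesh_op (tgt b) (cons_lift (opp b) g) = (\<lambda>p. eps (opp b) * cons_deriv b g p)"
  proof
    fix p
    have "(\<Sum>a\<in>out (tgt b). eps a * cons_lift (opp b) g (a # opp a # p)) =
        (\<Sum>a\<in>out (tgt b). if a = opp b then eps (opp b) * g (b # p) else 0)"
      using assms(1) by (intro sum.cong) (auto simp: cons_lift_def opp_opp)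
    then show "mesh_op (tgt b) (cons_lift (opp b) g) p = eps (opp b) * cons_deriv b g p"
      using ob finite_out by (simp add: mesh_op_def cons_deriv_def)
  qed
qed

section \<open>Endomorphisms of two consecutive levels\<close>

definition G_hom :: "nat \<Rightarrow> ('v \<Rightarrow> ('b list \<Rightarrow> 'k) \<Rightarrow> ('b list \<Rightarrow> 'k)) \<Rightarrow> bool" where
  "G_hom n \<phi> \<longleftrightarrow> (\<forall>i. \<forall>g\<in>G n i. \<phi> i g \<in> G n i \<and> (\<forall>h\<in>G n i. \<phi> i (g + h) = \<phi> i g + \<phi> i h) \<and>
     (\<forall>c. \<phi> i (\<lambda>x. c * g x) = (\<lambda>x. c * \<phi> i g x)))"

lemma G_homD:
  assumes "G_hom n \<phi>" "g \<in> G n i"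
  shows "\<phi> i g \<in> G n i" "h \<in> G n i \<Longrightarrow> \<phi> i (g + h) = \<phi> i g + \<phi> i h"
    "\<phi> i (\<lambda>x. c * g x) = (\<lambda>x. c * \<phi> i g x)"
  using assms by (auto simp: G_hom_def)

lemma G_hom_0: "G_hom n \<phi> \<Longrightarrow> \<phi> i 0 = 0"
  using G_homD(3)[of n \<phi> 0 i 0] fs.subspace_0[OF G_subspace] by (simp add: zero_fun_def)

text \<open>The pair \<open>(G n, G (Suc n))\<close> is viewed as a representation of the bipartite double cover, so an
  endomorphism consists of independent maps \<open>\<phi>\<close> and \<open>\<psi>\<close> on the two levels.\<close>

definition scalar_endos :: "nat \<Rightarrow> bool" where
  "scalar_endos n \<longleftrightarrow> (\<forall>\<phi> \<psi>. G_hom n \<phi> \<longrightarrow> G_hom (Suc n) \<psi> \<longrightarrow>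
     (\<forall>a\<in>B. \<forall>g\<in>G (Suc n) (src a). \<phi> (tgt a) (cons_deriv a g) = cons_deriv a (\<psi> (src a) g)) \<longrightarrow>
     (\<exists>c. \<forall>i. (\<forall>g\<in>G n i. \<phi> i g = (\<lambda>x. c * g x)) \<and> (\<forall>g\<in>G (Suc n) i. \<psi> i g = (\<lambda>x. c * g x))))"

text \<open>Dual to the statement that no nonzero element of degree \<open>n - 1\<close> in
  \<open>\<Pi> e\<^sub>j\<close> is annihilated from the left by every arrow.\<close>

definition mesh_onto :: "nat \<Rightarrow> bool" where
  "mesh_onto n \<longleftrightarrow> (\<forall>i. mesh_op i ` H (Suc n) i = G n i)"

text \<open>Level 0 vanishes and level 1 is a line at \<open>j\<close>, spanned by the indicator of
  the empty word: a simple representation. The scalar is read off from the image of that vector at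
  the empty word.\<close>

lemma scalar_endos_0: "scalar_endos 0"
  unfolding scalar_endos_def
proof (intro allI impI)
  fix \<phi> \<psi> assume hom: "G_hom 0 \<phi>" "G_hom (Suc 0) \<psi>"
  let ?e = "\<lambda>p :: 'b list. if p = [] then 1 else 0 :: 'k"
  have e: "?e \<in> G (Suc 0) j" by auto
  have scal: "g = (\<lambda>x. g [] * ?e x)" "i \<noteq> j \<Longrightarrow> g = 0" if "g \<in> G (Suc 0) i" for g i
    using that by (auto simp: fun_eq_iff)
  have "\<psi> i g = (\<lambda>x. \<psi> j ?e [] * g x)" if g: "g \<in> G (Suc 0) i" for i g
  proof (cases "i = j")
    case True
    have "\<psi> i g = \<psi> j (\<lambda>x. g [] * ?e x)" using scal(1)[OF g] True by simp
    also have "\<dots> = (\<lambda>x. g [] * \<psi> j ?e x)" using G_homD(3)[OF hom(2) e] .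
    also have "\<dots> = (\<lambda>x. g [] * (\<psi> j ?e [] * ?e x))"
      using scal(1)[OF G_homD(1)[OF hom(2) e]] by metis
    also have "\<dots> = (\<lambda>x. \<psi> j ?e [] * (g [] * ?e x))" by (simp add: mult_ac)
    also have "\<dots> = (\<lambda>x. \<psi> j ?e [] * g x)" using scal(1)[OF g] by metis
    finally show ?thesis .
  next
    case False
    then show ?thesis using scal(2)[OF g] G_hom_0[OF hom(2)] by auto
  qed
  moreover have "\<phi> i g = (\<lambda>x. \<psi> j ?e [] * g x)" if "g \<in> G 0 i" for i g
    using that G_hom_0[OF hom(1)] by auto
  ultimately show "\<exists>c. \<forall>i. (\<forall>g\<in>G 0 i. \<phi> i g = (\<lambda>x. c * g x)) \<and> (\<forall>g\<in>G (Suc 0) i. \<psi> i g = (\<lambda>x. c * g x))"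
    by blast
qed

text \<open>If \<open>y\<close> is missed by the mesh map and the functional \<open>l\<close> vanishes on its image, then \<open>l(\<cdot>) y\<close> on level
  \<open>n\<close> together with \<open>0\<close> on level \<open>Suc n\<close> is an endomorphism, the projection to a simple summand.\<close>

lemma mesh_onto_if_scalar_endos:
  assumes endo: "scalar_endos n" and nz: "G (Suc n) k \<noteq> {0}"
  shows "mesh_onto n"
  unfolding mesh_onto_def
proof (intro allI equalityI)
  fix i
  show "mesh_op i ` H (Suc n) i \<subseteq> G n i" using mesh_op_H by blast
  show "G n i \<subseteq> mesh_op i ` H (Suc n) i"
  proof
    fix y assume y: "y \<in> G n i"
    show "y \<in> mesh_op i ` H (Suc n) i"
    proof (rule ccontr)
      assume "y \<notin> mesh_op i ` H (Suc n) i"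
      then obtain l where l: "functional l" "l y = 1" "\<And>w. w \<in> mesh_op i ` H (Suc n) i \<Longrightarrow> l w = 0"
        using functional_separate[OF fun_linear_subspace_image[OF mesh_op_linear H_subspace]] by metis
      define \<phi> where "\<phi> = (\<lambda>i' g x. if i' = i then l g * y x else 0)"
      define \<psi> where "\<psi> = (\<lambda>(i'::'v) (g :: 'b list \<Rightarrow> 'k). 0 :: 'b list \<Rightarrow> 'k)"
      \<comment> \<open>Up to a unit the derivative is a mesh image, and \<open>l\<close> vanishes
        there. This makes \<open>\<phi>\<close> compatible with \<open>\<psi> = 0\<close>.\<close>
      have ld: "l (cons_deriv b g) = 0" if b: "b \<in> B" "tgt b = i" and g: "g \<in> G (Suc n) (src b)" for b g
      proof -
        have "(\<lambda>p. eps (opp b) * cons_deriv b g p) \<in> mesh_op i ` H (Suc n) i"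
          using cons_lift_opp[OF b(1) g] b(2) by (metis imageI)
        then have "l (\<lambda>p. eps (opp b) * cons_deriv b g p) = 0" by (rule l(3))
        then show ?thesis using l(1) eps_nz[OF opp_B[OF b(1)]] by (simp add: functional_iff)
      qed
      have "G_hom n \<phi>"
        unfolding G_hom_def
      proof (intro allI ballI conjI)
        fix i' g assume g: "g \<in> G n i'"
        show "\<phi> i' g \<in> G n i'"
        proof (cases "i' = i")
          case True
          then show ?thesis using fs.subspace_scale[OF G_subspace y, of "l g"] by (simp add: \<phi>_def)
        next
          case False
          then show ?thesis using fs.subspace_0[OF G_subspace, of n i'] by (simp add: \<phi>_def zero_fun_def)
        qed
      qed (use l(1) in \<open>auto simp: \<phi>_def functional_iff algebra_simps\<close>)
      moreover have "G_hom (Suc n) \<psi>"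
        using fs.subspace_0[OF G_subspace] by (auto simp: G_hom_def \<psi>_def)
      moreover have "\<phi> (tgt a) (cons_deriv a g) = cons_deriv a (\<psi> (src a) g)"
        if "a \<in> B" "g \<in> G (Suc n) (src a)" for a g
        using ld[OF that(1) _ that(2)] by (auto simp: \<phi>_def \<psi>_def cons_deriv_def)
      ultimately obtain c where c: "\<And>i g. g \<in> G n i \<Longrightarrow> \<phi> i g = (\<lambda>x. c * g x)"
          "\<And>i g. g \<in> G (Suc n) i \<Longrightarrow> \<psi> i g = (\<lambda>x. c * g x)"
        using endo unfolding scalar_endos_def by metis
      have "l (\<lambda>x. 0 * y x) = 0 * l y" using l(1) unfolding functional_iff by blast
      then have "y \<noteq> 0" using l(2) by (auto simp: zero_fun_def)
      then obtain x where "y x \<noteq> 0" by (auto simp: fun_eq_iff)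
      moreover have "y x = c * y x" using fun_cong[OF c(1)[OF y], of x] l(2) by (simp add: \<phi>_def)
      ultimately have "c = 1" by simp
      \<comment> \<open>The scalar is 1 because \<open>\<phi> i y = y\<close>, yet it acts on level
        \<open>Suc n\<close> as the zero map \<open>\<psi>\<close>.\<close>
      then have "G (Suc n) k \<subseteq> {0}" using c(2)[of _ k] by (auto simp: \<psi>_def)
      then show False using nz fs.subspace_0[OF G_subspace, of "Suc n" k] by blast
    qed
  qed
qed

text \<open>The mesh map presents \<open>G n\<close> as the quotient of \<open>H (n + 1)\<close> by \<open>G (n + 2)\<close>, so an endomorphism of
  the levels \<open>(n + 1, n + 2)\<close> induces one of the levels \<open>(n, n + 1)\<close>.\<close>

lemma scalar_endos_Suc:
  assumes endo: "scalar_endos n" and onto: "mesh_onto n"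
  shows "scalar_endos (Suc n)"
  unfolding scalar_endos_def
proof (intro allI impI)
  fix \<psi> \<omega> assume hom: "G_hom (Suc n) \<psi>" "G_hom (Suc (Suc n)) \<omega>"
    and comm: "\<forall>a\<in>B. \<forall>g\<in>G (Suc (Suc n)) (src a).
      \<psi> (tgt a) (cons_deriv a g) = cons_deriv a (\<omega> (src a) g)"
  \<comment> \<open>The map that \<open>\<psi>\<close> induces on \<open>H (Suc n)\<close>, summand
    by summand.\<close>
  define \<Psi> where "\<Psi> = (\<lambda>i g p. case p of [] \<Rightarrow> 0 |
    a # q \<Rightarrow> if a \<in> out i then \<psi> (tgt a) (cons_deriv a g) q else 0)"
  have d\<Psi>: "cons_deriv a (\<Psi> i g) = (if a \<in> out i then \<psi> (tgt a) (cons_deriv a g) else 0)" for a i g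
    by (auto simp: cons_deriv_def \<Psi>_def)
  have \<Psi>nil: "\<Psi> i g [] = 0" for i g by (simp add: \<Psi>_def)
  have Hd: "cons_deriv a u \<in> G (Suc n) (tgt a)" if "u \<in> H (Suc n) i" "a \<in> out i" for a u i
    using that by (auto simp: H_def cons_space_def)
  have \<Psi>H: "\<Psi> i u \<in> H (Suc n) i" if "u \<in> H (Suc n) i" for i u
    using Hd[OF that] G_homD(1)[OF hom(1)] by (auto simp: H_def cons_space_def d\<Psi> \<Psi>nil)
  have \<Psi>add: "\<Psi> i (u + v) = \<Psi> i u + \<Psi> i v" if "u \<in> H (Suc n) i" "v \<in> H (Suc n) i" for i u v
    by (rule cons_ext)
      (use Hd[OF that(1)] Hd[OF that(2)] G_homD(2)[OF hom(1)] in \<open>auto simp: \<Psi>nil d\<Psi> fun_linear_simps[OF cons_deriv_linear]\<close>)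
  have \<Psi>scale: "\<Psi> i (\<lambda>x. c * u x) = (\<lambda>x. c * \<Psi> i u x)" if "u \<in> H (Suc n) i" for i u c
    by (rule cons_ext)
      (use Hd[OF that] G_homD(3)[OF hom(1)] in \<open>auto simp: \<Psi>nil d\<Psi> fun_linear_simps[OF cons_deriv_linear]\<close>)
  have ker: "mesh_op i (\<Psi> i u) = 0" if u: "u \<in> H (Suc n) i" "mesh_op i u = 0" for i u
  proof -
    have uG: "u \<in> G (Suc (Suc n)) i" using u by (simp add: G_Suc_Suc)
    have \<omega>G: "\<omega> i u \<in> G (Suc (Suc n)) i" using G_homD(1)[OF hom(2) uG] .
    \<comment> \<open>On the kernel of the mesh map the induced map is \<open>\<omega>\<close>,
      since both have the same derivatives. So the kernel is preserved and a map on the quotient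
      \<open>G n\<close> results.\<close>
    have "\<Psi> i u = \<omega> i u"
      by (rule cons_ext)
        (use \<omega>G comm uG in \<open>auto simp: \<Psi>nil d\<Psi> G_simps(3) cons_space_def out_def\<close>)
    then show ?thesis using \<omega>G by (simp add: G_Suc_Suc)
  qed
  define \<phi> where "\<phi> = (\<lambda>i y. mesh_op i (\<Psi> i (SOME u. u \<in> H (Suc n) i \<and> mesh_op i u = y)))"
  have \<phi>: "\<phi> i (mesh_op i u) = mesh_op i (\<Psi> i u)" if u: "u \<in> H (Suc n) i" for i u
  proof -
    define v where "v = (SOME v. v \<in> H (Suc n) i \<and> mesh_op i v = mesh_op i u)"
    have v: "v \<in> H (Suc n) i" "mesh_op i v = mesh_op i u"
      using someI[of "\<lambda>v. v \<in> H (Suc n) i \<and> mesh_op i v = mesh_op i u" u] u by (auto simp: v_def)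
    have d: "v - u \<in> H (Suc n) i" using fs.subspace_diff[OF H_subspace] v u by blast
    have "mesh_op i (\<Psi> i v) = mesh_op i (\<Psi> i (u + (v - u)))" by simp
    also have "\<dots> = mesh_op i (\<Psi> i u) + mesh_op i (\<Psi> i (v - u))"
      by (simp only: \<Psi>add[OF u d] fun_linear_simps[OF mesh_op_linear])
    also have "mesh_op i (\<Psi> i (v - u)) = 0"
      using d v by (intro ker) (simp_all add: fun_linear_simps[OF mesh_op_linear])
    finally show ?thesis by (simp add: \<phi>_def v_def)
  qed
  have im: "\<exists>u\<in>H (Suc n) i. g = mesh_op i u" if "g \<in> G n i" for i g
    using onto that by (auto simp: mesh_onto_def)
  have "G_hom n \<phi>"
    unfolding G_hom_def
  proof (intro allI ballI conjI)
    fix i g assume "g \<in> G n i"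
    then obtain u where u: "u \<in> H (Suc n) i" "g = mesh_op i u" using im by blast
    show "\<phi> i g \<in> G n i" using u \<Psi>H by (auto simp: \<phi> intro: mesh_op_H)
    fix h assume "h \<in> G n i"
    then obtain v where v: "v \<in> H (Suc n) i" "h = mesh_op i v" using im by blast
    have "g + h = mesh_op i (u + v)" by (simp add: u v fun_linear_simps[OF mesh_op_linear])
    then have "\<phi> i (g + h) = mesh_op i (\<Psi> i (u + v))"
      using \<phi>[OF fs.subspace_add[OF H_subspace u(1) v(1)]] by simp
    then show "\<phi> i (g + h) = \<phi> i g + \<phi> i h"
      using u v by (simp add: \<Psi>add fun_linear_simps[OF mesh_op_linear] \<phi>)
  next
    fix i g c assume "g \<in> G n i"
    then obtain u where u: "u \<in> H (Suc n) i" "g = mesh_op i u" using im by blast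
    have "(\<lambda>x. c * g x) = mesh_op i (\<lambda>x. c * u x)" by (simp add: u fun_linear_simps[OF mesh_op_linear])
    then have "\<phi> i (\<lambda>x. c * g x) = mesh_op i (\<Psi> i (\<lambda>x. c * u x))"
      using \<phi>[OF fs.subspace_scale[OF H_subspace u(1)]] by simp
    then show "\<phi> i (\<lambda>x. c * g x) = (\<lambda>x. c * \<phi> i g x)"
      using u by (simp add: \<Psi>scale fun_linear_simps[OF mesh_op_linear] \<phi>)
  qed
  moreover have "\<phi> (tgt b) (cons_deriv b g) = cons_deriv b (\<psi> (src b) g)"
    if b: "b \<in> B" and g: "g \<in> G (Suc n) (src b)" for b g
  proof -
    \<comment> \<open>A test element of \<open>H (Suc n)\<close> whose mesh image is the derivative
      along \<open>b\<close> up to the unit \<open>?e\<close>, which is cancelled at the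
      end.\<close>
    let ?u = "cons_lift (opp b) g" and ?e = "eps (opp b)"
    have dG: "cons_deriv b g \<in> G n (tgt b)" using cons_deriv_G[OF g] b by (simp add: out_def)
    have \<Psi>u: "\<Psi> (tgt b) ?u = cons_lift (opp b) (\<psi> (src b) g)"
      by (rule cons_ext)
        (use b in \<open>auto simp: \<Psi>nil d\<Psi> cons_deriv_lift out_def opp_B src_opp tgt_opp G_hom_0[OF hom(1)] cons_lift_Nil\<close>)
    have "(\<lambda>p. ?e * \<phi> (tgt b) (cons_deriv b g) p) = \<phi> (tgt b) (\<lambda>p. ?e * cons_deriv b g p)"
      using G_homD(3)[OF \<open>G_hom n \<phi>\<close> dG] by simp
    also have "\<dots> = mesh_op (tgt b) (\<Psi> (tgt b) ?u)"
      using \<phi>[OF cons_lift_opp(1)[OF b g]] by (simp only: cons_lift_opp(2)[OF b g])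
    also have "\<dots> = (\<lambda>p. ?e * cons_deriv b (\<psi> (src b) g) p)"
      unfolding \<Psi>u using cons_lift_opp(2)[OF b G_homD(1)[OF hom(1) g]] .
    finally show ?thesis using eps_nz[OF opp_B[OF b]] by (simp add: fun_eq_iff)
  qed
  ultimately obtain c where c: "\<And>i g. g \<in> G (Suc n) i \<Longrightarrow> \<psi> i g = (\<lambda>x. c * g x)"
    using endo hom(1) unfolding scalar_endos_def by metis
  \<comment> \<open>Elements of this level vanish at the empty word and are determined by their
    derivatives, on which the scalar is already known.\<close>
  have "\<omega> i g = (\<lambda>x. c * g x)" if g: "g \<in> G (Suc (Suc n)) i" for i g
  proof (rule cons_ext)
    have \<omega>: "\<omega> i g \<in> G (Suc (Suc n)) i" using G_homD(1)[OF hom(2) g] .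
    then show "\<omega> i g [] = c * g []" using g by (simp add: G_simps(3) cons_space_def)
    fix a show "cons_deriv a (\<omega> i g) = cons_deriv a (\<lambda>x. c * g x)"
    proof (cases "a \<in> out i")
      case True
      then have "cons_deriv a (\<omega> i g) = \<psi> (tgt a) (cons_deriv a g)"
        using comm g by (auto simp: out_def)
      also have "\<dots> = (\<lambda>x. c * cons_deriv a g x)" using c cons_deriv_G[OF g True] by blast
      finally show ?thesis by (simp add: cons_deriv_def)
    next
      case False
      then show ?thesis using \<omega> g
        by (auto simp: G_simps(3) cons_space_def fun_linear_simps[OF cons_deriv_linear])
    qed
  qed
  with c show "\<exists>c. \<forall>i. (\<forall>g\<in>G (Suc n) i. \<psi> i g = (\<lambda>x. c * g x)) \<and>
      (\<forall>g\<in>G (Suc (Suc n)) i. \<omega> i g = (\<lambda>x. c * g x))"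
    by blast
qed

section \<open>Dimensions of the levels and their growth\<close>

lemma dim_G_rec:
  assumes "mesh_onto n"
  shows "fs.dim (G (Suc (Suc n)) i) + fs.dim (G n i) = (\<Sum>a\<in>out i. fs.dim (G (Suc n) (tgt a)))"
  \<comment> \<open>On \<open>H (Suc n) i\<close> the mesh map has kernel
    \<open>G (Suc (Suc n)) i\<close> and, by assumption, image \<open>G n i\<close>.\<close>
  using rank_nullity[OF fin_dim_H[of "Suc n" i] H_subspace mesh_op_linear[of i]] assms
  by (simp add: dim_H mesh_onto_def G_Suc_Suc)

lemma dim_G_0: "fs.dim (G 0 i) = 0"
proof -
  have "fs.dim (G 0 i) = fs.dim ({} :: ('b list \<Rightarrow> 'k) set)"
    by (intro fs.span_eq_dim) (simp add: fs.span_insert_0[of "{}", simplified])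
  then show ?thesis using fs.dim_eq_card_independent[OF fs.independent_empty] by simp
qed

lemma dim_G_1: "fs.dim (G (Suc 0) i) = (if i = j then 1 else 0)"
proof (cases "i = j")
  case True
  let ?e = "\<lambda>p :: 'b list. if p = [] then 1 else 0 :: 'k"
  have "G (Suc 0) i \<subseteq> fs.span {?e}"
  proof
    fix g assume "g \<in> G (Suc 0) i"
    then have "g = (\<lambda>x. g [] * ?e x)" by (auto simp: fun_eq_iff)
    then show "g \<in> fs.span {?e}" using fs.span_scale[OF fs.span_base[of ?e "{?e}"], of "g []"] by auto
  qed
  moreover have "?e \<noteq> 0" by (auto simp: fun_eq_iff intro: exI[of _ "[]"])
  then have "\<not> fs.dependent {?e}" by (simp only: fs.dependent_single not_False_eq_True)
  moreover have "{?e} \<subseteq> G (Suc 0) i" using True by auto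
  ultimately have "fs.dim (G (Suc 0) i) = card {?e}"
    using fs.dim_unique by metis
  then show ?thesis using True by simp
next
  case False
  then have "G (Suc 0) i = G 0 i" by (auto simp: fun_eq_iff)
  then show ?thesis using False dim_G_0 by metis
qed

lemma sum_out: "(\<Sum>i\<in>UNIV. \<Sum>a\<in>out i. f a) = (\<Sum>a\<in>B. f a)" for f :: "'b \<Rightarrow> nat"
proof -
  have "(\<Sum>i\<in>UNIV. \<Sum>a\<in>out i. f a) = (\<Sum>a\<in>(\<Union>i. out i). f a)"
    using finite_out by (subst sum.UNION_disjoint) (auto simp: out_def)
  also have "(\<Union>i. out i) = B" by (auto simp: out_def)
  finally show ?thesis .
qed

lemma sum_opp: "(\<Sum>a\<in>B. f (opp a)) = (\<Sum>a\<in>B. f a)" for f :: "'b \<Rightarrow> nat"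
  by (rule sum.reindex_bij_witness[where i = opp and j = opp]) (auto simp: opp_B opp_opp)

text \<open>The weighted total dimension is convex in the degree, hence strictly increasing, and it never
  returns to \<open>0\<close>.\<close>

theorem mesh_onto:
  fixes \<delta> :: "'v \<Rightarrow> nat"
  assumes pos: "\<And>i. \<delta> i > 0" and super: "\<And>i. 2 * \<delta> i \<le> (\<Sum>a\<in>out i. \<delta> (tgt a))"
  shows "mesh_onto n"
proof -
  define x where "x n = (\<Sum>i\<in>UNIV. \<delta> i * fs.dim (G n i))" for n
  have nz: "\<exists>k. G (Suc n) k \<noteq> {0}" if "x n < x (Suc n)" for n
  proof (rule ccontr)
    assume "\<nexists>k. G (Suc n) k \<noteq> {0}"
    then have "G (Suc n) k = G 0 k" for k by auto
    then have "x (Suc n) = 0" unfolding x_def by (simp add: dim_G_0 del: G_simps)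
    with that show False by simp
  qed
  have "scalar_endos n \<and> x n < x (Suc n)" for n
  proof (induction n)
    case 0
    have "x 0 = 0" unfolding x_def by (simp add: dim_G_0 del: G_simps)
    moreover have "x (Suc 0) = \<delta> j" unfolding x_def dim_G_1 by (simp add: if_distrib cong: if_cong)
    ultimately show ?case using scalar_endos_0 pos by simp
  next
    case (Suc n)
    obtain k where "G (Suc n) k \<noteq> {0}" using nz Suc by blast
    then have onto: "mesh_onto n" using mesh_onto_if_scalar_endos Suc by blast
    let ?d = "\<lambda>i. fs.dim (G (Suc n) i)"
    have "x (Suc (Suc n)) + x n = (\<Sum>i\<in>UNIV. \<delta> i * (\<Sum>a\<in>out i. ?d (tgt a)))"
      unfolding x_def sum.distrib[symmetric] distrib_left[symmetric] dim_G_rec[OF onto] ..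
    also have "\<dots> = (\<Sum>i\<in>UNIV. \<Sum>a\<in>out i. \<delta> (src a) * ?d (tgt a))"
      by (auto simp: sum_distrib_left out_def intro!: sum.cong)
    \<comment> \<open>Reindexing by \<open>opp\<close> exchanges sources and targets. This moves the
      neighbour sum from the dimensions to the weights, where \<open>super\<close> applies.\<close>
    also have "\<dots> = (\<Sum>a\<in>B. \<delta> (src (opp a)) * ?d (tgt (opp a)))"
      unfolding sum_out by (subst sum_opp[symmetric]) simp
    also have "\<dots> = (\<Sum>a\<in>B. \<delta> (tgt a) * ?d (src a))"
      by (intro sum.cong) (auto simp: src_opp tgt_opp)
    also have "\<dots> = (\<Sum>i\<in>UNIV. \<Sum>a\<in>out i. \<delta> (tgt a) * ?d (src a))"
      unfolding sum_out ..
    also have "\<dots> = (\<Sum>i\<in>UNIV. (\<Sum>a\<in>out i. \<delta> (tgt a)) * ?d i)"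
      by (auto simp: sum_distrib_right out_def intro!: sum.cong)
    also have "\<dots> \<ge> (\<Sum>i\<in>UNIV. 2 * \<delta> i * ?d i)"
      by (intro sum_mono mult_right_mono super) simp
    also have "(\<Sum>i\<in>UNIV. 2 * \<delta> i * ?d i) = 2 * x (Suc n)"
      by (simp add: x_def sum_distrib_left mult.assoc)
    finally have "x (Suc (Suc n)) + x n \<ge> 2 * x (Suc n)" .
    with Suc have "x (Suc n) < x (Suc (Suc n))" by linarith
    with scalar_endos_Suc onto Suc show ?case by blast
  qed
  then show ?thesis using nz mesh_onto_if_scalar_endos by blast
qed

end


section \<open>Superadditive functions and Dynkin diagrams\<close>

text \<open>Equality everywhere would make \<delta> an additive function, as the minimal imaginary
  root of an extended Dynkin diagram is. Since the sum runs over \<open>V\<close>, one multiplicity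
  function serves all vertex subsets.\<close>

definition superadditive :: "('v \<Rightarrow> 'v \<Rightarrow> nat) \<Rightarrow> 'v set \<Rightarrow> ('v \<Rightarrow> nat) \<Rightarrow> bool" where
  "superadditive m V \<delta> \<longleftrightarrow> (\<forall>v\<in>V. 2 * \<delta> v \<le> (\<Sum>u\<in>V. m v u * \<delta> u))"

definition has_superadditive :: "('v \<Rightarrow> 'v \<Rightarrow> nat) \<Rightarrow> 'v set \<Rightarrow> bool" where
  "has_superadditive m V \<longleftrightarrow> (\<exists>\<delta>. superadditive m V \<delta> \<and> (\<exists>v\<in>V. \<delta> v > 0))"

text \<open>Connectedness is stated through cuts because both uses, enlarging a support and deleting
  a leaf, ask for an edge across a given cut.\<close>

definition mult_connected :: "('v \<Rightarrow> 'v \<Rightarrow> nat) \<Rightarrow> 'v set \<Rightarrow> bool" where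
  "mult_connected m V \<longleftrightarrow> (\<forall>S\<subseteq>V. S \<noteq> {} \<longrightarrow> S \<noteq> V \<longrightarrow> (\<exists>u\<in>S. \<exists>v\<in>V - S. m u v > 0))"

text \<open>Extension by zero: inside \<open>W\<close> the sum is unchanged, and outside
  \<open>W\<close> the left side of the inequality is 0.\<close>

lemma has_superadditive_mono:
  assumes "has_superadditive m W" "W \<subseteq> V" "finite V"
  shows "has_superadditive m V"
proof -
  obtain \<delta> where \<delta>: "superadditive m W \<delta>" "\<exists>v\<in>W. \<delta> v > 0"
    using assms(1) by (auto simp: has_superadditive_def)
  let ?\<delta> = "\<lambda>v. if v \<in> W then \<delta> v else 0"
  have "(\<Sum>u\<in>V. m v u * ?\<delta> u) = (\<Sum>u\<in>W. m v u * \<delta> u)" for v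
    using assms by (intro sum.mono_neutral_cong_right) auto
  then have "superadditive m V ?\<delta>" using \<delta>(1) by (auto simp: superadditive_def)
  moreover have "\<exists>v\<in>V. ?\<delta> v > 0" using \<delta>(2) assms(2) by auto
  ultimately show ?thesis unfolding has_superadditive_def by blast
qed

text \<open>By connectedness some zero of \<delta> is adjacent to the support, and the support can
  be enlarged by it; the induction is on the number of zeros.\<close>

lemma superadditive_positive:
  assumes "finite V" "mult_connected m V" "\<And>u v. m u v = m v u" "has_superadditive m V"
  obtains \<delta> where "superadditive m V \<delta>" "\<And>v. v \<in> V \<Longrightarrow> \<delta> v > 0"
proof -
  have "\<exists>\<delta>'. superadditive m V \<delta>' \<and> (\<forall>v\<in>V. \<delta>' v > 0)"
    if "superadditive m V \<delta>" "\<exists>v\<in>V. \<delta> v > 0" for \<delta>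
    using that
  proof (induction "card {v \<in> V. \<delta> v = 0}" arbitrary: \<delta> rule: less_induct)
    case less
    show ?case
    proof (cases "\<forall>v\<in>V. \<delta> v > 0")
      case False
      let ?S = "{v \<in> V. \<delta> v > 0}"
      obtain z where "z \<in> V" "z \<notin> ?S" using False by auto
      then have "?S \<subseteq> V" "?S \<noteq> {}" "?S \<noteq> V" using less.prems by blast+
      then obtain u v where uv: "u \<in> ?S" "v \<in> V - ?S" "m u v > 0"
        using assms(2) unfolding mult_connected_def by meson
      \<comment> \<open>Doubling raises the neighbour sum at \<open>v\<close> from at least 1 to at
        least 2, which is what the new weight 1 at \<open>v\<close> demands. At the other vertices
        the inequality is doubled and can only gain on the right.\<close>
      define \<delta>' where "\<delta>' = (\<lambda>x. 2 * \<delta> x + (if x = v then 1 else 0))"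
      have v: "v \<in> V" "\<delta> v = 0" using uv by auto
      have "superadditive m V \<delta>'"
        unfolding superadditive_def
      proof
        fix x assume x: "x \<in> V"
        have "(\<Sum>u\<in>V. m x u * \<delta>' u) = 2 * (\<Sum>u\<in>V. m x u * \<delta> u) + (\<Sum>u\<in>V. if u = v then m x u else 0)"
          unfolding \<delta>'_def sum_distrib_left sum.distrib[symmetric] by (intro sum.cong) auto
        then have s: "(\<Sum>u\<in>V. m x u * \<delta>' u) \<ge> 2 * (\<Sum>u\<in>V. m x u * \<delta> u)" by simp
        show "2 * \<delta>' x \<le> (\<Sum>u\<in>V. m x u * \<delta>' u)"
        proof (cases "x = v")
          case True
          have "1 * 1 \<le> m v u * \<delta> u" using uv assms(3)[of u v] by (intro mult_mono) auto
          also have "\<dots> \<le> (\<Sum>u\<in>V. m v u * \<delta> u)"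
            using uv assms(1) by (intro member_le_sum) auto
          finally show ?thesis using s True v by (simp add: \<delta>'_def)
        next
          case False
          have "2 * \<delta> x \<le> (\<Sum>u\<in>V. m x u * \<delta> u)" using less.prems x by (auto simp: superadditive_def)
          then show ?thesis using s False by (simp add: \<delta>'_def)
        qed
      qed
      moreover have "{x \<in> V. \<delta>' x = 0} \<subset> {x \<in> V. \<delta> x = 0}"
        using v by (auto simp: \<delta>'_def split: if_splits)
      then have "card {x \<in> V. \<delta>' x = 0} < card {x \<in> V. \<delta> x = 0}"
        using assms(1) by (intro psubset_card_mono) auto
      moreover have "\<exists>v\<in>V. \<delta>' v > 0" using v by (intro bexI[of _ v]) (auto simp: \<delta>'_def)
      ultimately show ?thesis using less.hyps by blast
    qed (use less in blast)
  qed
  moreover obtain \<delta> where "superadditive m V \<delta>" "\<exists>v\<in>V. \<delta> v > 0"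
    using assms(4) by (auto simp: has_superadditive_def)
  ultimately show ?thesis using that by blast
qed

section \<open>Chains, spiders and explicit weights\<close>

definition chain_graph :: "('v \<Rightarrow> 'v \<Rightarrow> nat) \<Rightarrow> nat \<Rightarrow> (nat \<Rightarrow> 'v) \<Rightarrow> bool" where
  "chain_graph m n c \<longleftrightarrow> inj_on c {1..n} \<and>
     (\<forall>i\<in>{1..n}. \<forall>k\<in>{1..n}. m (c i) (c k) = (if k = i + 1 \<or> i = k + 1 then 1 else 0))"

definition leaf_at :: "('v \<Rightarrow> 'v \<Rightarrow> nat) \<Rightarrow> nat \<Rightarrow> (nat \<Rightarrow> 'v) \<Rightarrow> nat \<Rightarrow> 'v \<Rightarrow> bool" where
  "leaf_at m n c k b \<longleftrightarrow> b \<notin> c ` {1..n} \<and> (\<forall>i\<in>{1..n}. m b (c i) = (if i = k then 1 else 0))"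

lemma chain_sum:
  fixes f :: "nat \<Rightarrow> nat"
  assumes "i \<in> {1..n}"
  shows "(\<Sum>k\<in>{1..n}. (if k = i + 1 \<or> i = k + 1 then 1 else 0) * f k) =
    (if 1 < i then f (i - 1) else 0) + (if i < n then f (i + 1) else 0)"
proof -
  have "(\<Sum>k\<in>{1..n}. (if k = i + 1 \<or> i = k + 1 then 1 else 0) * f k) =
      (\<Sum>k\<in>{1..n}. (if k = i - 1 then f k else 0) + (if k = i + 1 then f k else 0))"
    by (intro sum.cong) auto
  also have "\<dots> = (if 1 < i then f (i - 1) else 0) + (if i < n then f (i + 1) else 0)"
    using assms by (simp add: sum.distrib) auto
  finally show ?thesis .
qed

text \<open>All explicit weights enter through this translation: on a chain with extra vertices
  \<open>X\<close>, superadditivity becomes inequalities between the numbers \<open>f i\<close> and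
  \<open>g x\<close>.\<close>

lemma chain_superadditive:
  fixes f :: "nat \<Rightarrow> nat"
  assumes chain: "chain_graph m n c" and sym: "\<And>u v. m u v = m v u"
    and X: "finite X" "X \<inter> c ` {1..n} = {}"
    and f: "\<And>i. 1 \<le> i \<Longrightarrow> i \<le> n \<Longrightarrow> 2 * f i \<le>
      (if 1 < i then f (i - 1) else 0) + (if i < n then f (i + 1) else 0) + (\<Sum>x\<in>X. m x (c i) * g x)"
    and g: "\<And>x. x \<in> X \<Longrightarrow> 2 * g x \<le> (\<Sum>i\<in>{1..n}. m x (c i) * f i) + (\<Sum>y\<in>X. m x y * g y)"
    and pos: "k \<in> {1..n}" "f k > 0"
  shows "has_superadditive m (c ` {1..n} \<union> X)"
proof -
  have inj: "inj_on c {1..n}" using chain by (simp add: chain_graph_def)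
  define \<delta> where "\<delta> = (\<lambda>u. if u \<in> X then g u else f (the_inv_into {1..n} c u))"
  have \<delta>c: "\<delta> (c i) = f i" if "i \<in> {1..n}" for i
    using that X inj by (auto simp: \<delta>_def the_inv_into_f_f)
  have \<delta>X: "\<delta> x = g x" if "x \<in> X" for x using that by (simp add: \<delta>_def)
  have sum: "(\<Sum>u\<in>c ` {1..n} \<union> X. m v u * \<delta> u) =
      (\<Sum>i\<in>{1..n}. m v (c i) * f i) + (\<Sum>x\<in>X. m v x * g x)" for v
  proof -
    have "(\<Sum>u\<in>c ` {1..n}. m v u * \<delta> u) = (\<Sum>i\<in>{1..n}. m v (c i) * f i)"
      unfolding sum.reindex[OF inj] by (intro sum.cong refl) (simp only: o_def \<delta>c)
    moreover have "(\<Sum>x\<in>X. m v x * \<delta> x) = (\<Sum>x\<in>X. m v x * g x)"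
      by (intro sum.cong refl) (simp only: \<delta>X)
    ultimately show ?thesis using X by (subst sum.union_disjoint) auto
  qed
  have "superadditive m (c ` {1..n} \<union> X) \<delta>"
    unfolding superadditive_def sum
  proof
    fix v assume "v \<in> c ` {1..n} \<union> X"
    then consider i where "i \<in> {1..n}" "v = c i" | "v \<in> X" by auto
    then show "2 * \<delta> v \<le> (\<Sum>i\<in>{1..n}. m v (c i) * f i) + (\<Sum>x\<in>X. m v x * g x)"
    proof cases
      case 1
      have "(\<Sum>k\<in>{1..n}. m v (c k) * f k) =
          (\<Sum>k\<in>{1..n}. (if k = i + 1 \<or> i = k + 1 then 1 else 0) * f k)"
        using 1 chain by (intro sum.cong) (auto simp: chain_graph_def)
      also have "\<dots> = (if 1 < i then f (i - 1) else 0) + (if i < n then f (i + 1) else 0)"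
        by (rule chain_sum[OF 1(1)])
      finally show ?thesis using f[of i] 1 sym[of v] by (simp add: \<delta>c)
    next
      case 2
      then show ?thesis using g by (simp add: \<delta>X)
    qed
  qed
  moreover have "\<delta> (c k) > 0" using pos \<delta>c by simp
  ultimately show ?thesis unfolding has_superadditive_def using pos by blast
qed

lemma sum_leaf:
  fixes f :: "nat \<Rightarrow> nat"
  assumes "leaf_at m n c k b" "k \<in> {1..n}"
  shows "(\<Sum>i\<in>{1..n}. m b (c i) * f i) = f k"
proof -
  have "(\<Sum>i\<in>{1..n}. m b (c i) * f i) = (\<Sum>i\<in>{1..n}. if i = k then f i else 0)"
    using assms by (intro sum.cong) (auto simp: leaf_at_def)
  then show ?thesis using assms(2) by simp
qed

lemma one_leaf_superadditive:
  fixes f :: "nat \<Rightarrow> nat"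
  assumes "chain_graph m n c" "\<And>u v. m u v = m v u" "leaf_at m n c k b" "k \<in> {1..n}"
    and f: "\<And>i. 1 \<le> i \<Longrightarrow> i \<le> n \<Longrightarrow> 2 * f i \<le>
      (if 1 < i then f (i - 1) else 0) + (if i < n then f (i + 1) else 0) + (if i = k then \<beta> else 0)"
    and "2 * \<beta> \<le> f k" "f k > 0"
  shows "has_superadditive m (insert b (c ` {1..n}))"
proof -
  have "has_superadditive m (c ` {1..n} \<union> {b})"
  proof (rule chain_superadditive[OF assms(1,2), where f = f and g = "\<lambda>_. \<beta>" and k = k])
    fix i assume "1 \<le> i" "i \<le> n"
    then show "2 * f i \<le> (if 1 < i then f (i - 1) else 0) + (if i < n then f (i + 1) else 0) +
        (\<Sum>x\<in>{b}. m x (c i) * \<beta>)"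
      using f[of i] assms(3) by (auto simp: leaf_at_def)
  next
    fix x assume "x \<in> {b}"
    then show "2 * \<beta> \<le> (\<Sum>i\<in>{1..n}. m x (c i) * f i) + (\<Sum>y\<in>{b}. m x y * \<beta>)"
      using sum_leaf[OF assms(3,4), of f] assms(6) by simp
  qed (use assms in \<open>auto simp: leaf_at_def\<close>)
  then show ?thesis by simp
qed

lemma chain_graph_rev:
  assumes "chain_graph m n c"
  shows "chain_graph m n (\<lambda>i. c (n + 1 - i))"
  unfolding chain_graph_def
proof (intro conjI ballI)
  show "inj_on (\<lambda>i. c (n + 1 - i)) {1..n}"
  proof (rule inj_onI)
    fix x y assume xy: "x \<in> {1..n}" "y \<in> {1..n}" "c (n + 1 - x) = c (n + 1 - y)"
    then have "n + 1 - x = n + 1 - y"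
      using assms by (intro inj_onD[of c "{1..n}"]) (auto simp: chain_graph_def)
    then show "x = y" using xy by auto
  qed
  fix i k assume ik: "i \<in> {1..n}" "k \<in> {1..n}"
  then have "n + 1 - i \<in> {1..n}" "n + 1 - k \<in> {1..n}" by auto
  then have "m (c (n + 1 - i)) (c (n + 1 - k)) =
      (if n + 1 - k = n + 1 - i + 1 \<or> n + 1 - i = n + 1 - k + 1 then 1 else 0)"
    using assms unfolding chain_graph_def by blast
  also have "(n + 1 - k = n + 1 - i + 1 \<or> n + 1 - i = n + 1 - k + 1) \<longleftrightarrow> k = i + 1 \<or> i = k + 1"
    using ik unfolding atLeastAtMost_iff by presburger
  finally show "m (c (n + 1 - i)) (c (n + 1 - k)) = (if k = i + 1 \<or> i = k + 1 then 1 else 0)" .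
qed

lemma image_rev: "(\<lambda>i. c (n + 1 - i)) ` {1..n} = c ` {1..n :: nat}"
proof -
  have "x \<in> (\<lambda>i. n + 1 - i) ` {1..n}" if "x \<in> {1..n}" for x
    using that by (intro image_eqI[of _ _ "n + 1 - x"]) auto
  then have "(\<lambda>i. n + 1 - i) ` {1..n} = {1..n}" by auto
  then show ?thesis by (metis image_image)
qed

lemma leaf_at_rev:
  assumes "leaf_at m n c k b" "k \<in> {1..n}"
  shows "leaf_at m n (\<lambda>i. c (n + 1 - i)) (n + 1 - k) b"
  using assms unfolding leaf_at_def image_rev by (auto simp: Suc_diff_le; arith)

lemma chain_graph_snoc:
  assumes "chain_graph m n c" "leaf_at m n c n v" "m v v = 0" "\<And>u v. m u v = m v u"
  shows "chain_graph m (n + 1) (c(n + 1 := v))"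
proof -
  have "{1..n + 1} = insert (n + 1) {1..n}" by auto
  moreover have "inj_on (c(n + 1 := v)) {1..n}"
    using assms(1) by (subst inj_on_cong[of _ _ c]) (auto simp: chain_graph_def)
  then have "inj_on (c(n + 1 := v)) (insert (n + 1) {1..n})"
    using assms(2) by (auto simp: leaf_at_def)
  moreover have "m ((c(n + 1 := v)) i) ((c(n + 1 := v)) k) = (if k = i + 1 \<or> i = k + 1 then 1 else 0)"
    if ik: "i \<in> {1..n + 1}" "k \<in> {1..n + 1}" for i k
  proof -
    have vc: "m v (c x) = (if x = n then 1 else 0)" if "x \<in> {1..n}" for x
      using assms(2) that by (simp add: leaf_at_def)
    have cc: "m (c x) (c y) = (if y = x + 1 \<or> x = y + 1 then 1 else 0)" if "x \<in> {1..n}" "y \<in> {1..n}" for x y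
      using assms(1) that by (simp add: chain_graph_def)
    consider "i = n + 1" "k = n + 1" | "i = n + 1" "k \<in> {1..n}" | "i \<in> {1..n}" "k = n + 1" |
      "i \<in> {1..n}" "k \<in> {1..n}" using ik by force
    then show ?thesis
    proof cases
      case 2
      then show ?thesis using vc[of k] by auto
    next
      case 3
      then show ?thesis using vc[of i] assms(4)[of "c i" v] by auto
    next
      case 4
      then show ?thesis using cc[of i k] by auto
    qed (use assms(3) in auto)
  qed
  ultimately show ?thesis unfolding chain_graph_def by metis
qed

lemma image_snoc: "(c(n + 1 := v)) ` {1..n + 1} = insert v (c ` {1..n :: nat})"
proof -
  have "{1..n + 1} = insert (n + 1) {1..n}" by auto
  then show ?thesis by auto
qed

lemma leaf_at_snoc:
  assumes "leaf_at m n c k b" "k \<in> {1..n}" "m b v = 0" "b \<noteq> v"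
  shows "leaf_at m (n + 1) (c(n + 1 := v)) k b"
proof -
  have "{1..n + 1} = insert (n + 1) {1..n}" by auto
  then show ?thesis using assms by (auto simp: leaf_at_def)
qed

text \<open>A spider is the star T(2, k, n + 1 - k), arms counted with the branch vertex; the bounds
  on \<open>k\<close> make it branch. A star with at least two further vertices on each of three
  arms contains extended E6 and so carries a weight.\<close>

definition chain_or_spider :: "('v \<Rightarrow> 'v \<Rightarrow> nat) \<Rightarrow> 'v set \<Rightarrow> bool" where
  "chain_or_spider m V \<longleftrightarrow> (\<exists>n\<ge>1. \<exists>c. chain_graph m n c \<and> V = c ` {1..n}) \<or>
     (\<exists>n c k b. chain_graph m n c \<and> leaf_at m n c k b \<and> 2 \<le> k \<and> k < n \<and> V = insert b (c ` {1..n}))"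

text \<open>The adjacency of \<open>v\<close> is left open to cover both ways of enlarging a spider:
  \<open>v\<close> attached to the chain, or to the short arm \<open>b\<close>.\<close>

lemma two_leaves_superadditive:
  fixes f :: "nat \<Rightarrow> nat"
  assumes "chain_graph m n c" "\<And>u v. m u v = m v u" "leaf_at m n c k b" "k \<in> {1..n}"
    and v: "v \<notin> c ` {1..n}" "v \<noteq> b"
    and f: "\<And>i. 1 \<le> i \<Longrightarrow> i \<le> n \<Longrightarrow> 2 * f i \<le>
      (if 1 < i then f (i - 1) else 0) + (if i < n then f (i + 1) else 0) + (if i = k then \<beta> else 0) +
      m v (c i) * \<gamma>"
    and "2 * \<beta> \<le> f k + m b v * \<gamma>" "2 * \<gamma> \<le> (\<Sum>i\<in>{1..n}. m v (c i) * f i) + m v b * \<beta>" "f k > 0"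
  shows "has_superadditive m (insert v (insert b (c ` {1..n})))"
proof -
  let ?g = "\<lambda>x. if x = b then \<beta> else \<gamma>"
  have "has_superadditive m (c ` {1..n} \<union> {b, v})"
  proof (rule chain_superadditive[OF assms(1,2), where f = f and g = ?g and k = k])
    fix i assume "1 \<le> i" "i \<le> n"
    then show "2 * f i \<le> (if 1 < i then f (i - 1) else 0) + (if i < n then f (i + 1) else 0) +
        (\<Sum>x\<in>{b, v}. m x (c i) * ?g x)"
      using f[of i] assms(3) v by (auto simp: leaf_at_def)
  next
    fix x assume "x \<in> {b, v}"
    then show "2 * ?g x \<le> (\<Sum>i\<in>{1..n}. m x (c i) * f i) + (\<Sum>y\<in>{b, v}. m x y * ?g y)"
      using sum_leaf[OF assms(3,4), of f] assms(8,9) v by auto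
  qed (use assms in \<open>auto simp: leaf_at_def\<close>)
  then show ?thesis by (simp add: insert_commute)
qed

lemma extend_chain:
  assumes chain: "chain_graph m n c" "n \<ge> 1" and sym: "\<And>u v. m u v = m v u"
    and leaf: "leaf_at m n c l v" "l \<in> {1..n}" "m v v = 0"
  shows "chain_or_spider m (insert v (c ` {1..n}))"
proof -
  consider "l = n" | "l = 1" | "2 \<le> l" "l < n" using leaf(2) by fastforce
  then show ?thesis
  proof cases
    case 1
    have "chain_graph m (n + 1) (c(n + 1 := v))"
      using chain_graph_snoc[of m n c v] chain leaf sym 1 by blast
    then show ?thesis
      unfolding chain_or_spider_def image_snoc[symmetric] using le_add2 by blast
  next
    case 2
    let ?d = "\<lambda>i. c (n + 1 - i)"
    have "leaf_at m n ?d n v" using leaf_at_rev[OF leaf(1,2)] 2 by simp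
    then have "chain_graph m (n + 1) (?d(n + 1 := v))"
      by (rule chain_graph_snoc[OF chain_graph_rev[OF chain(1)] _ leaf(3) sym])
    moreover have "insert v (c ` {1..n}) = (?d(n + 1 := v)) ` {1..n + 1}"
      unfolding image_snoc image_rev ..
    ultimately show ?thesis
      unfolding chain_or_spider_def using le_add2 by blast
  next
    case 3
    then show ?thesis unfolding chain_or_spider_def using chain leaf by blast
  qed
qed

lemma extend_spider_end:
  assumes chain: "chain_graph m n c" and sym: "\<And>u v. m u v = m v u"
    and b: "leaf_at m n c k b" "2 \<le> k" "k < n"
    and leaf: "leaf_at m n c n v" "m v v = 0" "m v b = 0" "v \<noteq> b"
  shows "chain_or_spider m (insert v (insert b (c ` {1..n})))"
proof -
  have "chain_graph m (n + 1) (c(n + 1 := v))"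
    using chain_graph_snoc[OF chain leaf(1,2)] sym by blast
  moreover have "leaf_at m (n + 1) (c(n + 1 := v)) k b"
    using b leaf sym[of b v] by (intro leaf_at_snoc) auto
  moreover have "insert v (insert b (c ` {1..n})) = insert b ((c(n + 1 := v)) ` {1..n + 1})"
    unfolding image_snoc by auto
  ultimately show ?thesis
    unfolding chain_or_spider_def using b
    by (intro disjI2 exI[of _ "n + 1"] exI[of _ "c(n + 1 := v)"] exI[of _ k] exI[of _ b]) auto
qed

text \<open>When the leaf is attached to the short arm \<open>b\<close> and \<open>b\<close> sits next to the end of the chain, the
  new chain runs through \<open>b\<close> and the end of the old chain becomes the short arm.\<close>

lemma extend_spider_arm:
  assumes chain: "chain_graph m (n + 1) c" and sym: "\<And>u v. m u v = m v u" and irr: "\<And>v. m v v = 0"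
    and b: "leaf_at m (n + 1) c n b" "2 \<le> n"
    and v: "v \<notin> c ` {1..n + 1}" "v \<noteq> b" "m v b = 1" "\<And>i. i \<in> {1..n + 1} \<Longrightarrow> m v (c i) = 0"
  shows "chain_or_spider m (insert v (insert b (c ` {1..n + 1})))"
proof -
  let ?d = "c(n + 1 := b)"
  let ?e = "?d(n + 1 + 1 := v)"
  have sub: "{1..n} \<subseteq> {1..n + 1}" by auto
  have inj: "inj_on c {1..n + 1}" using chain by (simp add: chain_graph_def)
  have cn: "chain_graph m n c" "leaf_at m n c n b"
    using chain b(1) sub inj_on_subset[OF inj sub] by (auto simp: chain_graph_def leaf_at_def)
  have cl: "leaf_at m n c n (c (n + 1))"
    unfolding leaf_at_def
  proof (intro conjI ballI)
    show "c (n + 1) \<notin> c ` {1..n}" using inj sub by (subst inj_on_image_mem_iff[OF inj]) auto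
    show "m (c (n + 1)) (c i) = (if i = n then 1 else 0)" if "i \<in> {1..n}" for i
      using chain that by (simp add: chain_graph_def)
  qed
  have cb: "c (n + 1) \<noteq> b" "m b (c (n + 1)) = 0" using b(1) by (auto simp: leaf_at_def)
  have cv: "c (n + 1) \<noteq> v" "m v (c (n + 1)) = 0" using v by auto
  have d: "chain_graph m (n + 1) ?d" by (rule chain_graph_snoc[OF cn irr sym])
  have "leaf_at m (n + 1) ?d (n + 1) v"
    using v sub unfolding leaf_at_def image_snoc by auto
  then have "chain_graph m (n + 1 + 1) ?e" by (rule chain_graph_snoc[OF d _ irr sym])
  moreover have "leaf_at m (n + 1) ?d n (c (n + 1))"
    by (rule leaf_at_snoc[OF cl]) (use cb b(2) sym[of b] in auto)
  then have "leaf_at m (n + 1 + 1) ?e n (c (n + 1))"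
    by (rule leaf_at_snoc) (use cv b(2) sym[of v] in auto)
  moreover have "insert v (insert b (c ` {1..n + 1})) = insert (c (n + 1)) (?e ` {1..n + 1 + 1})"
    unfolding image_snoc by (simp add: atLeastAtMostSuc_conv insert_commute)
  ultimately show ?thesis
    unfolding chain_or_spider_def using b(2)
    by (intro disjI2 exI[of _ "n + 1 + 1"] exI[of _ ?e] exI[of _ n] exI[of _ "c (n + 1)"]) auto
qed

text \<open>The weights \<open>f\<close> exclude the subdiagrams of extended types \<open>D\<close> (two branch points, or one of
  valency four) and \<open>E\<^sub>6\<close>.\<close>

lemma extend_spider:
  assumes chain: "chain_graph m n c" and sym: "\<And>u v. m u v = m v u" and irr: "\<And>v. m v v = 0"
    and b: "leaf_at m n c k b" "2 \<le> k" "k < n"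
    and v: "v \<notin> insert b (c ` {1..n})" "w \<in> insert b (c ` {1..n})"
      "\<And>u. u \<in> insert b (c ` {1..n}) \<Longrightarrow> m v u = (if u = w then 1 else 0)"
    and fin: "\<not> has_superadditive m (insert v (insert b (c ` {1..n})))"
  shows "chain_or_spider m (insert v (insert b (c ` {1..n})))"
proof -
  have inj: "inj_on c {1..n}" using chain by (simp add: chain_graph_def)
  let ?d = "\<lambda>i. c (n + 1 - i)"
  have k: "k \<in> {1..n}" using b by auto
  have bc: "b \<notin> c ` {1..n}" using b by (simp add: leaf_at_def)
  have rev: "leaf_at m n ?d (n + 1 - k) b" "chain_graph m n ?d" "?d ` {1..n} = c ` {1..n}"
    by (rule leaf_at_rev[OF b(1) k] chain_graph_rev[OF chain] image_rev)+
  show ?thesis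
  proof (cases "w = b")
    case False
    then obtain l where l: "l \<in> {1..n}" "w = c l" using v(2) by auto
    have lv: "leaf_at m n c l v"
      unfolding leaf_at_def
    proof (intro conjI ballI)
      show "m v (c i) = (if i = l then 1 else 0)" if "i \<in> {1..n}" for i
        using v(3)[of "c i"] l that inj_on_eq_iff[OF inj that l(1)] by simp
    qed (use v(1) in blast)
    have vb: "m v b = 0" "m b v = 0" "v \<noteq> b" using v False sym[of v b] by auto
    consider "l = n" | "l = 1" | "2 \<le> l" "l < n" using l by fastforce
    then show ?thesis
    proof cases
      case 1
      then show ?thesis using extend_spider_end[OF chain sym b] lv irr vb by blast
    next
      case 2
      have "leaf_at m n ?d n v" using leaf_at_rev[OF lv l(1)] 2 by simp
      then show ?thesis
        using extend_spider_end[OF rev(2) sym rev(1), of v] irr vb b unfolding rev(3) by auto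
    next
      case 3
      define p q where "p = min k l" and "q = max k l"
      have pq: "2 \<le> p" "p \<le> q" "q < n" "k = p \<and> l = q \<or> k = q \<and> l = p"
        using b 3 by (auto simp: p_def q_def)
      \<comment> \<open>The minimal imaginary root of extended type D: 2 from \<open>p\<close> to
        \<open>q\<close>, and 1 on the chain vertices just outside and on \<open>b\<close> and
        \<open>v\<close>. For \<open>p = q\<close> it is the star with four leaves.\<close>
      define f :: "nat \<Rightarrow> nat" where
        "f i = (if p \<le> i \<and> i \<le> q then 2 else if i + 1 = p \<or> i = q + 1 then 1 else 0)" for i
      have mvc: "m v (c i) = (if i = l then 1 else 0)" if "i \<in> {1..n}" for i
        using lv that by (auto simp: leaf_at_def)
      have "has_superadditive m (insert v (insert b (c ` {1..n})))"
      proof (rule two_leaves_superadditive[OF chain sym b(1) k, where f = f and \<beta> = 1 and \<gamma> = 1])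
        fix i assume i: "1 \<le> i" "i \<le> n"
        have mi: "m v (c i) = (if i = l then 1 else 0)" using i mvc by auto
        show "2 * f i \<le> (if 1 < i then f (i - 1) else 0) + (if i < n then f (i + 1) else 0) +
            (if i = k then 1 else 0) + m v (c i) * 1"
        proof -
          have "(if i = k then 1 else 0 :: nat) + (if i = l then 1 else 0) =
              (if i = p then 1 else 0) + (if i = q then 1 else 0)" using pq(4) by auto
          moreover consider "p \<le> i" "i \<le> q" | "i + 1 = p" | "i = q + 1" | "i + 1 < p \<or> q + 1 < i"
            by linarith
          then have "2 * f i \<le> (if 1 < i then f (i - 1) else 0) + (if i < n then f (i + 1) else 0) +
              ((if i = p then 1 else 0) + (if i = q then 1 else 0))"
          proof cases
            case 1
            have "f (i - 1) = (if i = p then 1 else 2)" "f (i + 1) = (if i = q then 1 else 2)"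
              using 1 pq by (auto simp: f_def)
            then show ?thesis using 1 pq by (simp add: f_def)
          next
            case 2
            have "f (i + 1) = 2" using 2 pq by (simp add: f_def)
            then show ?thesis using 2 pq by (simp add: f_def)
          next
            case 3
            have "f (i - 1) = 2" using 3 pq by (simp add: f_def)
            then show ?thesis using 3 pq by (simp add: f_def)
          next
            case 4
            then have "f i = 0" using pq by (auto simp: f_def)
            then show ?thesis by simp
          qed
          ultimately show ?thesis unfolding mi by simp
        qed
      next
        show "2 * 1 \<le> (\<Sum>i\<in>{1..n}. m v (c i) * f i) + m v b * 1"
          unfolding sum_leaf[OF lv l(1)] using pq by (auto simp: f_def)
      qed (use v vb pq in \<open>auto simp: f_def\<close>)
      then show ?thesis using fin by blast
    qed
  next
    case True
    have mv: "m v b = 1" "m b v = 1" "m v (c i) = 0" if "i \<in> {1..n}" for i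
      using v True bc that sym[of v b] by auto
    have mv': "m v b = 1" "m b v = 1" using mv(1,2)[OF k] by auto
    \<comment> \<open>Stated for any numbering \<open>d\<close>, to be applied to the chain and to
      its reversal.\<close>
    have arm: "chain_or_spider m (insert v (insert b (c ` {1..n})))"
      if "chain_graph m n d" "leaf_at m n d (n - 1) b" "d ` {1..n} = c ` {1..n}"
        "\<And>i. i \<in> {1..n} \<Longrightarrow> m v (d i) = 0" for d
    proof -
      have n: "n - 1 + 1 = n" "2 \<le> n - 1" using b by auto
      have "chain_or_spider m (insert v (insert b (d ` {1..n - 1 + 1})))"
        by (rule extend_spider_arm[OF _ sym irr], unfold n(1))
          (use that n(2) v(1) mv' in auto)
      then show ?thesis unfolding n(1) that(3) .
    qed
    consider "k = n - 1" | "k = 2" | "3 \<le> k" "k + 2 \<le> n" using b by linarith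
    then show ?thesis
    proof cases
      case 1
      show ?thesis
        by (rule arm[of c]) (use chain b(1) 1 mv in auto)
    next
      case 2
      have "n + 1 - k = n - 1" using 2 b by auto
      then have "leaf_at m n ?d (n - 1) b" using rev(1) by simp
      moreover have "m v (?d i) = 0" if "i \<in> {1..n}" for i
        by (rule mv(3)) (use that in auto)
      ultimately show ?thesis by (intro arm[of ?d] rev(2,3))
    next
      case 3
      \<comment> \<open>Extended E6: 3 minus the distance to the branch vertex, so the arms read 2,
        1, and likewise on \<open>b\<close> and \<open>v\<close>. Truncated subtraction supplies the
        zeros further out.\<close>
      define f :: "nat \<Rightarrow> nat" where "f i = 3 - (if i \<le> k then k - i else i - k)" for i
      have "has_superadditive m (insert v (insert b (c ` {1..n})))"
      proof (rule two_leaves_superadditive[OF chain sym b(1) k, where f = f and \<beta> = 2 and \<gamma> = 1])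
        fix i assume i: "1 \<le> i" "i \<le> n"
        show "2 * f i \<le> (if 1 < i then f (i - 1) else 0) + (if i < n then f (i + 1) else 0) +
            (if i = k then 2 else 0) + m v (c i) * 1"
          unfolding f_def using i b 3 by auto
      qed (use v mv mv' b 3 in \<open>auto simp: f_def\<close>)
      then show ?thesis using fin by blast
    qed
  qed
qed

text \<open>If all valencies, counted with multiplicity, were at least two, the constant weight 1
  would be superadditive; this disposes of cycles. So some vertex has valency at most one. Removing
  it preserves connectedness and the absence of weights, and the extension lemmas put it
  back.\<close>

lemma chain_or_spider_if_no_superadditive:
  assumes "finite V" "V \<noteq> {}" "mult_connected m V" "\<not> has_superadditive m V"
    and sym: "\<And>u v. m u v = m v u" and irr: "\<And>v. m v v = 0"
  shows "chain_or_spider m V"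
  using assms(1-4)
proof (induction "card V" arbitrary: V rule: less_induct)
  case less
  have "\<exists>v\<in>V. (\<Sum>u\<in>V. m v u) < 2"
  proof (rule ccontr)
    assume "\<not> ?thesis"
    then have "superadditive m V (\<lambda>_. 1)" by (auto simp: superadditive_def)
    then show False using less.prems unfolding has_superadditive_def by (metis all_not_in_conv zero_less_one)
  qed
  then obtain v where v: "v \<in> V" "(\<Sum>u\<in>V. m v u) \<le> 1" by auto
  show ?case
  proof (cases "V = {v}")
    case True
    have "chain_graph m 1 (\<lambda>_. v)" by (auto simp: chain_graph_def irr)
    moreover have "V = (\<lambda>_. v) ` {1..1::nat}" using True by auto
    ultimately show ?thesis unfolding chain_or_spider_def by blast
  next
    case False
    define W where "W = V - {v}"
    have W: "W \<subseteq> V" "W \<noteq> {}" "finite W" "V = insert v W" "v \<notin> W" using False v less.prems by (auto simp: W_def)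
    have "\<exists>u\<in>{v}. \<exists>w\<in>V - {v}. m u w > 0"
      using less.prems(3) v False unfolding mult_connected_def by auto
    then obtain w where w: "w \<in> W" "m v w > 0" by (auto simp: W_def)
    have mv: "m v u = (if u = w then 1 else 0)" if "u \<in> W" for u
    proof (cases "u = w")
      case True
      have "m v w \<le> (\<Sum>u\<in>V. m v u)" using w W less.prems by (intro member_le_sum) auto
      then show ?thesis using True w v by auto
    next
      case False
      have "(\<Sum>u\<in>{u, w}. m v u) \<le> (\<Sum>u\<in>V. m v u)" using w W that less.prems by (intro sum_mono2) auto
      then show ?thesis using False w v by auto
    qed
    have conn: "mult_connected m W"
      unfolding mult_connected_def
    proof (intro allI impI)
      fix S assume S: "S \<subseteq> W" "S \<noteq> {}" "S \<noteq> W"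
      \<comment> \<open>\<open>v\<close> joins the side of its only neighbour \<open>w\<close>, so
        the edge across the cut of \<open>V\<close> does not involve \<open>v\<close>.\<close>
      define T where "T = (if w \<in> S then insert v S else S)"
      have "T \<subseteq> V" "T \<noteq> {}" "T \<noteq> V" using S W by (auto simp: T_def)
      then obtain x y where xy: "x \<in> T" "y \<in> V - T" "m x y > 0"
        using less.prems(3) unfolding mult_connected_def by meson
      have "x \<noteq> v" using xy mv[of y] W(4,5) S by (auto simp: T_def split: if_splits)
      moreover have "y \<noteq> v" using xy mv[of x] sym[of x y] S by (auto simp: T_def split: if_splits)
      ultimately show "\<exists>x\<in>S. \<exists>y\<in>W - S. m x y > 0"
        using xy W(4) by (intro bexI[of _ x] bexI[of _ y]) (auto simp: T_def split: if_splits)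
    qed
    have nW: "\<not> has_superadditive m W"
      using has_superadditive_mono less.prems W(1) by blast
    have "card W < card V" using W by simp
    then have "chain_or_spider m W" using less.hyps W conn nW by blast
    then consider n c where "n \<ge> 1" "chain_graph m n c" "W = c ` {1..n}" |
      n c k b where "chain_graph m n c" "leaf_at m n c k b" "2 \<le> k" "k < n" "W = insert b (c ` {1..n})"
      unfolding chain_or_spider_def by blast
    then show ?thesis
    proof cases
      case 1
      then obtain l where l: "l \<in> {1..n}" "w = c l" using w by auto
      have inj: "inj_on c {1..n}" using 1 by (simp add: chain_graph_def)
      have "leaf_at m n c l v"
        unfolding leaf_at_def using W 1(3) mv l inj_onD[OF inj] by (metis imageI)
      then show ?thesis
        using extend_chain[OF 1(2,1) sym _ l(1) irr] W(4) 1(3) by blast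
    next
      case 2
      have "chain_or_spider m (insert v (insert b (c ` {1..n})))"
        by (rule extend_spider[OF 2(1) sym irr 2(2-4)]) (use W 2(5) w mv less.prems in auto)
      then show ?thesis using W(4) 2(5) by simp
    qed
  qed
qed

text \<open>The weights below are the minimal imaginary roots of the extended Dynkin diagrams of types
  \<open>E\<^sub>7\<close> and \<open>E\<^sub>8\<close>.\<close>

lemma spider_bounds:
  assumes chain: "chain_graph m n c" and sym: "\<And>u v. m u v = m v u"
    and b: "leaf_at m n c k b" "2 \<le> k" "k < n"
    and fin: "\<not> has_superadditive m (insert b (c ` {1..n}))"
  shows "k = 2 \<or> k = n - 1 \<or> (k = 3 \<or> k = n - 2) \<and> n \<in> {5, 6, 7}"
proof -
  have k: "k \<in> {1..n}" using b by auto
  have no_E7: False if "4 \<le> k" "k + 3 \<le> n"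
  proof -
    \<comment> \<open>Extended E7: 4 at the branch vertex, then 3, 2, 1 on either side, and 2 on
      \<open>b\<close>.\<close>
    define f :: "nat \<Rightarrow> nat" where "f i = 4 - (if i \<le> k then k - i else i - k)" for i
    have "has_superadditive m (insert b (c ` {1..n}))"
      by (rule one_leaf_superadditive[OF chain sym b(1) k, where f = f and \<beta> = 2])
        (use that in \<open>auto simp: f_def\<close>)
    then show False using fin by blast
  qed
  have no_E8: False if "chain_graph m n d" "leaf_at m n d 3 b" "8 \<le> n" "d ` {1..n} = c ` {1..n}" for d
  proof -
    \<comment> \<open>Extended E8: 6 at the vertex 3, with 4, 2 on the short side, 5 down to 1 at
      the vertex 8 on the long side, and 3 on \<open>b\<close>. Hence the threshold 8.\<close>
    define f :: "nat \<Rightarrow> nat" where "f i = (if i \<le> 3 then 2 * i else 9 - i)" for i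
    have "3 \<in> {1..n}" using that by auto
    then have "has_superadditive m (insert b (d ` {1..n}))"
      by (rule one_leaf_superadditive[OF that(1) sym that(2), where f = f and \<beta> = 3])
        (use that(3) in \<open>auto simp: f_def\<close>)
    then show False using fin that(4) by simp
  qed
  have "k = 3 \<longrightarrow> n < 8" using no_E8[of c] chain b(1) by force
  moreover have "k = n - 2 \<and> 3 \<le> k \<longrightarrow> n < 8"
  proof (rule ccontr)
    assume "\<not> ?thesis"
    then have n: "\<not> n < 8" "k = n - 2" by auto
    then have "n + 1 - k = 3" using b by auto
    then show False
      using n no_E8[of "\<lambda>i. c (n + 1 - i)"] chain_graph_rev[OF chain] leaf_at_rev[OF b(1) k] image_rev
      by (metis not_less)
  qed
  moreover have "\<not> (4 \<le> k \<and> k + 3 \<le> n)" using no_E7 by blast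
  ultimately show ?thesis using b(2,3) unfolding insert_iff empty_iff by presburger
qed

section \<open>From adjacency multiplicities to Dynkin quivers\<close>

definition arrow_mult :: "('v, 'a) pre_digraph \<Rightarrow> 'v \<Rightarrow> 'v \<Rightarrow> nat" where
  "arrow_mult Q u v = card {b \<in> arcs (double_quiver Q).
     tail (double_quiver Q) b = u \<and> head (double_quiver Q) b = v}"

lemma arrow_mult_eq:
  assumes "fin_digraph Q"
  shows "arrow_mult Q u v = card {a \<in> arcs Q. tail Q a = u \<and> head Q a = v} +
    card {a \<in> arcs Q. head Q a = u \<and> tail Q a = v}" (is "_ = card ?A + card ?B")
proof -
  interpret fin_digraph Q by fact
  have "{b \<in> arcs (double_quiver Q). tail (double_quiver Q) b = u \<and> head (double_quiver Q) b = v} =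
      ?A <+> ?B"
    by (auto simp: double_quiver_def)
  then show ?thesis
    unfolding arrow_mult_def by (simp add: card_Plus)
qed

lemma arrow_mult_sym:
  assumes "fin_digraph Q" shows "arrow_mult Q u v = arrow_mult Q v u"
proof -
  have "{a \<in> arcs Q. tail Q a = u \<and> head Q a = v} = {a \<in> arcs Q. head Q a = v \<and> tail Q a = u}" for u v
    by auto
  then show ?thesis unfolding arrow_mult_eq[OF assms] by simp
qed

lemma arrow_mult_irrefl:
  assumes "fin_digraph Q" "acyclic_quiver Q" shows "arrow_mult Q v v = 0"
proof -
  interpret fin_digraph Q by fact
  have "tail Q a \<noteq> head Q a" if "a \<in> arcs Q" for a
  proof
    assume "tail Q a = head Q a"
    then have "cycle [a]"
      using that unfolding cycle_def by (intro exI[of _ "tail Q a"]) (auto simp: awalk_def)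
    then show False using assms(2) by (auto simp: acyclic_quiver_def)
  qed
  then have "{a \<in> arcs Q. tail Q a = v \<and> head Q a = v} = {}" "{a \<in> arcs Q. head Q a = v \<and> tail Q a = v} = {}"
    by (auto simp: eq_commute[of "head Q _"])
  then show ?thesis unfolding arrow_mult_eq[OF assms(1)] by simp
qed

text \<open>A vertex set that no edge leaves is closed under arrows in both directions, hence under
  reachability in the symmetrised digraph.\<close>

lemma mult_connected_quiver:
  assumes "fin_digraph Q" "Digraph_Component.connected Q"
  shows "mult_connected (arrow_mult Q) (verts Q)"
  unfolding mult_connected_def
proof (intro allI impI, rule ccontr)
  interpret fin_digraph Q by fact
  fix S assume S: "S \<subseteq> verts Q" "S \<noteq> {}" "S \<noteq> verts Q"
    and no: "\<not> (\<exists>u\<in>S. \<exists>v\<in>verts Q - S. arrow_mult Q u v > 0)"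
  have closed: "head Q a \<in> S \<longleftrightarrow> tail Q a \<in> S" if a: "a \<in> arcs Q" for a
  proof -
    have "a \<in> {b \<in> arcs Q. tail Q b = tail Q a \<and> head Q b = head Q a}" using a by simp
    then have "card {b \<in> arcs Q. tail Q b = tail Q a \<and> head Q b = head Q a} > 0"
      by (subst card_gt_0_iff) auto
    then have "arrow_mult Q (tail Q a) (head Q a) > 0" unfolding arrow_mult_eq[OF assms(1)] by simp
    moreover from this have "arrow_mult Q (head Q a) (tail Q a) > 0"
      using arrow_mult_sym[OF assms(1)] by metis
    ultimately show ?thesis using no a by (meson DiffI head_in_verts tail_in_verts)
  qed
  obtain u v where uv: "u \<in> S" "v \<in> verts Q" "v \<notin> S" using S by blast
  then have "u \<rightarrow>\<^sup>*\<^bsub>mk_symmetric Q\<^esub> v"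
    using assms(2) S unfolding connected_def strongly_connected_def by auto
  then have "v \<in> S"
    unfolding reachable_def
  proof (induction rule: rtrancl_on_induct)
    case (step y z)
    then show ?case using closed by (auto simp: parcs_mk_symmetric)
  qed (use uv in auto)
  then show False using uv by blast
qed

text \<open>\<open>arrow_mult\<close> counts both orientations, so the value 1 means a single arrow
  in one of the two directions. The bound 1 gives injectivity on arrows, and its being nonzero gives
  surjectivity. The vertex bijection asked for is the inverse of \<open>d\<close>.\<close>

lemma underlying_graph_isoI:
  assumes fin: "fin_digraph Q" and d: "bij_betw d {1..N} (verts Q)"
    and E: "\<And>e. e \<in> E \<Longrightarrow> \<exists>i\<in>{1..N}. \<exists>k\<in>{1..N}. e = {i, k}"
    and m: "\<And>i k. i \<in> {1..N} \<Longrightarrow> k \<in> {1..N} \<Longrightarrow> arrow_mult Q (d i) (d k) = (if {i, k} \<in> E then 1 else 0)"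
  shows "underlying_graph_iso Q N E"
proof -
  interpret fin_digraph Q by fact
  define f where "f = the_inv_into {1..N} d"
  have f: "bij_betw f (verts Q) {1..N}" unfolding f_def by (rule bij_betw_the_inv_into[OF d])
  have df: "d (f v) = v" "f v \<in> {1..N}" if "v \<in> verts Q" for v
    using that d bij_betwE[OF f] by (auto simp: f_def f_the_inv_into_f bij_betw_def)
  have fd: "f (d i) = i" if "i \<in> {1..N}" for i
    using that d by (auto simp: f_def the_inv_into_f_f bij_betw_def)
  let ?e = "\<lambda>a. {f (tail Q a), f (head Q a)}"
  let ?A = "\<lambda>u v. {a \<in> arcs Q. tail Q a = u \<and> head Q a = v}"
  let ?B = "\<lambda>u v. {a \<in> arcs Q. head Q a = u \<and> tail Q a = v}"
  have m': "card (?A u v) + card (?B u v) = (if {f u, f v} \<in> E then 1 else 0)"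
    if "u \<in> verts Q" "v \<in> verts Q" for u v
    using m[OF df(2)[OF that(1)] df(2)[OF that(2)]] df(1) that by (simp add: arrow_mult_eq[OF fin])
  have in_E: "?e a \<in> E" if a: "a \<in> arcs Q" for a
  proof (rule ccontr)
    assume "?e a \<notin> E"
    then have "card (?A (tail Q a) (head Q a)) = 0" using m'[of "tail Q a" "head Q a"] a by simp
    then show False using a by auto
  qed
  have "inj_on ?e (arcs Q)"
  proof (rule inj_onI)
    fix a b assume ab: "a \<in> arcs Q" "b \<in> arcs Q" "?e a = ?e b"
    define u v where "u = tail Q a" and "v = head Q a"
    have uv: "u \<in> verts Q" "v \<in> verts Q" using ab by (auto simp: u_def v_def)
    have c: "card (?A u v) + card (?B u v) \<le> 1" using m'[OF uv] by auto
    have aA: "a \<in> ?A u v" using ab by (simp add: u_def v_def)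
    then have "card (?A u v) > 0" by (subst card_gt_0_iff) auto
    then have "card (?B u v) = 0" "card (?A u v) = 1" using c by linarith+
    then obtain x where x: "?A u v = {x}" by (elim card_1_singletonE)
    have "inj_on f (verts Q)" using f by (simp add: bij_betw_def)
    then have "tail Q b = u \<and> head Q b = v \<or> tail Q b = v \<and> head Q b = u"
      using ab uv unfolding u_def v_def
      by (auto simp: doubleton_eq_iff inj_on_eq_iff)
    then have "b \<in> ?A u v \<or> b \<in> ?B u v" using ab(2) by blast
    moreover have "?B u v = {}" using \<open>card (?B u v) = 0\<close> by simp
    ultimately have "b \<in> {x}" unfolding x by simp
    moreover have "a \<in> {x}" using aA unfolding x .
    ultimately show "a = b" by simp
  qed
  moreover have "?e ` arcs Q = E"
  proof (intro equalityI subsetI)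
    fix e assume e: "e \<in> E"
    then obtain i k where ik: "i \<in> {1..N}" "k \<in> {1..N}" "e = {i, k}" using E by blast
    have "card (?A (d i) (d k)) + card (?B (d i) (d k)) = 1"
      using m[OF ik(1,2)] e ik(3) by (simp add: arrow_mult_eq[OF fin])
    then have "?A (d i) (d k) \<noteq> {} \<or> ?B (d i) (d k) \<noteq> {}" by (metis add_is_0 card.empty zero_neq_one)
    then obtain a where a: "a \<in> arcs Q"
      "tail Q a = d i \<and> head Q a = d k \<or> head Q a = d i \<and> tail Q a = d k"
      by blast
    have "?e a = e" using a(2) fd[OF ik(1)] fd[OF ik(2)] ik(3) by auto
    then show "e \<in> ?e ` arcs Q" using a(1) by blast
  qed (use in_E in auto)
  ultimately show ?thesis
    unfolding underlying_graph_iso_def bij_betw_def using f by (auto simp: bij_betw_def)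
qed

lemma chain_edges_iff:
  "{i, k} \<in> chain_edges n \<longleftrightarrow> i \<in> {1..n} \<and> k \<in> {1..n} \<and> (k = i + 1 \<or> i = k + 1)"
  by (auto simp: chain_edges_def doubleton_eq_iff)

lemma chain_quiver_iso:
  assumes "fin_digraph Q" "chain_graph (arrow_mult Q) n c" "verts Q = c ` {1..n}"
  shows "underlying_graph_iso Q n (dynkin_A n)"
  unfolding dynkin_A_def
proof (rule underlying_graph_isoI[OF assms(1)])
  show "bij_betw c {1..n} (verts Q)" using assms by (simp add: chain_graph_def bij_betw_def)
  show "\<exists>i\<in>{1..n}. \<exists>k\<in>{1..n}. e = {i, k}" if "e \<in> chain_edges n" for e
    using that by (fastforce simp: chain_edges_def)
  show "arrow_mult Q (c i) (c k) = (if {i, k} \<in> chain_edges n then 1 else 0)"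
    if "i \<in> {1..n}" "k \<in> {1..n}" for i k
    using that assms(2) unfolding chain_edges_iff chain_graph_def by simp
qed

text \<open>\<open>b\<close> receives the last label \<open>n + 1\<close>, as the extra vertex does
  in \<open>dynkin_D\<close> and \<open>dynkin_E\<close>; the branch vertex \<open>k\<close> stays
  free so that the chain may be reversed.\<close>

lemma spider_quiver_iso:
  assumes fin: "fin_digraph Q" and irr: "\<And>v. arrow_mult Q v v = 0"
    and chain: "chain_graph (arrow_mult Q) n c" and b: "leaf_at (arrow_mult Q) n c k b" "k \<in> {1..n}"
    and V: "verts Q = insert b (c ` {1..n})"
  shows "underlying_graph_iso Q (n + 1) (insert {k, n + 1} (chain_edges n))"
proof (rule underlying_graph_isoI[OF fin])
  let ?m = "arrow_mult Q" and ?d = "c(n + 1 := b)"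
  have n1: "{1..n + 1} = insert (n + 1) {1..n}" by auto
  have "inj_on ?d {1..n}"
    using chain by (subst inj_on_cong[of _ _ c]) (auto simp: chain_graph_def)
  then have "inj_on ?d {1..n + 1}" using b unfolding n1 by (auto simp: leaf_at_def)
  then show "bij_betw ?d {1..n + 1} (verts Q)" unfolding bij_betw_def image_snoc V by simp
  show "\<exists>i\<in>{1..n + 1}. \<exists>l\<in>{1..n + 1}. e = {i, l}" if "e \<in> insert {k, n + 1} (chain_edges n)" for e
  proof (cases "e = {k, n + 1}")
    case False
    with that obtain i where "e = {i, i + 1}" "1 \<le> i" "i < n" by (auto simp: chain_edges_def)
    then show ?thesis by (intro bexI[of _ i] bexI[of _ "i + 1"]) auto
  next
    case True
    then show ?thesis using b(2) by (intro bexI[of _ k] bexI[of _ "n + 1"]) auto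
  qed
  fix i l assume il: "i \<in> {1..n + 1}" "l \<in> {1..n + 1}"
  have bc: "?m b (c x) = (if x = k then 1 else 0)" "?m (c x) b = (if x = k then 1 else 0)" if "x \<in> {1..n}" for x
    using b that arrow_mult_sym[OF fin, of "c x" b] by (auto simp: leaf_at_def)
  consider "i = n + 1" "l = n + 1" | "i = n + 1" "l \<in> {1..n}" | "i \<in> {1..n}" "l = n + 1" |
    "i \<in> {1..n}" "l \<in> {1..n}" using il by force
  then show "?m (?d i) (?d l) = (if {i, l} \<in> insert {k, n + 1} (chain_edges n) then 1 else 0)"
  proof cases
    case 1
    then show ?thesis using irr b(2) unfolding insert_iff chain_edges_iff by (auto simp: doubleton_eq_iff)
  next
    case 2
    then show ?thesis using bc[of l] unfolding insert_iff chain_edges_iff by (auto simp: doubleton_eq_iff)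
  next
    case 3
    then show ?thesis using bc[of i] unfolding insert_iff chain_edges_iff by (auto simp: doubleton_eq_iff)
  next
    case 4
    then have "?m (c i) (c l) = (if l = i + 1 \<or> i = l + 1 then 1 else 0)"
      using chain by (simp add: chain_graph_def)
    then show ?thesis using 4 unfolding insert_iff chain_edges_iff by (auto simp: doubleton_eq_iff)
  qed
qed

text \<open>By contraposition: without a weight the graph is a chain, of type A, or a spider, which
  \<open>spider_bounds\<close> leaves only in types D and E. Connectedness then makes the weight
  positive.\<close>

theorem non_dynkin_superadditive:
  assumes fin: "fin_digraph Q" and conn: "Digraph_Component.connected Q"
    and acyc: "acyclic_quiver Q" and nd: "\<not> dynkin_quiver Q"
  obtains \<delta> where "superadditive (arrow_mult Q) (verts Q) \<delta>" "\<And>v. v \<in> verts Q \<Longrightarrow> \<delta> v > 0"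
proof -
  interpret fin_digraph Q by fact
  let ?m = "arrow_mult Q"
  have sym: "\<And>u v. ?m u v = ?m v u" and irr: "\<And>v. ?m v v = 0"
    by (rule arrow_mult_sym[OF fin]) (rule arrow_mult_irrefl[OF fin acyc])
  have mconn: "mult_connected ?m (verts Q)" by (rule mult_connected_quiver[OF fin conn])
  have ne: "verts Q \<noteq> {}" using conn unfolding connected_def strongly_connected_def by simp
  have "has_superadditive ?m (verts Q)"
  proof (rule ccontr)
    assume no: "\<not> has_superadditive ?m (verts Q)"
    have "chain_or_spider ?m (verts Q)"
      by (rule chain_or_spider_if_no_superadditive[OF _ ne mconn no sym irr]) simp
    then consider n c where "n \<ge> 1" "chain_graph ?m n c" "verts Q = c ` {1..n}" |
      n c k b where "chain_graph ?m n c" "leaf_at ?m n c k b" "2 \<le> k" "k < n" "verts Q = insert b (c ` {1..n})"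
      unfolding chain_or_spider_def by blast
    then show False
    proof cases
      case 1
      then show False using chain_quiver_iso[OF fin] nd unfolding dynkin_quiver_def by blast
    next
      case 2
      have k: "k \<in> {1..n}" using 2 by auto
      have bounds: "k = 2 \<or> k = n - 1 \<or> (k = 3 \<or> k = n - 2) \<and> n \<in> {5, 6, 7}"
        by (rule spider_bounds[OF 2(1) sym 2(2-4)]) (use no 2(5) in simp)
      let ?r = "\<lambda>i. c (n + 1 - i)"
      have iso: "underlying_graph_iso Q (n + 1) (insert {k, n + 1} (chain_edges n))"
        by (rule spider_quiver_iso[OF fin irr 2(1,2) k 2(5)])
      \<comment> \<open>Reversal moves a branch vertex at 2 or \<open>n - 2\<close> to
        \<open>n - 1\<close> or 3, where the labellings of D and E expect it.\<close>
      have iso': "underlying_graph_iso Q (n + 1) (insert {n + 1 - k, n + 1} (chain_edges n))"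
        by (rule spider_quiver_iso[OF fin irr chain_graph_rev[OF 2(1)] leaf_at_rev[OF 2(2) k]])
          (use k 2(5) image_rev[of c n] in auto)
      have D: "insert {n - 1, n + 1} (chain_edges n) = dynkin_D (n + 1)"
        by (simp add: dynkin_D_def)
      have E: "insert {3, n + 1} (chain_edges n) = dynkin_E (n + 1)"
        by (simp add: dynkin_E_def)
      from bounds consider "k = n - 1 \<or> n + 1 - k = n - 1" |
        "k = 3 \<or> n + 1 - k = 3" "n + 1 \<in> {6, 7, 8}" using 2(3,4) by fastforce
      then show False
      proof cases
        case 1
        then have "underlying_graph_iso Q (n + 1) (dynkin_D (n + 1))" using iso iso' D by metis
        moreover have "n + 1 \<ge> 4" using 1 \<open>2 \<le> k\<close> \<open>k < n\<close> by auto
        ultimately show False using nd unfolding dynkin_quiver_def by blast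
      next
        case 2
        then have "underlying_graph_iso Q (n + 1) (dynkin_E (n + 1))" using iso iso' E by metis
        then show False using nd 2(2) unfolding dynkin_quiver_def by blast
      qed
    qed
  qed
  then show ?thesis
    using superadditive_positive[OF finite_verts mconn sym] that by blast
qed


section \<open>The pairing with the path algebra\<close>

text \<open>Finite support is a matter of \<open>f\<close> alone; \<open>g\<close> is any function
  on paths, that is, an element of the full linear dual.\<close>

definition path_pairing :: "(('v, 'b) path \<Rightarrow> 'k::field) \<Rightarrow> (('v, 'b) path \<Rightarrow> 'k) \<Rightarrow> 'k" where
  "path_pairing g f = (\<Sum>x | f x \<noteq> 0. g x * f x)"

definition path_cat :: "('v, 'b) path \<Rightarrow> ('v, 'b) path \<Rightarrow> ('v, 'b) path" where
  "path_cat y z = (fst y, fst (snd y) @ fst (snd z), snd (snd z))"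

text \<open>The transpose of left multiplication by the path \<open>y\<close>. As
  \<open>path_cat\<close> ignores whether end points match, the test singles out the composable
  pairs.\<close>

definition left_shift :: "('v, 'b) path \<Rightarrow> (('v, 'b) path \<Rightarrow> 'k::field) \<Rightarrow> ('v, 'b) path \<Rightarrow> 'k" where
  "left_shift y g = (\<lambda>z. if snd (snd y) = fst z then g (path_cat y z) else 0)"

definition right_shift :: "('v, 'b) path \<Rightarrow> (('v, 'b) path \<Rightarrow> 'k::field) \<Rightarrow> ('v, 'b) path \<Rightarrow> 'k" where
  "right_shift z g = (\<lambda>y. if snd (snd y) = fst z then g (path_cat y z) else 0)"

lemma path_pairing_superset:
  "finite X \<Longrightarrow> {x. f x \<noteq> 0} \<subseteq> X \<Longrightarrow> path_pairing g f = (\<Sum>x\<in>X. g x * f x)"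
  unfolding path_pairing_def by (rule sum.mono_neutral_left) auto

lemma path_pairing_add:
  assumes "finite {x. f x \<noteq> 0}" "finite {x. h x \<noteq> 0}"
  shows "path_pairing g (\<lambda>x. f x + h x) = path_pairing g f + path_pairing g h"
proof -
  let ?X = "{x. f x \<noteq> 0} \<union> {x. h x \<noteq> 0}"
  have fin: "finite ?X" using assms by simp
  have "path_pairing g f = (\<Sum>x\<in>?X. g x * f x)" "path_pairing g h = (\<Sum>x\<in>?X. g x * h x)"
    "path_pairing g (\<lambda>x. f x + h x) = (\<Sum>x\<in>?X. g x * (f x + h x))"
    by (rule path_pairing_superset[OF fin]; auto)+
  then show ?thesis by (simp add: sum.distrib distrib_left)
qed

lemma path_pairing_scale:
  assumes "finite {x. f x \<noteq> 0}"
  shows "path_pairing g (\<lambda>x. c * f x) = c * path_pairing g f"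
  using path_pairing_superset[OF assms, of "\<lambda>x. c * f x" g]
  by (auto simp: path_pairing_def sum_distrib_left mult_ac)

lemma path_pairing_delta:
  assumes "finite {x. f x \<noteq> 0}"
  shows "path_pairing (path_basis y) f = f y"
proof -
  have "path_pairing (path_basis y) f = (\<Sum>x\<in>insert y {x. f x \<noteq> 0}. path_basis y x * f x)"
    using assms by (intro path_pairing_superset) auto
  also have "\<dots> = (\<Sum>x\<in>insert y {x. f x \<noteq> 0}. if x = y then f x else 0)"
    by (intro sum.cong) (auto simp: path_basis_def)
  finally show ?thesis using assms by simp
qed

context fin_digraph
begin

lemma path_algebra_carrierD:
  "f \<in> carrier (path_algebra G) \<Longrightarrow> finite {x. f x \<noteq> 0}"
  "f \<in> carrier (path_algebra G) \<Longrightarrow> f x \<noteq> 0 \<Longrightarrow> x \<in> paths G"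
  by (auto simp: path_algebra_def)

text \<open>Double counting: a coefficient of the product sums over factorizations of one path, and
  grouping by \<open>path_cat\<close> turns the total into a sum over composable pairs from the two
  supports.\<close>

lemma path_pairing_mult:
  fixes f h :: "('a, 'b) path \<Rightarrow> 'k::field"
  assumes f: "f \<in> carrier (path_algebra G)" and h: "h \<in> carrier (path_algebra G)"
  shows "path_pairing g (f \<otimes>\<^bsub>path_algebra G\<^esub> h) =
    (\<Sum>y | f y \<noteq> 0. \<Sum>z | h z \<noteq> 0. if snd (snd y) = fst z then g (path_cat y z) * (f y * h z) else 0)"
proof -
  let ?A = "{y. f y \<noteq> 0}" and ?B = "{z. h z \<noteq> 0}" and ?F = "path_factorizations G"
  let ?P = "{yz \<in> ?A \<times> ?B. snd (snd (fst yz)) = fst (snd yz)}"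
  let ?c = "\<lambda>yz. path_cat (fst yz) (snd yz)"
  note fin = path_algebra_carrierD(1)[OF f] path_algebra_carrierD(1)[OF h]
  then have finP: "finite ?P" by simp
  have inF: "yz \<in> ?F (?c yz)" if "yz \<in> ?P" for yz
  proof -
    obtain u p w w' q v where yz: "yz = ((u, p, w), (w', q, v))" by (metis prod.exhaust)
    then have "w' = w" "(u, p, w) \<in> paths G" "(w, q, v) \<in> paths G"
      using that path_algebra_carrierD(2)[OF f] path_algebra_carrierD(2)[OF h] by auto
    then show ?thesis by (auto simp: yz path_factorizations_def path_cat_def)
  qed
  have Fc: "snd (snd (fst yz)) = fst (snd yz) \<and> ?c yz = x" if "yz \<in> ?F x" for yz x
    using that by (auto simp: path_factorizations_def path_cat_def)
  have mult: "(f \<otimes>\<^bsub>path_algebra G\<^esub> h) x = (\<Sum>yz\<in>{yz \<in> ?P. ?c yz = x}. f (fst yz) * h (snd yz))" for x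
  proof -
    have "(f \<otimes>\<^bsub>path_algebra G\<^esub> h) x = (\<Sum>yz\<in>?F x. f (fst yz) * h (snd yz))"
      by (simp add: path_algebra_def case_prod_beta)
    also have "\<dots> = (\<Sum>yz\<in>{yz \<in> ?P. ?c yz = x}. f (fst yz) * h (snd yz))"
    proof (rule sum.mono_neutral_right[OF finite_path_factorizations])
      show "{yz \<in> ?P. ?c yz = x} \<subseteq> ?F x" using inF by blast
      show "\<forall>yz\<in>?F x - {yz \<in> ?P. ?c yz = x}. f (fst yz) * h (snd yz) = 0"
      proof
        fix yz assume yz: "yz \<in> ?F x - {yz \<in> ?P. ?c yz = x}"
        then have "yz \<notin> ?A \<times> ?B" using Fc[of yz x] by blast
        then show "f (fst yz) * h (snd yz) = 0" by (auto simp: mem_Times_iff)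
      qed
    qed
    finally show ?thesis .
  qed
  have "{x. (f \<otimes>\<^bsub>path_algebra G\<^esub> h) x \<noteq> 0} \<subseteq> ?c ` ?P"
  proof
    fix x assume "x \<in> {x. (f \<otimes>\<^bsub>path_algebra G\<^esub> h) x \<noteq> 0}"
    then have "(f \<otimes>\<^bsub>path_algebra G\<^esub> h) x \<noteq> 0" by simp
    then have "{yz \<in> ?P. ?c yz = x} \<noteq> {}" unfolding mult by (metis (lifting) sum.empty)
    then show "x \<in> ?c ` ?P" by blast
  qed
  then have "path_pairing g (f \<otimes>\<^bsub>path_algebra G\<^esub> h) = (\<Sum>x\<in>?c ` ?P. g x * (f \<otimes>\<^bsub>path_algebra G\<^esub> h) x)"
    using finP by (intro path_pairing_superset) auto
  also have "\<dots> = (\<Sum>x\<in>?c ` ?P. \<Sum>yz\<in>{yz \<in> ?P. ?c yz = x}. g (?c yz) * (f (fst yz) * h (snd yz)))"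
    unfolding mult sum_distrib_left by (intro sum.cong refl) auto
  also have "\<dots> = (\<Sum>yz\<in>?P. g (?c yz) * (f (fst yz) * h (snd yz)))"
    by (rule sum.image_gen[OF finP, symmetric])
  also have "\<dots> = (\<Sum>yz\<in>?A \<times> ?B. if snd (snd (fst yz)) = fst (snd yz) then g (?c yz) * (f (fst yz) * h (snd yz)) else 0)"
    using fin by (subst sum.inter_filter) auto
  also have "\<dots> = (\<Sum>y\<in>?A. \<Sum>z\<in>?B. if snd (snd y) = fst z then g (path_cat y z) * (f y * h z) else 0)"
    by (simp add: sum.cartesian_product case_prod_beta)
  finally show ?thesis .
qed

lemma path_pairing_mult_left:
  fixes f h :: "('a, 'b) path \<Rightarrow> 'k::field"
  assumes "f \<in> carrier (path_algebra G)" "h \<in> carrier (path_algebra G)"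
  shows "path_pairing g (f \<otimes>\<^bsub>path_algebra G\<^esub> h) =
    (\<Sum>y | f y \<noteq> 0. f y * path_pairing (left_shift y g) h)"
  unfolding path_pairing_mult[OF assms] unfolding path_pairing_def left_shift_def sum_distrib_left
  by (intro sum.cong refl) (auto simp: mult_ac)

lemma path_pairing_mult_right:
  fixes f h :: "('a, 'b) path \<Rightarrow> 'k::field"
  assumes "f \<in> carrier (path_algebra G)" "h \<in> carrier (path_algebra G)"
  shows "path_pairing g (f \<otimes>\<^bsub>path_algebra G\<^esub> h) =
    (\<Sum>z | h z \<noteq> 0. h z * path_pairing (right_shift z g) f)"
  unfolding path_pairing_mult[OF assms] unfolding path_pairing_def right_shift_def sum_distrib_left
  by (subst sum.swap, intro sum.cong refl) (auto simp: mult_ac)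

lemma path_basis_closed: "y \<in> paths G \<Longrightarrow> path_basis y \<in> carrier (path_algebra G)"
  by (auto simp: path_algebra_def path_basis_def)

lemma path_pairing_basis_left:
  fixes h :: "('a, 'b) path \<Rightarrow> 'k::field"
  assumes "y \<in> paths G" "h \<in> carrier (path_algebra G)"
  shows "path_pairing g (path_basis y \<otimes>\<^bsub>path_algebra G\<^esub> h) = path_pairing (left_shift y g) h"
proof -
  have "{x. path_basis y x \<noteq> (0::'k)} = {y}" by (auto simp: path_basis_def)
  then show ?thesis
    unfolding path_pairing_mult_left[OF path_basis_closed[OF assms(1)] assms(2)]
    by (simp add: path_basis_def)
qed

lemma path_pairing_basis_right:
  fixes f :: "('a, 'b) path \<Rightarrow> 'k::field"
  assumes "z \<in> paths G" "f \<in> carrier (path_algebra G)"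
  shows "path_pairing g (f \<otimes>\<^bsub>path_algebra G\<^esub> path_basis z) = path_pairing (right_shift z g) f"
proof -
  have "{x. path_basis z x \<noteq> (0::'k)} = {z}" by (auto simp: path_basis_def)
  then show ?thesis
    unfolding path_pairing_mult_right[OF assms(2) path_basis_closed[OF assms(1)]]
    by (simp add: path_basis_def)
qed

end

section \<open>Functions annihilating the mesh ideal\<close>

definition opp_arrow :: "'a + 'a \<Rightarrow> 'a + 'a" where
  "opp_arrow = case_sum Inr Inl"

definition arrow_sign :: "'a + 'a \<Rightarrow> 'k::field" where
  "arrow_sign = case_sum (\<lambda>_. 1) (\<lambda>_. - 1)"

definition arrows_from :: "('v, 'a) pre_digraph \<Rightarrow> 'v \<Rightarrow> ('a + 'a) set" where
  "arrows_from Q i = {a \<in> arcs (double_quiver Q). tail (double_quiver Q) a = i}"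

text \<open>Such a \<open>g\<close> annihilates every product of a path, a mesh relation and a path,
  and these products span the mesh ideal.\<close>

definition mesh_harmonic :: "('v, 'a) pre_digraph \<Rightarrow> (('v, 'a + 'a) path \<Rightarrow> 'k::field) \<Rightarrow> bool" where
  "mesh_harmonic Q g \<longleftrightarrow> (\<forall>u p k q v. (u, p, k) \<in> paths (double_quiver Q) \<longrightarrow>
     (k, q, v) \<in> paths (double_quiver Q) \<longrightarrow>
     (\<Sum>a\<in>arrows_from Q k. arrow_sign a * g (u, p @ a # opp_arrow a # q, v)) = 0)"

context fin_digraph
begin

interpretation D: fin_digraph "double_quiver G" by (rule double_quiver_fin_digraph)

lemma finite_arrows_from: "finite (arrows_from G i)"
  by (simp add: arrows_from_def)

lemma mesh_relation_alt:
  "mesh_relation G i x = (\<Sum>a\<in>arrows_from G i. arrow_sign a * path_basis (i, [a, opp_arrow a], i) x)"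
proof -
  have "arrows_from G i = {a \<in> arcs G. tail G a = i} <+> {a \<in> arcs G. head G a = i}"
    by (auto simp: arrows_from_def double_quiver_def)
  then show ?thesis
    by (simp add: mesh_relation_def sum.Plus arrow_sign_def opp_arrow_def sum_negf)
qed

lemma path_pairing_mesh:
  fixes g :: "('a, 'b + 'b) path \<Rightarrow> 'k::field"
  assumes "i \<in> verts G"
  shows "path_pairing g (mesh_relation G i) = (\<Sum>a\<in>arrows_from G i. arrow_sign a * g (i, [a, opp_arrow a], i))"
proof -
  let ?m = "mesh_relation G i :: ('a, 'b + 'b) path \<Rightarrow> 'k"
  let ?X = "(\<lambda>a. (i, [a, opp_arrow a], i)) ` arrows_from G i"
  have "{x. ?m x \<noteq> 0} \<subseteq> ?X"
  proof
    fix x assume "x \<in> {x. ?m x \<noteq> 0}"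
    then have "(\<Sum>a\<in>arrows_from G i. arrow_sign a * path_basis (i, [a, opp_arrow a], i) x :: 'k) \<noteq> 0"
      by (simp add: mesh_relation_alt)
    then show "x \<in> ?X"
      by (rule sum.not_neutral_contains_not_neutral) (auto simp: path_basis_def split: if_splits)
  qed
  then have "path_pairing g ?m = (\<Sum>x\<in>?X. g x * ?m x)"
    using finite_arrows_from by (intro path_pairing_superset) auto
  also have "\<dots> = (\<Sum>b\<in>arrows_from G i. g (i, [b, opp_arrow b], i) *
      (\<Sum>a\<in>arrows_from G i. arrow_sign a * path_basis (i, [a, opp_arrow a], i) (i, [b, opp_arrow b], i)))"
    by (subst sum.reindex) (auto simp: inj_on_def mesh_relation_alt)
  also have "\<dots> = (\<Sum>b\<in>arrows_from G i. g (i, [b, opp_arrow b], i) *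
      (\<Sum>a\<in>arrows_from G i. if a = b then arrow_sign b else 0))"
    by (intro sum.cong arg_cong2[where f = "(*)"] refl) (auto simp: path_basis_def)
  also have "\<dots> = (\<Sum>b\<in>arrows_from G i. arrow_sign b * g (i, [b, opp_arrow b], i))"
    using finite_arrows_from by (intro sum.cong) (auto simp: mult.commute)
  finally show ?thesis .
qed

lemma mesh_harmonic_left_shift:
  assumes "mesh_harmonic G g" "y \<in> paths (double_quiver G)"
  shows "mesh_harmonic G (left_shift y g)"
  unfolding mesh_harmonic_def
proof (intro allI impI)
  fix u p k q v assume pq: "(u, p, k) \<in> paths (double_quiver G)" "(k, q, v) \<in> paths (double_quiver G)"
  obtain s r t where y: "y = (s, r, t)" by (cases y)
  show "(\<Sum>a\<in>arrows_from G k. arrow_sign a * left_shift y g (u, p @ a # opp_arrow a # q, v)) = 0"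
  proof (cases "t = u")
    case True
    then have "(s, r @ p, k) \<in> paths (double_quiver G)"
      using assms(2) pq y D.paths_append by blast
    then have "(\<Sum>a\<in>arrows_from G k. arrow_sign a * g (s, (r @ p) @ a # opp_arrow a # q, v)) = 0"
      using assms(1) pq(2) unfolding mesh_harmonic_def by blast
    then show ?thesis using True by (simp add: y left_shift_def path_cat_def)
  qed (simp add: y left_shift_def)
qed

lemma mesh_harmonic_right_shift:
  assumes "mesh_harmonic G g" "z \<in> paths (double_quiver G)"
  shows "mesh_harmonic G (right_shift z g)"
  unfolding mesh_harmonic_def
proof (intro allI impI)
  fix u p k q v assume pq: "(u, p, k) \<in> paths (double_quiver G)" "(k, q, v) \<in> paths (double_quiver G)"
  obtain s r t where z: "z = (s, r, t)" by (cases z)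
  show "(\<Sum>a\<in>arrows_from G k. arrow_sign a * right_shift z g (u, p @ a # opp_arrow a # q, v)) = 0"
  proof (cases "v = s")
    case True
    then have "(k, q @ r, t) \<in> paths (double_quiver G)"
      using assms(2) pq z D.paths_append by blast
    then show ?thesis using True assms(1) pq
      by (simp add: z right_shift_def path_cat_def mesh_harmonic_def)
  qed (simp add: z right_shift_def)
qed

text \<open>The elements killed by all harmonic functions, rather than by \<open>g\<close> alone,
  form an ideal: multiplying by a path replaces a harmonic function by a shift, which is harmonic
  again. The ideal contains the mesh relations.\<close>

lemma harmonic_annihilates_mesh_ideal:
  fixes g :: "('a, 'b + 'b) path \<Rightarrow> 'k::field"
  assumes g: "mesh_harmonic G g" and f: "f \<in> mesh_ideal G"
  shows "path_pairing g f = 0"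
proof -
  let ?R = "path_algebra (double_quiver G) :: (('a, 'b + 'b) path \<Rightarrow> 'k) ring"
  interpret R: ring ?R by (rule D.path_algebra_ring)
  define J where "J = {f \<in> carrier ?R. \<forall>g. mesh_harmonic G g \<longrightarrow> path_pairing g f = 0}"
  note fin = D.path_algebra_carrierD(1)
  have "ideal J ?R"
  proof (rule idealI[OF R.ring_axioms])
    show "subgroup J (add_monoid ?R)"
    proof (rule R.add.subgroupI)
      show "J \<subseteq> carrier ?R" by (auto simp: J_def)
      have "\<zero>\<^bsub>?R\<^esub> \<in> J" by (auto simp: J_def path_pairing_def) (simp add: path_algebra_def)
      then show "J \<noteq> {}" by blast
    next
      fix a assume a: "a \<in> J"
      have c: "(\<lambda>x. - 1 * a x) \<in> carrier ?R" using a by (auto simp: J_def path_algebra_def)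
      have "\<ominus>\<^bsub>?R\<^esub> a = (\<lambda>x. - 1 * a x)"
        by (rule R.minus_equality) (use a c in \<open>auto simp: J_def, auto simp: path_algebra_def\<close>)
      moreover have "path_pairing g (\<lambda>x. - 1 * a x) = 0" if "mesh_harmonic G g" for g
        using a that fin[of a] by (subst path_pairing_scale) (auto simp: J_def)
      ultimately show "\<ominus>\<^bsub>?R\<^esub> a \<in> J" using c by (simp add: J_def)
    next
      fix a b assume ab: "a \<in> J" "b \<in> J"
      then have "a \<oplus>\<^bsub>?R\<^esub> b \<in> carrier ?R" by (simp add: J_def)
      moreover have "a \<oplus>\<^bsub>?R\<^esub> b = (\<lambda>x. a x + b x)" by (simp add: path_algebra_def)
      moreover have "path_pairing g (\<lambda>x. a x + b x) = 0" if "mesh_harmonic G g" for g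
        using ab that fin[of a] fin[of b] by (subst path_pairing_add) (auto simp: J_def)
      ultimately show "a \<oplus>\<^bsub>?R\<^esub> b \<in> J" by (simp add: J_def)
    qed
  next
    fix a x assume a: "a \<in> J" and x: "x \<in> carrier ?R"
    have ac: "a \<in> carrier ?R" using a by (simp add: J_def)
    have "path_pairing g (x \<otimes>\<^bsub>?R\<^esub> a) = 0" if "mesh_harmonic G g" for g
      unfolding D.path_pairing_mult_left[OF x ac]
      using a mesh_harmonic_left_shift[OF that] D.path_algebra_carrierD(2)[OF x]
      by (intro sum.neutral) (auto simp: J_def)
    then show "x \<otimes>\<^bsub>?R\<^esub> a \<in> J" using x ac by (simp add: J_def)
    have "path_pairing g (a \<otimes>\<^bsub>?R\<^esub> x) = 0" if "mesh_harmonic G g" for g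
      unfolding D.path_pairing_mult_right[OF ac x]
      using a mesh_harmonic_right_shift[OF that] D.path_algebra_carrierD(2)[OF x]
      by (intro sum.neutral) (auto simp: J_def)
    then show "a \<otimes>\<^bsub>?R\<^esub> x \<in> J" using x ac by (simp add: J_def)
  qed
  moreover have "mesh_relation G ` verts G \<subseteq> J"
  proof clarify
    fix i assume i: "i \<in> verts G"
    have "i \<in> verts (double_quiver G)" using i by (simp add: double_quiver_def)
    then have "(i, [], i) \<in> paths (double_quiver G)" by (simp only: D.trivial_path_iff)
    then have "path_pairing g (mesh_relation G i) = 0" if "mesh_harmonic G g" for g :: "('a, 'b + 'b) path \<Rightarrow> 'k"
      unfolding path_pairing_mesh[OF i] using that unfolding mesh_harmonic_def by fastforce
    then show "mesh_relation G i \<in> J" using mesh_relation_closed[OF i] by (simp add: J_def)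
  qed
  ultimately have "mesh_ideal G \<subseteq> J"
    unfolding mesh_ideal_def by (rule R.genideal_minimal)
  then show ?thesis using f g by (auto simp: J_def)
qed

text \<open>\<open>b\<close> is the product of \<open>p\<close>, the mesh relation at
  \<open>k\<close> and \<open>q\<close>. Its coefficients are found by pairing with delta functions
  and transposing both multiplications, so that no factorizations are summed.\<close>

lemma mesh_insertion:
  fixes p q :: "('b + 'b) list"
  assumes "(u, p, k) \<in> paths (double_quiver G)" "(k, q, v) \<in> paths (double_quiver G)"
  defines "b \<equiv> (\<lambda>x. \<Sum>a\<in>arrows_from G k. arrow_sign a * path_basis (u, p @ a # opp_arrow a # q, v) x)"
  shows "b \<in> (mesh_ideal G :: (('a, 'b + 'b) path \<Rightarrow> 'k::field) set)"
proof -
  let ?R = "path_algebra (double_quiver G) :: (('a, 'b + 'b) path \<Rightarrow> 'k) ring"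
  let ?y = "path_basis (u, p, k) :: ('a, 'b + 'b) path \<Rightarrow> 'k"
  let ?z = "path_basis (k, q, v) :: ('a, 'b + 'b) path \<Rightarrow> 'k"
  interpret R: ring ?R by (rule D.path_algebra_ring)
  interpret I: ideal "mesh_ideal G" ?R by (rule mesh_ideal)
  have k: "k \<in> verts G" using D.paths_verts[OF assms(1)] by (simp add: double_quiver_def)
  let ?m = "mesh_relation G k :: ('a, 'b + 'b) path \<Rightarrow> 'k"
  have c: "?m \<in> carrier ?R" "?y \<in> carrier ?R" "?z \<in> carrier ?R"
    by (rule mesh_relation_closed[OF k] D.path_basis_closed[OF assms(1)] D.path_basis_closed[OF assms(2)])+
  have "mesh_relation G ` verts G \<subseteq> (mesh_ideal G :: (_ \<Rightarrow> 'k) set)"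
    unfolding mesh_ideal_def
    by (rule R.genideal_self) (use mesh_relation_closed in blast)
  then have "?m \<in> mesh_ideal G" using k by blast
  then have mem: "?y \<otimes>\<^bsub>?R\<^esub> (?m \<otimes>\<^bsub>?R\<^esub> ?z) \<in> mesh_ideal G"
    using c by (intro I.I_l_closed I.I_r_closed)
  have "(?y \<otimes>\<^bsub>?R\<^esub> (?m \<otimes>\<^bsub>?R\<^esub> ?z)) x = b x" for x
  proof -
    have "(?y \<otimes>\<^bsub>?R\<^esub> (?m \<otimes>\<^bsub>?R\<^esub> ?z)) x =
        path_pairing (path_basis x) (?y \<otimes>\<^bsub>?R\<^esub> (?m \<otimes>\<^bsub>?R\<^esub> ?z))"
      using c by (intro path_pairing_delta[symmetric] D.path_algebra_carrierD(1)) simp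
    also have "\<dots> = path_pairing (left_shift (u, p, k) (path_basis x)) (?m \<otimes>\<^bsub>?R\<^esub> ?z)"
      using c by (intro D.path_pairing_basis_left assms) simp
    also have "\<dots> = path_pairing (right_shift (k, q, v) (left_shift (u, p, k) (path_basis x))) ?m"
      using c by (intro D.path_pairing_basis_right assms) simp
    also have "\<dots> = b x"
      unfolding path_pairing_mesh[OF k] b_def
      by (intro sum.cong refl) (auto simp: right_shift_def left_shift_def path_cat_def path_basis_def)
    finally show ?thesis .
  qed
  then have "?y \<otimes>\<^bsub>?R\<^esub> (?m \<otimes>\<^bsub>?R\<^esub> ?z) = b" by (rule ext)
  then show ?thesis using mem by simp
qed

end


section \<open>Corners of the preprojective algebra\<close>

context mesh
begin

primrec walk :: "'v \<Rightarrow> 'b list \<Rightarrow> 'v \<Rightarrow> bool" where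
  "walk i [] k \<longleftrightarrow> i = k"
| "walk i (a # p) k \<longleftrightarrow> a \<in> out i \<and> walk (tgt a) p k"

lemma walk_append: "walk i (p @ q) k \<longleftrightarrow> (\<exists>l. walk i p l \<and> walk l q k)"
  by (induction p arbitrary: i) auto

lemma walk_unique: "walk i p k \<Longrightarrow> walk i p l \<Longrightarrow> k = l"
  by (induction p arbitrary: i) auto

text \<open>The recursion demands the mesh condition at the front of words, for the function and all
  its derivatives. Unfolded, this is the condition at every position, as the two-sided ideal
  requires. The path length \<open>n\<close> is one less than the level.\<close>

lemma G_Suc_iff:
  "g \<in> G (Suc n) i \<longleftrightarrow> (\<forall>p. g p \<noteq> 0 \<longrightarrow> walk i p j \<and> length p = n) \<and>
     (\<forall>p k q. walk i p k \<longrightarrow> (\<Sum>a\<in>out k. eps a * g (p @ a # opp a # q)) = 0)"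
proof (induction n arbitrary: g i)
  case 0
  have "(\<forall>p. g p \<noteq> 0 \<longrightarrow> p = [] \<and> i = j) \<Longrightarrow> (\<Sum>a\<in>out k. eps a * g (p @ a # opp a # q)) = 0" for p k q
    by (intro sum.neutral) auto
  then show ?case by auto
next
  case (Suc n)
  show ?case
  proof (intro iffI conjI allI impI)
    assume g: "g \<in> G (Suc (Suc n)) i"
    have da: "cons_deriv a g \<in> G (Suc n) (tgt a)" if "a \<in> out i" for a
      using cons_deriv_G[OF g that] .
    have nil: "g [] = 0" and dn: "\<And>a p. a \<notin> out i \<Longrightarrow> g (a # p) = 0"
      using g by (auto simp: G_simps(3) cons_space_def cons_deriv_def fun_eq_iff)
    {
      fix p assume "g p \<noteq> 0"
      with nil dn obtain a q where aq: "p = a # q" "a \<in> out i" by (metis list.exhaust)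
      then have "cons_deriv a g q \<noteq> 0" using \<open>g p \<noteq> 0\<close> by (simp add: cons_deriv_def)
      then show "walk i p j" "length p = Suc n"
        using da[OF aq(2)] aq unfolding Suc.IH by auto
    }
    fix p k q assume w: "walk i p k"
    show "(\<Sum>a\<in>out k. eps a * g (p @ a # opp a # q)) = 0"
    proof (cases p)
      case Nil
      have "mesh_op i g q = 0" using g by (simp add: G_simps(3))
      then show ?thesis using w Nil by (simp add: mesh_op_def)
    next
      case (Cons a r)
      then have "a \<in> out i" "walk (tgt a) r k" using w by auto
      then have "(\<Sum>b\<in>out k. eps b * cons_deriv a g (r @ b # opp b # q)) = 0"
        using da[of a] unfolding Suc.IH by blast
      then show ?thesis by (simp add: Cons cons_deriv_def)
    qed
  next
    assume h: "(\<forall>p. g p \<noteq> 0 \<longrightarrow> walk i p j \<and> length p = Suc n) \<and>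
      (\<forall>p k q. walk i p k \<longrightarrow> (\<Sum>a\<in>out k. eps a * g (p @ a # opp a # q)) = 0)"
    have "g [] = 0" using h by (metis length_0_conv nat.distinct(1))
    moreover have "cons_deriv a g \<in> G (Suc n) (tgt a)" if a: "a \<in> out i" for a
      unfolding Suc.IH
    proof (intro conjI allI impI)
      fix p assume "cons_deriv a g p \<noteq> 0"
      then have "walk i (a # p) j \<and> length (a # p) = Suc n" using h unfolding cons_deriv_def by blast
      then show "walk (tgt a) p j" "length p = n" by auto
    next
      fix p k q assume "walk (tgt a) p k"
      then have "walk i (a # p) k" using a by simp
      then have "(\<Sum>b\<in>out k. eps b * g ((a # p) @ b # opp b # q)) = 0" using h by blast
      then show "(\<Sum>b\<in>out k. eps b * cons_deriv a g (p @ b # opp b # q)) = 0"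
        by (simp add: cons_deriv_def)
    qed
    moreover have "cons_deriv a g = 0" if "a \<notin> out i" for a
    proof
      fix p
      have "\<not> walk i (a # p) j" using that by simp
      then have "g (a # p) = 0" using h by blast
      then show "cons_deriv a g p = 0 p" by (simp add: cons_deriv_def)
    qed
    moreover have "mesh_op i g = 0"
    proof
      fix q
      have "(\<Sum>a\<in>out i. eps a * g ([] @ a # opp a # q)) = 0" using h by (metis walk.simps(1))
      then show "mesh_op i g q = 0 q" by (simp add: mesh_op_def)
    qed
    ultimately show "g \<in> G (Suc (Suc n)) i" by (simp add: G_simps(3) cons_space_def)
  qed
qed

end

text \<open>With both end points fixed, words stand for paths, so a corner lives in the same
  function space as \<open>G\<close>.\<close>

definition path_emb :: "'v \<Rightarrow> 'v \<Rightarrow> ('b list \<Rightarrow> 'k::field) \<Rightarrow> ('v, 'b) path \<Rightarrow> 'k" where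
  "path_emb i j f = (\<lambda>(u, p, v). if u = i \<and> v = j then f p else 0)"

lemma path_emb_simps:
  "path_emb i j (f + g) = (\<lambda>x. path_emb i j f x + path_emb i j g x)"
  "path_emb i j (f - g) = (\<lambda>x. path_emb i j f x - path_emb i j g x)"
  "path_emb i j (\<lambda>p. c * f p) = (\<lambda>x. c * path_emb i j f x)"
  "path_emb i j 0 = (\<lambda>x. 0)"
  by (auto simp: path_emb_def)

lemma path_emb_support: "{x. path_emb i j f x \<noteq> 0} = (\<lambda>p. (i, p, j)) ` {p. f p \<noteq> 0}"
  by (auto simp: path_emb_def split: if_splits)

lemma path_pairing_emb:
  assumes "finite L" "\<And>p. f p \<noteq> 0 \<Longrightarrow> p \<in> L"
  shows "path_pairing (path_emb i j g) (path_emb i j f) = (\<Sum>p\<in>L. g p * f p)"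
proof -
  have "path_pairing (path_emb i j g) (path_emb i j f) =
      (\<Sum>x\<in>(\<lambda>p. (i, p, j)) ` L. path_emb i j g x * path_emb i j f x)"
    using assms by (intro path_pairing_superset) (auto simp: path_emb_support)
  also have "\<dots> = (\<Sum>p\<in>L. g p * f p)"
    by (subst sum.reindex) (auto simp: inj_on_def path_emb_def)
  finally show ?thesis .
qed

definition paths_of_length :: "('v, 'a) pre_digraph \<Rightarrow> 'v \<Rightarrow> 'v \<Rightarrow> nat \<Rightarrow> ('a + 'a) list set" where
  "paths_of_length Q i j n = {p. (i, p, j) \<in> paths (double_quiver Q) \<and> length p = n}"

context fin_digraph
begin

interpretation D: fin_digraph "double_quiver G" by (rule double_quiver_fin_digraph)

lemma finite_paths_of_length: "finite (paths_of_length G i j n)"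
proof (rule finite_subset)
  show "paths_of_length G i j n \<subseteq> {p. set p \<subseteq> arcs (double_quiver G) \<and> length p = n}"
    by (auto simp: paths_of_length_def paths_def)
  show "finite {p. set p \<subseteq> arcs (double_quiver G) \<and> length p = n}"
    by (rule finite_lists_length_eq) simp
qed

lemma path_emb_graded:
  assumes "\<And>p. f p \<noteq> 0 \<Longrightarrow> p \<in> paths_of_length G i j n"
  shows "path_emb i j f \<in> path_graded (double_quiver G) n"
proof -
  have "finite {p. f p \<noteq> 0}"
    using assms by (intro finite_subset[OF _ finite_paths_of_length]) auto
  then have "finite {x. path_emb i j f x \<noteq> 0}" unfolding path_emb_support by simp
  moreover have "path_emb i j f (u, p, v) \<noteq> 0 \<Longrightarrow> u = i \<and> v = j \<and> f p \<noteq> 0" for u p v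
    by (auto simp: path_emb_def split: if_splits)
  then have "path_emb i j f (u, p, v) \<noteq> 0 \<Longrightarrow> (u, p, v) \<in> paths (double_quiver G) \<and> length p = n" for u p v
    using assms by (fastforce simp: paths_of_length_def)
  ultimately show ?thesis by (auto simp: path_graded_def path_algebra_def)
qed

lemma preproj_hom:
  "ring_hom_ring (path_algebra (double_quiver G) :: (('a, 'b + 'b) path \<Rightarrow> 'k::field) ring)
     (preproj_algebra G) (preproj_class G)"
  unfolding preproj_algebra_def preproj_class_def[abs_def]
  by (rule ideal.rcos_ring_hom_ring[OF mesh_ideal])

lemma preproj_class_eq_iff:
  fixes f h :: "('a, 'b + 'b) path \<Rightarrow> 'k::field"
  assumes "f \<in> carrier (path_algebra (double_quiver G))" "h \<in> carrier (path_algebra (double_quiver G))"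
  shows "preproj_class G f = preproj_class G h \<longleftrightarrow> (\<lambda>x. f x - h x) \<in> mesh_ideal G"
proof -
  let ?R = "path_algebra (double_quiver G) :: (('a, 'b + 'b) path \<Rightarrow> 'k) ring"
  interpret R: ring ?R by (rule D.path_algebra_ring)
  have c: "(\<lambda>x. - h x) \<in> carrier ?R" using assms(2) by (auto simp: path_algebra_def)
  have "\<ominus>\<^bsub>?R\<^esub> h = (\<lambda>x. - h x)"
    by (rule R.minus_equality) (use assms c in \<open>auto simp: path_algebra_def\<close>)
  then have "f \<ominus>\<^bsub>?R\<^esub> h = (\<lambda>x. f x - h x)"
    unfolding a_minus_def by (simp add: path_algebra_def)
  then show ?thesis
    unfolding preproj_class_def using R.quotient_eq_iff_same_a_r_cos[OF mesh_ideal assms] by simp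
qed

text \<open>The idempotents cut out the paths from \<open>i\<close> to \<open>j\<close>, and the
  class map is a ring homomorphism, so it carries corners to corners.\<close>

lemma preproj_corner:
  "(\<lambda>x. preproj_idem G i \<otimes>\<^bsub>preproj_algebra G\<^esub> x \<otimes>\<^bsub>preproj_algebra G\<^esub> preproj_idem G j) ` preproj_graded G n =
   (\<lambda>f. preproj_class G (path_emb i j f)) `
     {f :: ('b + 'b) list \<Rightarrow> 'k::field. \<forall>p. f p \<noteq> 0 \<longrightarrow> p \<in> paths_of_length G i j n}"
  if V: "verts G = UNIV"
proof -
  let ?R = "path_algebra (double_quiver G) :: (('a, 'b + 'b) path \<Rightarrow> 'k) ring"
  let ?P = "preproj_algebra G :: (('a, 'b + 'b) path \<Rightarrow> 'k) set ring"
  let ?U = "{f :: ('b + 'b) list \<Rightarrow> 'k. \<forall>p. f p \<noteq> 0 \<longrightarrow> p \<in> paths_of_length G i j n}"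
  interpret R: ring ?R by (rule D.path_algebra_ring)
  interpret h: ring_hom_ring ?R ?P "preproj_class G" by (rule preproj_hom)
  have e: "path_basis (i, [], i) \<in> carrier ?R" for i
    by (rule D.path_basis_closed) (simp only: D.trivial_path_iff, simp add: double_quiver_def V)
  have graded: "f \<in> carrier ?R" if "f \<in> path_graded (double_quiver G) n" for f
    using that by (simp add: path_graded_def)
  have corner: "preproj_idem G i \<otimes>\<^bsub>?P\<^esub> preproj_class G f \<otimes>\<^bsub>?P\<^esub> preproj_idem G j =
      preproj_class G (path_emb i j (\<lambda>p. f (i, p, j)))" if "f \<in> path_graded (double_quiver G) n" for f
  proof -
    have "preproj_idem G i \<otimes>\<^bsub>?P\<^esub> preproj_class G f \<otimes>\<^bsub>?P\<^esub> preproj_idem G j =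
        preproj_class G (path_basis (i, [], i) \<otimes>\<^bsub>?R\<^esub> f \<otimes>\<^bsub>?R\<^esub> path_basis (j, [], j))"
      using e graded[OF that] unfolding preproj_idem_def by simp
    also have "path_basis (i, [], i) \<otimes>\<^bsub>?R\<^esub> f \<otimes>\<^bsub>?R\<^esub> path_basis (j, [], j) = path_emb i j (\<lambda>p. f (i, p, j))"
      unfolding D.path_algebra_corner[OF graded[OF that]] by (auto simp: path_emb_def fun_eq_iff)
    finally show ?thesis .
  qed
  show ?thesis
  proof (intro equalityI subsetI)
    fix X assume "X \<in> (\<lambda>x. preproj_idem G i \<otimes>\<^bsub>?P\<^esub> x \<otimes>\<^bsub>?P\<^esub> preproj_idem G j) ` preproj_graded G n"
    then obtain f where f: "f \<in> path_graded (double_quiver G) n"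
      "X = preproj_idem G i \<otimes>\<^bsub>?P\<^esub> preproj_class G f \<otimes>\<^bsub>?P\<^esub> preproj_idem G j"
      by (auto simp: preproj_graded_def)
    have "(\<lambda>p. f (i, p, j)) \<in> ?U"
      using f(1) by (auto simp: path_graded_def path_algebra_def paths_of_length_def)
    then show "X \<in> (\<lambda>f. preproj_class G (path_emb i j f)) ` ?U"
      using corner[OF f(1)] f(2) by blast
  next
    fix X assume "X \<in> (\<lambda>f. preproj_class G (path_emb i j f)) ` ?U"
    then obtain f where f: "f \<in> ?U" "X = preproj_class G (path_emb i j f)" by blast
    have g: "path_emb i j f \<in> path_graded (double_quiver G) n" using f(1) by (intro path_emb_graded) auto
    have "X = preproj_idem G i \<otimes>\<^bsub>?P\<^esub> preproj_class G (path_emb i j f) \<otimes>\<^bsub>?P\<^esub> preproj_idem G j"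
      unfolding corner[OF g] f(2) by (simp add: path_emb_def)
    then show "X \<in> (\<lambda>x. preproj_idem G i \<otimes>\<^bsub>?P\<^esub> x \<otimes>\<^bsub>?P\<^esub> preproj_idem G j) ` preproj_graded G n"
      using g unfolding preproj_graded_def by blast
  qed
qed

text \<open>\<open>C\<close> spans the kernel of the class map, so the classes of \<open>E\<close>
  are a basis of the image. As \<open>ring.dimension\<close> grows by line extensions, the elements
  of \<open>E\<close> are added one at a time.\<close>

lemma dimension_class_span:
  fixes C E :: "(('b + 'b) list \<Rightarrow> 'k::field) set"
  assumes fin: "finite E" and ind: "\<not> fs.dependent (C \<union> E)" and disj: "C \<inter> E = {}"
    and carr: "\<And>f. f \<in> fs.span (C \<union> E) \<Longrightarrow> path_emb i j f \<in> carrier (path_algebra (double_quiver G))"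
    and ker: "\<And>f. f \<in> fs.span (C \<union> E) \<Longrightarrow> path_emb i j f \<in> mesh_ideal G \<longleftrightarrow> f \<in> fs.span C"
  shows "ring.dimension (preproj_algebra G) (card E) (preproj_scalars G)
    ((\<lambda>f. preproj_class G (path_emb i j f)) ` fs.span (C \<union> E))"
proof -
  let ?R = "path_algebra (double_quiver G) :: (('a, 'b + 'b) path \<Rightarrow> 'k) ring"
  let ?P = "preproj_algebra G :: (('a, 'b + 'b) path \<Rightarrow> 'k) set ring"
  let ?\<Psi> = "\<lambda>f. preproj_class G (path_emb i j f)"
  interpret R: ring ?R by (rule D.path_algebra_ring)
  interpret P: ring ?P by (rule preproj_algebra_ring)
  interpret h: ring_hom_ring ?R ?P "preproj_class G" by (rule preproj_hom)
  have "P.dimension (card F) (preproj_scalars G) (?\<Psi> ` fs.span (C \<union> F))" if "F \<subseteq> E" for F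
    using finite_subset[OF that fin] that
  proof (induction F)
    case empty
    have "?\<Psi> f = \<zero>\<^bsub>?P\<^esub>" if "f \<in> fs.span C" for f
    proof -
      have f: "f \<in> fs.span (C \<union> E)" using that fs.span_mono[of C "C \<union> E"] by blast
      then have "path_emb i j f \<in> mesh_ideal G" using ker that by blast
      moreover have "(\<lambda>x. path_emb i j f x - \<zero>\<^bsub>?R\<^esub> x) = path_emb i j f" by (simp add: path_algebra_def)
      ultimately have "?\<Psi> f = preproj_class G \<zero>\<^bsub>?R\<^esub>"
        using preproj_class_eq_iff[OF carr[OF f] R.zero_closed] by simp
      then show ?thesis by simp
    qed
    then have "?\<Psi> ` fs.span C = {\<zero>\<^bsub>?P\<^esub>}" using fs.span_zero by blast
    then show ?case using P.zero_dim by simp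
  next
    case (insert d F)
    have dF: "d \<in> fs.span (C \<union> E)" using insert.prems fs.span_base by blast
    have F: "fs.span (C \<union> F) \<subseteq> fs.span (C \<union> E)"
      using insert.prems by (intro fs.span_mono) auto
    have nd: "d \<notin> fs.span (C \<union> F)"
    proof -
      have "C \<union> F \<subseteq> C \<union> E - {d}" using insert disj by auto
      then show ?thesis using ind insert.prems fs.span_mono unfolding fs.dependent_def by blast
    qed
    have scale: "preproj_class G (\<lambda>x. c * \<one>\<^bsub>?R\<^esub> x) \<otimes>\<^bsub>?P\<^esub> ?\<Psi> d = ?\<Psi> (\<lambda>p. c * d p)" for c
    proof -
      have "(\<lambda>x. c * \<one>\<^bsub>?R\<^esub> x) \<in> carrier ?R" using R.one_closed by (auto simp: path_algebra_def)
      then have "preproj_class G (\<lambda>x. c * \<one>\<^bsub>?R\<^esub> x) \<otimes>\<^bsub>?P\<^esub> ?\<Psi> d =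
          preproj_class G ((\<lambda>x. c * \<one>\<^bsub>?R\<^esub> x) \<otimes>\<^bsub>?R\<^esub> path_emb i j d)"
        using carr[OF dF] by simp
      then show ?thesis
        using carr[OF dF] by (simp add: D.path_algebra_scalar_mult path_emb_simps)
    qed
    have add: "?\<Psi> (f + g) = ?\<Psi> f \<oplus>\<^bsub>?P\<^esub> ?\<Psi> g" if "f \<in> fs.span (C \<union> E)" "g \<in> fs.span (C \<union> E)" for f g
    proof -
      have "path_emb i j (f + g) = path_emb i j f \<oplus>\<^bsub>?R\<^esub> path_emb i j g"
        by (simp add: path_emb_simps path_algebra_def)
      then show ?thesis using carr[OF that(1)] carr[OF that(2)] by simp
    qed
    have "?\<Psi> d \<notin> ?\<Psi> ` fs.span (C \<union> F)"
    proof
      assume "?\<Psi> d \<in> ?\<Psi> ` fs.span (C \<union> F)"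
      then obtain u where u: "u \<in> fs.span (C \<union> F)" "?\<Psi> d = ?\<Psi> u" by blast
      then have "path_emb i j (d - u) \<in> mesh_ideal G"
        using preproj_class_eq_iff[OF carr[OF dF] carr[of u]] F unfolding path_emb_simps by blast
      then have "d - u \<in> fs.span C" using ker fs.span_diff[OF dF, of u] u F by blast
      then have "d - u \<in> fs.span (C \<union> F)" using fs.span_mono[of C "C \<union> F"] by blast
      then have "d - u + u \<in> fs.span (C \<union> F)" using u(1) by (rule fs.span_add)
      then show False using nd by simp
    qed
    moreover have "?\<Psi> d \<in> carrier ?P" using carr[OF dF] by simp
    moreover have "P.dimension (card F) (preproj_scalars G) (?\<Psi> ` fs.span (C \<union> F))"
      using insert by blast
    ultimately have "P.dimension (Suc (card F)) (preproj_scalars G)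
        (P.line_extension (preproj_scalars G) (?\<Psi> d) (?\<Psi> ` fs.span (C \<union> F)))"
      by (intro P.Suc_dim)
    moreover have "P.line_extension (preproj_scalars G) (?\<Psi> d) (?\<Psi> ` fs.span (C \<union> F)) =
        ?\<Psi> ` fs.span (insert d (C \<union> F))"
    proof (intro equalityI subsetI)
      fix X assume "X \<in> P.line_extension (preproj_scalars G) (?\<Psi> d) (?\<Psi> ` fs.span (C \<union> F))"
      then obtain c u where u: "u \<in> fs.span (C \<union> F)"
        "X = preproj_class G (\<lambda>x. c * \<one>\<^bsub>?R\<^esub> x) \<otimes>\<^bsub>?P\<^esub> ?\<Psi> d \<oplus>\<^bsub>?P\<^esub> ?\<Psi> u"
        by (auto simp: P.line_extension_mem_iff preproj_scalars_def path_scalars_def)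
      have "X = ?\<Psi> ((\<lambda>p. c * d p) + u)"
        unfolding u(2) scale using fs.span_scale[OF dF] u(1) F by (intro add[symmetric]) auto
      moreover have "(\<lambda>p. c * d p) + u \<in> fs.span (insert d (C \<union> F))"
      proof (rule fs.span_add)
        show "(\<lambda>p. c * d p) \<in> fs.span (insert d (C \<union> F))"
          by (intro fs.span_scale fs.span_base) simp
        show "u \<in> fs.span (insert d (C \<union> F))"
          using u(1) fs.span_mono[OF subset_insertI] by blast
      qed
      ultimately show "X \<in> ?\<Psi> ` fs.span (insert d (C \<union> F))" by blast
    next
      fix X assume "X \<in> ?\<Psi> ` fs.span (insert d (C \<union> F))"
      then obtain x where x: "x \<in> fs.span (insert d (C \<union> F))" "X = ?\<Psi> x" by blast
      then obtain c where c: "x - (\<lambda>p. c * d p) \<in> fs.span (C \<union> F)"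
        unfolding fs.span_breakdown_eq by blast
      have "X = ?\<Psi> ((\<lambda>p. c * d p) + (x - (\<lambda>p. c * d p)))" using x by simp
      also have "\<dots> = preproj_class G (\<lambda>x. c * \<one>\<^bsub>?R\<^esub> x) \<otimes>\<^bsub>?P\<^esub> ?\<Psi> d \<oplus>\<^bsub>?P\<^esub> ?\<Psi> (x - (\<lambda>p. c * d p))"
        unfolding scale using fs.span_scale[OF dF] c F by (intro add) auto
      finally show "X \<in> P.line_extension (preproj_scalars G) (?\<Psi> d) (?\<Psi> ` fs.span (C \<union> F))"
        unfolding P.line_extension_mem_iff preproj_scalars_def path_scalars_def using c by blast
    qed
    ultimately show ?case using insert.hyps by simp
  qed
  then show ?thesis by blast
qed

text \<open>The scalars survive because the unit is not in the mesh ideal: the indicator of a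
  trivial path is harmonic, mesh terms having length at least two, and takes the value 1 on the
  unit.\<close>

lemma preproj_scalars_subfield:
  assumes "verts G \<noteq> {}"
  shows "subfield (preproj_scalars G) (preproj_algebra G :: (('a, 'b + 'b) path \<Rightarrow> 'k::field) set ring)"
proof -
  let ?R = "path_algebra (double_quiver G) :: (('a, 'b + 'b) path \<Rightarrow> 'k) ring"
  let ?P = "preproj_algebra G :: (('a, 'b + 'b) path \<Rightarrow> 'k) set ring"
  interpret R: ring ?R by (rule D.path_algebra_ring)
  interpret h: ring_hom_ring ?R ?P "preproj_class G" by (rule preproj_hom)
  obtain i where "i \<in> verts G" using assms by blast
  have V: "verts (double_quiver G) = verts G" by (simp add: double_quiver_def)
  have "mesh_harmonic G (path_basis (i, [], i) :: ('a, 'b + 'b) path \<Rightarrow> 'k)"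
    by (auto simp: mesh_harmonic_def path_basis_def)
  moreover have "path_pairing (path_basis (i, [], i)) \<one>\<^bsub>?R\<^esub> = \<one>\<^bsub>?R\<^esub> (i, [], i)"
    by (rule path_pairing_delta[OF D.path_algebra_carrierD(1)[OF R.one_closed]])
  moreover have "\<one>\<^bsub>?R\<^esub> (i, [], i) = 1" using \<open>i \<in> verts G\<close> V by (auto simp: path_algebra_def)
  ultimately have "\<one>\<^bsub>?R\<^esub> \<notin> mesh_ideal G"
    using harmonic_annihilates_mesh_ideal by fastforce
  moreover have "(\<lambda>x. \<one>\<^bsub>?R\<^esub> x - \<zero>\<^bsub>?R\<^esub> x) = \<one>\<^bsub>?R\<^esub>" by (simp add: path_algebra_def)
  ultimately have "\<one>\<^bsub>?P\<^esub> \<noteq> \<zero>\<^bsub>?P\<^esub>"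
    using preproj_class_eq_iff[OF R.one_closed R.zero_closed] by simp
  then show ?thesis
    unfolding preproj_scalars_def
    using h.img_is_subfield(2) D.path_scalars_subfield V assms by metis
qed

end


section \<open>The Hilbert series\<close>

lemma mesh_double_quiver:
  assumes "fin_digraph Q"
  shows "mesh (arcs (double_quiver Q)) (tail (double_quiver Q)) (head (double_quiver Q)) opp_arrow
    (arrow_sign :: _ \<Rightarrow> 'k::field)"
proof -
  interpret fin_digraph Q by fact
  show ?thesis
    by unfold_locales (auto simp: double_quiver_def opp_arrow_def arrow_sign_def)
qed

abbreviation mesh_functions ::
    "('v::finite, 'a) pre_digraph \<Rightarrow> 'v \<Rightarrow> nat \<Rightarrow> 'v \<Rightarrow> (('a + 'a) list \<Rightarrow> 'k::field) set" where
  "mesh_functions Q j \<equiv> mesh.G (arcs (double_quiver Q)) (tail (double_quiver Q))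
     (head (double_quiver Q)) opp_arrow arrow_sign j"

text \<open>In one direction a mesh function, extended by zero, is harmonic on all paths. In the
  other, an annihilating function is tested on the inserted mesh relations of this corner and
  degree.\<close>

lemma annihilator_mesh_ideal:
  fixes Q :: "('v::finite, 'a) pre_digraph" and i j :: 'v and n :: nat
  assumes fin: "fin_digraph Q" and V: "verts Q = UNIV"
  defines "L \<equiv> paths_of_length Q i j n"
  shows "{g. (\<forall>p. g p \<noteq> 0 \<longrightarrow> p \<in> L) \<and> (\<forall>f\<in>{f. (\<forall>p. f p \<noteq> 0 \<longrightarrow> p \<in> L) \<and> path_emb i j f \<in> mesh_ideal Q}.
      (\<Sum>p\<in>L. g p * f p) = 0)} = (mesh_functions Q j (Suc n) i :: (_ \<Rightarrow> 'k::field) set)"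
proof -
  interpret fin_digraph Q by fact
  interpret M: mesh "arcs (double_quiver Q)" "tail (double_quiver Q)" "head (double_quiver Q)"
    opp_arrow "arrow_sign :: _ \<Rightarrow> 'k" j by (rule mesh_double_quiver[OF fin])
  have out: "M.out k = arrows_from Q k" for k by (simp add: M.out_def arrows_from_def)
  have "verts (double_quiver Q) = UNIV" by (simp add: double_quiver_def V)
  then have walk: "(u, p, v) \<in> paths (double_quiver Q) \<longleftrightarrow> M.walk u p v" for u p v
    by (induction p arbitrary: u)
      (auto simp: paths_def pre_digraph.awalk_def pre_digraph.cas.simps M.out_def)
  have L: "finite L" "p \<in> L \<longleftrightarrow> M.walk i p j \<and> length p = n" for p
    unfolding L_def by (rule finite_paths_of_length) (simp add: paths_of_length_def walk)
  show ?thesis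
  proof (intro equalityI subsetI CollectI conjI)
    fix g :: "('a + 'a) list \<Rightarrow> 'k" assume g: "g \<in> M.G (Suc n) i"
    show supp: "\<forall>p. g p \<noteq> 0 \<longrightarrow> p \<in> L" using g unfolding M.G_Suc_iff L(2) by blast
    have "mesh_harmonic Q (path_emb i j g)"
      unfolding mesh_harmonic_def
    proof (intro allI impI)
      fix u p k q v assume pq: "(u, p, k) \<in> paths (double_quiver Q)" "(k, q, v) \<in> paths (double_quiver Q)"
      show "(\<Sum>a\<in>arrows_from Q k. arrow_sign a * path_emb i j g (u, p @ a # opp_arrow a # q, v)) = 0"
      proof (cases "u = i \<and> v = j")
        case True
        then have "M.walk i p k" using pq(1) walk by blast
        then have "(\<Sum>a\<in>arrows_from Q k. arrow_sign a * g (p @ a # opp_arrow a # q)) = 0"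
          using g unfolding M.G_Suc_iff out by blast
        then show ?thesis using True by (simp add: path_emb_def)
      next
        case False
        then have "path_emb i j g (u, p @ a # opp_arrow a # q, v) = 0" for a
          by (auto simp: path_emb_def)
        then show ?thesis by simp
      qed
    qed
    then have pair: "path_pairing (path_emb i j g) (path_emb i j f) = 0" if "path_emb i j f \<in> mesh_ideal Q" for f
      using that by (rule harmonic_annihilates_mesh_ideal)
    show "\<forall>f\<in>{f. (\<forall>p. f p \<noteq> 0 \<longrightarrow> p \<in> L) \<and> path_emb i j f \<in> mesh_ideal Q}. (\<Sum>p\<in>L. g p * f p) = 0"
    proof
      fix f assume "f \<in> {f. (\<forall>p. f p \<noteq> 0 \<longrightarrow> p \<in> L) \<and> path_emb i j f \<in> (mesh_ideal Q :: (_ \<Rightarrow> 'k) set)}"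
      then have f: "\<And>p. f p \<noteq> 0 \<Longrightarrow> p \<in> L" "path_emb i j f \<in> mesh_ideal Q" by auto
      show "(\<Sum>p\<in>L. g p * f p) = 0"
        using path_pairing_emb[OF L(1) f(1), where i = i and j = j and g = g] pair[OF f(2)] by simp
    qed
  next
    fix g :: "('a + 'a) list \<Rightarrow> 'k"
    assume "g \<in> {g. (\<forall>p. g p \<noteq> 0 \<longrightarrow> p \<in> L) \<and>
      (\<forall>f\<in>{f. (\<forall>p. f p \<noteq> 0 \<longrightarrow> p \<in> L) \<and> path_emb i j f \<in> mesh_ideal Q}. (\<Sum>p\<in>L. g p * f p) = 0)}"
    then have supp: "\<And>p. g p \<noteq> 0 \<Longrightarrow> p \<in> L"
      and ann: "\<And>f. (\<And>p. f p \<noteq> 0 \<Longrightarrow> p \<in> L) \<Longrightarrow> path_emb i j f \<in> mesh_ideal Q \<Longrightarrow> (\<Sum>p\<in>L. g p * f p) = 0"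
      by auto
    have "(\<Sum>a\<in>M.out k. arrow_sign a * g (p @ a # opp_arrow a # q)) = 0" if p: "M.walk i p k" for p k q
    proof (cases "M.walk k q j \<and> length p + length q + 2 = n")
      case True
      define b :: "('a + 'a) list \<Rightarrow> 'k"
        where "b x = (\<Sum>a\<in>arrows_from Q k. arrow_sign a * (if x = p @ a # opp_arrow a # q then 1 else 0))" for x
      have W: "p @ a # opp_arrow a # q \<in> L" if "a \<in> arrows_from Q k" for a
      proof -
        have a: "a \<in> arcs (double_quiver Q)" "tail (double_quiver Q) a = k"
          using that by (auto simp: arrows_from_def)
        then have "M.walk k (a # opp_arrow a # q) j"
          using True M.opp_B[OF a(1)] M.src_opp[OF a(1)] M.tgt_opp[OF a(1)] by (simp add: M.out_def)
        then show ?thesis unfolding L(2) M.walk_append using p True by auto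
      qed
      have bL: "x \<in> L" if "b x \<noteq> 0" for x
      proof -
        have "(\<Sum>a\<in>arrows_from Q k. arrow_sign a * (if x = p @ a # opp_arrow a # q then 1 else 0) :: 'k) \<noteq> 0"
          using that by (simp only: b_def not_False_eq_True)
        then show ?thesis
          by (rule sum.not_neutral_contains_not_neutral) (use W in \<open>auto split: if_splits\<close>)
      qed
      have emb_b: "path_emb i j b = (\<lambda>x. \<Sum>a\<in>arrows_from Q k. arrow_sign a *
          path_basis (i, p @ a # opp_arrow a # q, j) x)"
        by (auto simp: path_emb_def b_def path_basis_def fun_eq_iff intro!: sum.cong)
      have "path_emb i j b \<in> mesh_ideal Q"
        unfolding emb_b by (rule mesh_insertion) (use p True walk in auto)
      then have "0 = (\<Sum>x\<in>L. g x * b x)" using ann[of b] bL by auto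
      also have "\<dots> = (\<Sum>a\<in>arrows_from Q k. \<Sum>x\<in>L. if x = p @ a # opp_arrow a # q
          then arrow_sign a * g (p @ a # opp_arrow a # q) else 0)"
        unfolding b_def sum_distrib_left by (subst sum.swap) (intro sum.cong refl, auto)
      also have "\<dots> = (\<Sum>a\<in>arrows_from Q k. arrow_sign a * g (p @ a # opp_arrow a # q))"
        using L(1) W by (intro sum.cong refl) simp
      finally show ?thesis by (simp add: out)
    next
      case False
      \<comment> \<open>An insertion of the wrong length or end point has no term in
        \<open>L\<close>, so the sum vanishes termwise.\<close>
      have "g (p @ a # opp_arrow a # q) = 0" if "a \<in> M.out k" for a
      proof (rule ccontr)
        assume "g (p @ a # opp_arrow a # q) \<noteq> 0"
        then have "M.walk i (p @ a # opp_arrow a # q) j" "length p + length q + 2 = n"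
          using supp unfolding L(2) by fastforce+
        then have "M.walk k (a # opp_arrow a # q) j"
          using p M.walk_unique unfolding M.walk_append by metis
        then have "M.walk k q j"
          using M.tgt_opp[of a] that by (auto simp: M.out_def)
        then show False using False \<open>length p + length q + 2 = n\<close> by blast
      qed
      then show ?thesis by simp
    qed
    then show "g \<in> M.G (Suc n) i"
      unfolding M.G_Suc_iff using supp unfolding L(2) by blast
  qed
qed

text \<open>The corner is the quotient of the functions on the finite set \<open>L\<close> by the
  subspace \<open>N\<close>. It has the dimension of the annihilator of \<open>N\<close>, which is a
  space of mesh functions.\<close>

lemma preproj_corner_dim:
  fixes Q :: "('v::finite, 'a) pre_digraph"
  assumes fin: "fin_digraph Q" and V: "verts Q = UNIV"
  shows "vdim (preproj_algebra Q :: (('v, 'a + 'a) path \<Rightarrow> 'k::field) set ring) (preproj_scalars Q)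
      ((\<lambda>x. preproj_idem Q i \<otimes>\<^bsub>preproj_algebra Q\<^esub> x \<otimes>\<^bsub>preproj_algebra Q\<^esub> preproj_idem Q j) ` preproj_graded Q n) =
    fs.dim (mesh_functions Q j (Suc n) i :: (_ \<Rightarrow> 'k) set)"
proof -
  interpret fin_digraph Q by fact
  let ?R = "path_algebra (double_quiver Q) :: (('v, 'a + 'a) path \<Rightarrow> 'k) ring"
  let ?P = "preproj_algebra Q :: (('v, 'a + 'a) path \<Rightarrow> 'k) set ring"
  interpret R: ring ?R by (rule fin_digraph.path_algebra_ring[OF double_quiver_fin_digraph])
  interpret I: ideal "mesh_ideal Q" ?R by (rule mesh_ideal)
  define L where "L = paths_of_length Q i j n"
  have finL: "finite L" unfolding L_def by (rule finite_paths_of_length)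
  define U where "U = {f :: ('a + 'a) list \<Rightarrow> 'k. \<forall>p. f p \<noteq> 0 \<longrightarrow> p \<in> L}"
  define N where "N = {f. (\<forall>p. f p \<noteq> 0 \<longrightarrow> p \<in> L) \<and> path_emb i j f \<in> (mesh_ideal Q :: (_ \<Rightarrow> 'k) set)}"
  have carr: "path_emb i j f \<in> carrier ?R" if "f \<in> U" for f
    using path_emb_graded[of f i j n] that by (auto simp: U_def L_def path_graded_def)
  have subU: "fs.subspace U" unfolding U_def by (rule supported_subspace)
  have NU: "N \<subseteq> U" by (auto simp: N_def U_def)
  have subN: "fs.subspace N"
  proof -
    have mem: "f \<in> N \<longleftrightarrow> f \<in> U \<and> path_emb i j f \<in> mesh_ideal Q" for f by (simp add: N_def U_def)
    show ?thesis
      unfolding fs.subspace_def mem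
    proof (intro conjI ballI allI)
      have "\<zero>\<^bsub>?R\<^esub> \<in> mesh_ideal Q" by (rule I.zero_closed)
      then show "path_emb i j 0 \<in> (mesh_ideal Q :: (_ \<Rightarrow> 'k) set)"
        by (simp add: path_emb_simps path_algebra_def)
      fix f assume f: "f \<in> N"
      {
        fix g assume g: "g \<in> N"
        have "path_emb i j f \<oplus>\<^bsub>?R\<^esub> path_emb i j g \<in> mesh_ideal Q"
          using f g unfolding mem by (intro I.a_closed) auto
        then show "path_emb i j (f + g) \<in> mesh_ideal Q"
          by (simp add: path_emb_simps path_algebra_def)
        show "f + g \<in> U" using f g unfolding mem by (intro fs.subspace_add[OF subU]) auto
      }
      fix c
      have s: "(\<lambda>x. c * \<one>\<^bsub>?R\<^esub> x) \<in> carrier ?R" using R.one_closed by (auto simp: path_algebra_def)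
      then have "(\<lambda>x. c * \<one>\<^bsub>?R\<^esub> x) \<otimes>\<^bsub>?R\<^esub> path_emb i j f \<in> mesh_ideal Q"
        using f unfolding mem by (intro I.I_l_closed) auto
      then show "path_emb i j (\<lambda>x. c * f x) \<in> mesh_ideal Q"
        using carr f unfolding mem
        by (simp add: fin_digraph.path_algebra_scalar_mult[OF double_quiver_fin_digraph] path_emb_simps)
      show "(\<lambda>x. c * f x) \<in> U" using f unfolding mem by (intro fs.subspace_scale[OF subU]) auto
    qed (rule fs.subspace_0[OF subU])
  qed
  have "fin_dim U" unfolding U_def by (rule fin_dim_supported[OF finL])
  then obtain C E where CE: "finite C" "finite E" "C \<inter> E = {}" "\<not> fs.dependent (C \<union> E)"
    "fs.span C = N" "fs.span (C \<union> E) = U"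
    using complement_basis[OF _ subU subN NU] by metis
  have "ring.dimension ?P (card E) (preproj_scalars Q) ((\<lambda>f. preproj_class Q (path_emb i j f)) ` fs.span (C \<union> E))"
    by (rule dimension_class_span[OF CE(2,4,3)]) (use carr CE(5,6) in \<open>auto simp: N_def U_def\<close>)
  then have "vdim ?P (preproj_scalars Q) ((\<lambda>f. preproj_class Q (path_emb i j f)) ` U) = card E"
    unfolding CE(6) using V
    by (intro vdim_eqI preproj_algebra_ring preproj_scalars_subfield) auto
  also have "card E = fs.dim {g. (\<forall>p. g p \<noteq> 0 \<longrightarrow> p \<in> L) \<and> (\<forall>f\<in>N. (\<Sum>p\<in>L. g p * f p) = 0)}"
    by (rule dim_annihilator[OF finL _ CE(1,2,3,4,5), symmetric]) (simp only: CE(6) U_def)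
  also have "{g. (\<forall>p. g p \<noteq> 0 \<longrightarrow> p \<in> L) \<and> (\<forall>f\<in>N. (\<Sum>p\<in>L. g p * f p) = 0)} =
      mesh_functions Q j (Suc n) i"
    unfolding N_def L_def by (rule annihilator_mesh_ideal[OF fin V])
  finally show ?thesis
    unfolding preproj_corner[OF V] U_def L_def .
qed

theorem theorem3p1:
  fixes Q :: "('v::finite, 'a) pre_digraph"
  defines "h \<equiv> hilbert_series TYPE('k::field) Q"
    and "C \<equiv> adjacency_matrix (double_quiver Q)"
  assumes "fin_digraph Q"
    and "verts Q = UNIV"
    and "Digraph_Component.connected Q"
    and "acyclic_quiver Q"
    and "\<not> dynkin_quiver Q"
  shows "h * (1 - fps_const C * fps_X + fps_X ^ 2) = 1
       \<and> (1 - fps_const C * fps_X + fps_X ^ 2) * h = 1"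
proof -
  interpret fin_digraph Q by fact
  let ?d = "\<lambda>j n i. fs.dim (mesh_functions Q j n i :: (_ \<Rightarrow> 'k) set)"
  \<comment> \<open>Degree \<open>n\<close> is level \<open>Suc n\<close>; the row is the starting
    vertex and the column is the fixed end.\<close>
  have h_entry: "mat_of_sqmat (fps_nth h n) $ i $ j = int (?d j (Suc n) i)" for n i j
    by (simp add: h_def hilbert_series_def dim_matrix_def Sqmat_inverse preproj_corner_dim assms(3,4))
  have C_entry: "mat_of_sqmat C $ i $ k = int (arrow_mult Q i k)" for i k
    by (simp add: C_def adjacency_matrix_def Sqmat_inverse arrow_mult_def)
  have sqmat_eqI: "A = B" if "\<And>i j. mat_of_sqmat A $ i $ j = mat_of_sqmat B $ i $ j" for A B :: "(int, 'v) sqmat"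
    using that by (simp add: mat_of_sqmat_inject[symmetric] vec_eq_iff)
  obtain \<delta> where \<delta>: "superadditive (arrow_mult Q) UNIV \<delta>" "\<And>v. \<delta> v > 0"
    using non_dynkin_superadditive[OF assms(3,5,6,7)] assms(4) by auto
  have sum_out: "(\<Sum>a\<in>arrows_from Q i. f (head (double_quiver Q) a)) = (\<Sum>k\<in>UNIV. arrow_mult Q i k * f k)"
    for f :: "'v \<Rightarrow> nat" and i
  proof -
    have "(\<Sum>a\<in>arrows_from Q i. f (head (double_quiver Q) a)) =
        (\<Sum>k\<in>UNIV. \<Sum>a\<in>{a \<in> arrows_from Q i. head (double_quiver Q) a = k}. f (head (double_quiver Q) a))"
      by (rule sum.group[symmetric]) (auto simp: finite_arrows_from)
    also have "\<dots> = (\<Sum>k\<in>UNIV. arrow_mult Q i k * f k)"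
      by (intro sum.cong refl) (simp add: arrow_mult_def arrows_from_def conj_ac)
    finally show ?thesis .
  qed
  have rec: "?d j (Suc (Suc n)) i + ?d j n i = (\<Sum>k\<in>UNIV. arrow_mult Q i k * ?d j (Suc n) k)"
    and d0: "?d j 0 i = 0" and d1: "?d j (Suc 0) i = (if i = j then 1 else 0)" for i j n
  proof -
    interpret M: mesh "arcs (double_quiver Q)" "tail (double_quiver Q)" "head (double_quiver Q)"
      opp_arrow "arrow_sign :: _ \<Rightarrow> 'k" j by (rule mesh_double_quiver[OF assms(3)])
    have out: "M.out i = arrows_from Q i" for i by (simp add: M.out_def arrows_from_def)
    have "M.mesh_onto n"
      by (rule M.mesh_onto[of \<delta>]) (use \<delta> in \<open>auto simp: out sum_out superadditive_def\<close>)
    then show "?d j (Suc (Suc n)) i + ?d j n i = (\<Sum>k\<in>UNIV. arrow_mult Q i k * ?d j (Suc n) k)"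
      unfolding sum_out[symmetric] using M.dim_G_rec[of n i] by (simp only: out)
    show "?d j 0 i = 0" by (rule M.dim_G_0)
    show "?d j (Suc 0) i = (if i = j then 1 else 0)" by (rule M.dim_G_1)
  qed
  have C_mult: "mat_of_sqmat (C * fps_nth h n) $ i $ j =
      int (\<Sum>k\<in>UNIV. arrow_mult Q i k * ?d j (Suc n) k)" for n i j
    by (simp add: times_sqmat.rep_eq matrix_matrix_mult_def C_entry h_entry)
  have h0: "fps_nth h 0 = 1"
    by (rule sqmat_eqI) (simp add: h_entry d1 one_sqmat.rep_eq mat_def)
  \<comment> \<open>The recursion one degree lower, where level 0 stands for degree -1 and
    contributes nothing.\<close>
  have h1: "fps_nth h 1 = C * fps_nth h 0"
    by (rule sqmat_eqI) (use rec[of _ 0] d0 in \<open>simp add: h_entry C_mult del: of_nat_sum\<close>)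
  have h2: "fps_nth h (Suc (Suc n)) = C * fps_nth h (Suc n) - fps_nth h n" for n
  proof (rule sqmat_eqI)
    fix i j
    have "int (?d j (Suc (Suc (Suc n))) i) + int (?d j (Suc n) i) =
        int (\<Sum>k\<in>UNIV. arrow_mult Q i k * ?d j (Suc (Suc n)) k)"
      by (simp only: of_nat_add[symmetric] rec)
    then show "mat_of_sqmat (fps_nth h (Suc (Suc n))) $ i $ j =
        mat_of_sqmat (C * fps_nth h (Suc n) - fps_nth h n) $ i $ j"
      by (simp add: minus_sqmat.rep_eq C_mult h_entry del: of_nat_sum)
  qed
  \<comment> \<open>The recursion has \<open>C\<close> on the left only. The coefficients are
    polynomials in \<open>C\<close>, so they commute with it, which yields the other product. Two
    neighbours are carried along because the recursion has depth two.\<close>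
  have comm: "C * fps_nth h n = fps_nth h n * C \<and> C * fps_nth h (Suc n) = fps_nth h (Suc n) * C" for n
  proof (induction n)
    case 0
    then show ?case using h0 h1 by simp
  next
    case (Suc n)
    then show ?case unfolding h2 by (simp add: algebra_simps) (metis mult.assoc)
  qed
  have coeff: "fps_nth h n - (if n = 0 then 0 else C * fps_nth h (n - 1)) + (if n < 2 then 0 else fps_nth h (n - 2)) =
      fps_nth 1 n" for n
  proof -
    consider "n = 0" | "n = 1" | m where "n = Suc (Suc m)" by (metis One_nat_def not0_implies_Suc)
    then show ?thesis using h0 h1 h2 by cases auto
  qed
  have "(1 - fps_const C * fps_X + fps_X ^ 2) * h = 1"
  proof (rule fps_ext)
    fix n
    show "fps_nth ((1 - fps_const C * fps_X + fps_X ^ 2) * h) n = fps_nth 1 n"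
      using coeff[of n]
      by (cases "n = 0"; cases "n = 1")
        (simp_all add: distrib_right left_diff_distrib mult.assoc fps_X_power_mult_nth)
  qed
  moreover have "h * (1 - fps_const C * fps_X + fps_X ^ 2) = 1"
  proof (rule fps_ext)
    fix n
    have "fps_nth (h * (fps_const C * fps_X)) n = (if n = 0 then 0 else C * fps_nth h (n - 1))"
      using comm[of "n - 1"] by (simp add: mult.assoc[symmetric])
    then show "fps_nth (h * (1 - fps_const C * fps_X + fps_X ^ 2)) n = fps_nth 1 n"
      using coeff[of n]
      by (cases "n = 0"; cases "n = 1")
        (simp_all add: distrib_left right_diff_distrib fps_X_power_mult_right_nth)
  qed
  ultimately show ?thesis by blast
qed

end
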